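(* Let $0<c\le C$ be constants. For each $n$ let $M=(a_{ij})$ be a deterministic $n\times n$ real matrix with $c\le a_{ij}\le C$ for all $i,j$. Let $D$ be either the Godsil–Gutman estimator or the Barvinok estimator of $\mathrm{per}(M)$. Then, with probability tending to one as $n\to\infty$, $D$ approximates $\mathrm{per}(M)$ within a factor of $\exp(n^{2/3}\log n)$, i.e. $$\exp(-n^{2/3}\log n)\,\mathrm{per}(M)\ \le\ D\ \le\ \exp(n^{2/3}\log n)\,\mathrm{per}(M).$$
   Context: The permanent of an $n\times n$ matrix $M=(a_{ij})$ is $\mathrm{per}(M)=\sum_{\sigma\in S_n}\prod_{i=1}^n a_{i\sigma(i)}$. Given $M$ with nonnegative entries $a_{ij}$ and independent identically distributed random variables $u_{ij}$ ($1\le i,j\le n$) with mean zero and variance one, let $A$ be the random matrix with entries $\sqrt{a_{ij}}\,u_{ij}$; the associated determinant estimator of $\mathrm{per}(M)$ is the random variable $D=(\det A)^2$ (it satisfies $\mathbf{E}(D)=\mathrm{per}(M)$). The Godsil–Gutman estimator is the case where the $u_{ij}$ are iid Bernoulli, taking values $+1$ and $-1$ with probability $1/2$ each; the Barvinok estimator is the case where the $u_{ij}$ are iid standard real Gaussian. *)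

theory Defs
  imports "HOL-Probability.Probability" "Jordan_Normal_Form.Determinant"
begin

definition permanent :: "'a::comm_semiring_1 mat \<Rightarrow> 'a" where
  "permanent M =
    (\<Sum>p\<in>{p. p permutes {0..<dim_row M}}. \<Prod>i = 0..<dim_row M. M $$ (i, p i))"

definition bernoulli_sign_law :: "real measure" where
  "bernoulli_sign_law = distr (measure_pmf (pmf_of_set {-1, 1})) borel (\<lambda>x. x)"

definition std_gaussian_law :: "real measure" where
  "std_gaussian_law = density lborel (\<lambda>x. ennreal (std_normal_density x))"

text \<open>
  The measurability of each \<open>u (i, j)\<close> is part of \<open>indep_vars\<close>.
\<close>

definition iid_entries ::
    "'a measure \<Rightarrow> real measure \<Rightarrow> nat \<Rightarrow> (nat \<times> nat \<Rightarrow> 'a \<Rightarrow> real) \<Rightarrow> bool" where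
  "iid_entries P L n u \<longleftrightarrow>
    prob_space P \<and>
    prob_space.indep_vars P (\<lambda>_. borel) u ({0..<n} \<times> {0..<n}) \<and>
    (\<forall>ij \<in> {0..<n} \<times> {0..<n}. distr P borel (u ij) = L)"

definition estimator_matrix ::
    "real mat \<Rightarrow> (nat \<times> nat \<Rightarrow> 'a \<Rightarrow> real) \<Rightarrow> 'a \<Rightarrow> real mat" where
  "estimator_matrix M u \<omega> =
    Matrix.mat (dim_row M) (dim_col M) (\<lambda>(i, j). sqrt (M $$ (i, j)) * u (i, j) \<omega>)"

definition determinant_estimator ::
    "real mat \<Rightarrow> (nat \<times> nat \<Rightarrow> 'a \<Rightarrow> real) \<Rightarrow> 'a \<Rightarrow> real" where
  "determinant_estimator M u \<omega> = (Determinant.det (estimator_matrix M u \<omega>))\<^sup>2"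

definition godsil_gutman_estimator :: "'a measure \<Rightarrow> real mat \<Rightarrow> ('a \<Rightarrow> real) \<Rightarrow> bool" where
  "godsil_gutman_estimator P M D \<longleftrightarrow>
    (\<exists>u. iid_entries P bernoulli_sign_law (dim_row M) u \<and> D = determinant_estimator M u)"

definition barvinok_estimator :: "'a measure \<Rightarrow> real mat \<Rightarrow> ('a \<Rightarrow> real) \<Rightarrow> bool" where
  "barvinok_estimator P M D \<longleftrightarrow>
    (\<exists>u. iid_entries P std_gaussian_law (dim_row M) u \<and> D = determinant_estimator M u)"

end

theory Submission
  imports Defs "HOL-Real_Asymp.Real_Asymp"
begin

text \<open>
  Write \<open>D = (det A)\<^sup>2\<close>. Since \<open>E D = per M\<close>, Markov's inequality bounds \<open>D\<close> from above. For the
  lower bound it is shown that \<open>ln \<bar>det A\<bar>\<close> is concentrated, and that its typical value cannot lie far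
  below \<open>ln (per M) / 2\<close>. The two laws enter through their moments: mean 0, variance 1, and a fourth
  moment of at most 3. Three facts carry the argument.

  \<^item> \<open>D\<close> is comparable with its mean on an event that is not too unlikely. Expand the fourth power
  of the determinant over four permutations. A quadruple contributes only if in every row the four
  chosen columns form two pairs. Given a choice of the pairing in every row, the quadruple amounts to
  two permutations \<open>p, p'\<close> together with a 3-colouring of the rows that is invariant under
  \<open>p'\<^sup>-\<^sup>1 p\<close>. Hence \<open>E D\<^sup>2 / (E D)\<^sup>2\<close> is at most the mean of 3 to the number of cycles of a random
  permutation whose weight is a product of factors from \<open>[c, C]\<close>. If \<open>k\<close> is the least element
  of its cycle, then composing with the transposition of \<open>k\<close> and any \<open>i < k\<close> merges two cycles and changes
  the weight by a factor of at most \<open>(C/c)\<^sup>2\<close>; so \<open>k\<close> is least in its cycle with probability at most of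
  order \<open>1/k\<close>, and the mean is polynomial in \<open>n\<close> (\<open>paired_permutations_sum_le\<close>). By the Paley-Zygmund
  inequality \<open>D \<ge> per M / 2\<close> has probability at least an inverse power of \<open>n\<close>
  (\<open>det_anticoncentration\<close>).

  \<^item> On the matrices with entries at most \<open>exp (n^(1/10))\<close> there is a function that dominates
  \<open>ln \<bar>det A\<bar>\<close>, equals it when \<open>A\<close> has an inverse with entries at most \<open>exp (6 n^(1/10))\<close>, and
  changes by at most \<open>b = O(n^(1/10))\<close> when one row of \<open>A\<close> is changed: the logarithm of \<open>sup_det\<close>, a
  maximum over all ways to replace some of the rows at a cost of \<open>b\<close> per row. By the bounded differences inequality it leaves its mean by \<open>n^(13/20)\<close> only with a probability that
  is smaller than any power of \<open>n\<close>. The event \<open>D \<ge> per M / 2\<close> is too likely to lie in this tail,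
  so the mean is at least \<open>ln (per M) / 2 - O(n^(13/20))\<close> (\<open>det_lower_tail\<close>).

  \<^item> With probability tending to one, no \<open>x\<close> of maximum norm 1 has \<open>\<bar>A x\<bar> \<le> exp (- 6 n^(1/10))\<close>
  in maximum norm, so that the second fact applies to \<open>A\<close> itself
  (\<open>invertible_with_high_probability\<close>). Vectors with few large coordinates are excluded by a union
  bound over a grid. If an \<open>x\<close> with many large coordinates violated this, many columns of \<open>A\<close> would
  be close to the span of the other columns; each column is so with small probability by a
  Littlewood-Offord inequality (\<open>littlewood_offord\<close>).

  Since \<open>n^(13/20)\<close> is of smaller order than \<open>n^(2/3) ln n\<close>, this gives the theorem.
\<close>

section \<open>Permutations with bounded weights\<close>

abbreviation "swap \<equiv> Transposition.transpose"

abbreviation "perms n \<equiv> {p. p permutes {0..<n::nat}}"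

definition weight :: "nat \<Rightarrow> (nat \<Rightarrow> nat \<Rightarrow> real) \<Rightarrow> (nat \<Rightarrow> nat) \<Rightarrow> real" where
  "weight n b \<sigma> = (\<Prod>i=0..<n. b i (\<sigma> i))"

text \<open>
  The number \<open>j\<close> is the least element of its cycle under \<open>\<tau>\<close>. Stating this by an invariant set avoids
  powers of \<open>\<tau>\<close>: the sets for a permutation and for its product with a transposition are unions
  and differences of one another.
\<close>

definition orbit_min :: "nat \<Rightarrow> (nat \<Rightarrow> nat) \<Rightarrow> nat \<Rightarrow> bool" where
  "orbit_min n \<tau> j \<longleftrightarrow> (\<exists>S. j \<in> S \<and> \<tau> ` S \<subseteq> S \<and> S \<subseteq> {j..<n})"

lemma orbit_min_invariant_set:
  assumes "orbit_min n \<tau> j" "\<tau> permutes {0..<n}"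
  shows "\<exists>S. j \<in> S \<and> (\<forall>x. \<tau> x \<in> S \<longleftrightarrow> x \<in> S) \<and> S \<subseteq> {j..<n}"
proof -
  from assms(1) obtain S where S: "j \<in> S" "\<tau> ` S \<subseteq> S" "S \<subseteq> {j..<n}"
    unfolding orbit_min_def by blast
  have "finite S" using S(3) finite_subset by blast
  moreover have "inj_on \<tau> S" using permutes_inj_on[OF assms(2)] .
  ultimately have "\<tau> ` S = S" using S(2) endo_inj_surj by blast
  then have "\<tau> x \<in> S \<longleftrightarrow> x \<in> S" for x
    using permutes_inj[OF assms(2)] inj_image_mem_iff[of \<tau> x S] by simp
  then show ?thesis using S by blast
qed

text \<open>
  Composing with the transposition of \<open>k\<close> and \<open>i < k\<close> merges the cycle of \<open>k\<close>, all of whose elements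
  are at least \<open>k\<close>, into the cycle of \<open>i\<close>. Minima below \<open>k\<close> are not affected.
\<close>

lemma orbit_min_switch:
  assumes \<tau>: "\<tau> permutes {0..<n}" and k: "orbit_min n \<tau> k" and i: "i < k"
    and j: "orbit_min n \<tau> j" "j < k"
  shows "orbit_min n (\<tau> \<circ> swap k i) j"
proof -
  obtain Sk where Sk0: "k \<in> Sk \<and> (\<forall>x. \<tau> x \<in> Sk \<longleftrightarrow> x \<in> Sk) \<and> Sk \<subseteq> {k..<n}"
    using orbit_min_invariant_set[OF k \<tau>] ..
  note Sk = conjunct1[OF Sk0] spec[OF conjunct1[OF conjunct2[OF Sk0]]] conjunct2[OF conjunct2[OF Sk0]]
  obtain Sj where Sj0: "j \<in> Sj \<and> (\<forall>x. \<tau> x \<in> Sj \<longleftrightarrow> x \<in> Sj) \<and> Sj \<subseteq> {j..<n}"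
    using orbit_min_invariant_set[OF j(1) \<tau>] ..
  note Sj = conjunct1[OF Sj0] spec[OF conjunct1[OF conjunct2[OF Sj0]]] conjunct2[OF conjunct2[OF Sj0]]
  have ik: "i \<notin> Sk" using Sk(3) i by auto
  show ?thesis
  proof (cases "i \<in> Sj")
    case True
    have "(\<tau> \<circ> swap k i) ` (Sj \<union> Sk) \<subseteq> Sj \<union> Sk"
      using True Sk(1) by (auto simp: Sk(2) Sj(2) Transposition.transpose_def)
    moreover have "Sj \<union> Sk \<subseteq> {j..<n}" using Sj(3) Sk(3) j(2) by fastforce
    ultimately show ?thesis unfolding orbit_min_def using Sj(1) by (intro exI[of _ "Sj \<union> Sk"]) simp
  next
    case False
    have "(\<tau> \<circ> swap k i) ` (Sj - Sk) \<subseteq> Sj - Sk"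
      using False Sk(1) ik by (auto simp: Sk(2) Sj(2) Transposition.transpose_def split: if_splits)
    moreover have "j \<in> Sj - Sk" using Sj(1) Sk(3) j(2) by auto
    moreover have "Sj - Sk \<subseteq> {j..<n}" using Sj(3) by blast
    ultimately show ?thesis unfolding orbit_min_def by (intro exI[of _ "Sj - Sk"]) simp
  qed
qed

text \<open>
  Going backwards from \<open>k\<close> along the merged cycle, the first element below \<open>k\<close> is \<open>i\<close>; so the merged
  permutation determines \<open>i\<close>, and then \<open>\<tau>\<close>. In the proof, if \<open>i \<noteq> j\<close>, the intersection of
  the two old cycles of \<open>k\<close> would be invariant, although the merged permutation leads out of it at \<open>k\<close>.
\<close>

lemma orbit_min_switch_inj:
  assumes \<tau>: "\<tau> permutes {0..<n}" "orbit_min n \<tau> k" "i < k"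
    and \<rho>: "\<rho> permutes {0..<n}" "orbit_min n \<rho> k" "j < k"
    and eq: "\<tau> \<circ> swap k i = \<rho> \<circ> swap k j"
  shows "i = j \<and> \<tau> = \<rho>"
proof -
  obtain S where S0: "k \<in> S \<and> (\<forall>x. \<tau> x \<in> S \<longleftrightarrow> x \<in> S) \<and> S \<subseteq> {k..<n}"
    using orbit_min_invariant_set[OF \<tau>(2,1)] ..
  note S = conjunct1[OF S0] spec[OF conjunct1[OF conjunct2[OF S0]]] conjunct2[OF conjunct2[OF S0]]
  obtain R where R0: "k \<in> R \<and> (\<forall>x. \<rho> x \<in> R \<longleftrightarrow> x \<in> R) \<and> R \<subseteq> {k..<n}"
    using orbit_min_invariant_set[OF \<rho>(2,1)] ..
  note R = conjunct1[OF R0] spec[OF conjunct1[OF conjunct2[OF R0]]] conjunct2[OF conjunct2[OF R0]]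
  define f where "f = \<tau> \<circ> swap k i"
  have f1: "f y = \<tau> (swap k i y)" for y by (simp add: f_def)
  have f2: "f y = \<rho> (swap k j y)" for y
    unfolding f_def eq by simp
  have nin: "i \<notin> S" "j \<notin> S" "i \<notin> R" "j \<notin> R" using R(3) S(3) \<tau>(3) \<rho>(3) by auto
  have "i = j"
  proof (rule ccontr)
    assume ne: "i \<noteq> j"
    have pull: "y \<in> S \<inter> R" if y: "f y \<in> S \<inter> R" for y
    proof -
      have "swap k i y \<in> S" using y f1 S(2) by auto
      then have "y \<in> S \<or> y = i" using nin unfolding Transposition.transpose_def by (auto split: if_splits)
      moreover have "swap k j y \<in> R" using y f2 R(2) by auto
      then have "y \<in> R \<or> y = j" using nin unfolding Transposition.transpose_def by (auto split: if_splits)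
      ultimately show "y \<in> S \<inter> R" using nin ne by auto
    qed
    have "bij f" unfolding f_def using permutes_bij[OF \<tau>(1)] by (simp add: bij_comp)
    then have "surj f" by (rule bij_is_surj)
    have "S \<inter> R \<subseteq> f ` (S \<inter> R)"
    proof
      fix z assume z: "z \<in> S \<inter> R"
      obtain y where y: "z = f y" using surjD[OF \<open>surj f\<close>, of z] ..
      have "y \<in> S \<inter> R" using z unfolding y by (rule pull)
      then show "z \<in> f ` (S \<inter> R)" unfolding y by (rule imageI)
    qed
    moreover have "finite (S \<inter> R)" using finite_subset[OF S(3)] by simp
    ultimately have "f ` (S \<inter> R) = S \<inter> R"
      using card_seteq[of "f ` (S \<inter> R)" "S \<inter> R"] card_image_le[of "S \<inter> R" f] by simp
    then have "f k \<in> S" using S(1) R(1) by blast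
    then show False using f1[of k] S(2)[of i] nin by simp
  qed
  moreover have "\<tau> = \<rho>"
  proof -
    have "(\<tau> \<circ> swap k i) \<circ> swap k i
        = (\<rho> \<circ> swap k i) \<circ> swap k i"
      using eq \<open>i = j\<close> by simp
    then show ?thesis by (simp add: comp_assoc)
  qed
  ultimately show ?thesis by blast
qed

lemma weight_nonneg:
  assumes "0 < c" and b: "\<And>i j. i < n \<Longrightarrow> j < n \<Longrightarrow> c \<le> b i j" and \<tau>: "\<tau> permutes {0..<n}"
  shows "0 \<le> weight n b \<tau>"
  unfolding weight_def
proof (rule prod_nonneg)
  fix i assume "i \<in> {0..<n}"
  then have "c \<le> b i (\<tau> i)" using b permutes_in_image[OF \<tau>, of i] by simp
  then show "0 \<le> b i (\<tau> i)" using \<open>0 < c\<close> by linarith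
qed

lemma weight_switch:
  assumes "0 < c" and b: "\<And>i j. i < n \<Longrightarrow> j < n \<Longrightarrow> c \<le> b i j \<and> b i j \<le> C"
    and \<tau>: "\<tau> permutes {0..<n}" and ik: "i < n" "k < n" "i \<noteq> k"
  shows "weight n b \<tau> \<le> (C / c)\<^sup>2 * weight n b (\<tau> \<circ> swap k i)"
proof -
  let ?R = "\<Prod>x\<in>{0..<n} - {k} - {i}. b x (\<tau> x)"
  have split: "(\<Prod>x=0..<n. g x) = g k * (g i * (\<Prod>x\<in>{0..<n} - {k} - {i}. g x))" for g :: "nat \<Rightarrow> real"
    using ik by (subst prod.remove[of _ k], simp, simp, subst prod.remove[of _ i]) auto
  have in': "\<tau> x < n" if "x < n" for x using permutes_in_image[OF \<tau>, of x] that by simp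
  have bl: "c \<le> b x y" and bu: "b x y \<le> C" and b0: "0 \<le> b x y" if "x < n" "y < n" for x y
    using b[OF that] \<open>0 < c\<close> by auto
  have R: "?R \<ge> 0" using b0 in' by (intro prod_nonneg) auto
  have w2: "weight n b (\<tau> \<circ> swap k i) = b k (\<tau> i) * (b i (\<tau> k) * ?R)"
    unfolding weight_def by (subst split) (auto simp: Transposition.transpose_def intro!: prod.cong)
  have "weight n b \<tau> = (b k (\<tau> k) * b i (\<tau> i)) * ?R"
    unfolding weight_def by (subst split) simp
  also have "\<dots> \<le> (C * C) * ?R"
    using bu[OF ik(2) in'[OF ik(2)]] bu[OF ik(1) in'[OF ik(1)]] b0[OF ik(2) in'[OF ik(2)]] b0[OF ik(1) in'[OF ik(1)]] R
    by (intro mult_right_mono mult_mono) linarith+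
  also have "\<dots> = (C / c)\<^sup>2 * (c * c * ?R)" using \<open>0 < c\<close> by (simp add: power2_eq_square)
  also have "\<dots> \<le> (C / c)\<^sup>2 * ((b k (\<tau> i) * b i (\<tau> k)) * ?R)"
    using bl[OF ik(2) in'[OF ik(1)]] bl[OF ik(1) in'[OF ik(2)]] \<open>0 < c\<close> R
    by (intro mult_left_mono mult_right_mono mult_mono) (linarith | simp)+
  finally show ?thesis using w2 by (simp add: mult.assoc)
qed

definition min_weight :: "nat \<Rightarrow> real \<Rightarrow> nat \<Rightarrow> (nat \<Rightarrow> nat) \<Rightarrow> real" where
  "min_weight n \<alpha> k \<tau> = (\<Prod>j=0..<k. if orbit_min n \<tau> j then \<alpha> else 1)"

text \<open>
  The map \<open>(i, \<tau>) \<mapsto> \<tau> \<circ> (k i)\<close> is injective on \<open>k\<close> copies of the permutations for which \<open>k\<close> is least in its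
  cycle, and it costs a factor of at most \<open>(C/c)\<^sup>2\<close>. So these permutations carry at most the fraction
  \<open>(C/c)\<^sup>2 / k\<close> of the total weight.
\<close>

lemma min_weight_sum_step:
  assumes "0 < c" and b: "\<And>i j. i < n \<Longrightarrow> j < n \<Longrightarrow> c \<le> b i j \<and> b i j \<le> C"
    and \<alpha>: "1 \<le> \<alpha>" and k: "0 < k" "k < n"
  shows "(\<Sum>\<tau>\<in>perms n. weight n b \<tau> * min_weight n \<alpha> (Suc k) \<tau>)
     \<le> (1 + (\<alpha> - 1) * (C / c)\<^sup>2 / k) * (\<Sum>\<tau>\<in>perms n. weight n b \<tau> * min_weight n \<alpha> k \<tau>)"
proof -
  let ?P = "perms n"
  let ?K = "{\<tau>. \<tau> permutes {0..<n} \<and> orbit_min n \<tau> k}"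
  let ?g = "\<lambda>\<tau>. weight n b \<tau> * min_weight n \<alpha> k \<tau>"
  let ?h = "\<lambda>(i, \<tau>). \<tau> \<circ> swap k i"
  have finP: "finite ?P" by (simp add: finite_permutations)
  have w0: "0 \<le> weight n b \<tau>" if "\<tau> permutes {0..<n}" for \<tau>
    by (rule weight_nonneg[OF \<open>0 < c\<close> _ that]) (use b in blast)
  have m0: "0 \<le> min_weight n \<alpha> l \<tau>" for l \<tau>
    unfolding min_weight_def using \<alpha> by (intro prod_nonneg) auto
  have tp: "\<tau> \<circ> swap k i permutes {0..<n}" if "\<tau> permutes {0..<n}" "i < k" for \<tau> i
    using that k by (intro permutes_compose permutes_swap_id) auto
  have "real k * (\<Sum>\<tau>\<in>?K. ?g \<tau>) = (\<Sum>(i, \<tau>)\<in>{..<k} \<times> ?K. ?g \<tau>)"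
    by (simp add: sum.cartesian_product[symmetric])
  also have "\<dots> \<le> (\<Sum>x\<in>{..<k} \<times> ?K. (C / c)\<^sup>2 * ?g (?h x))"
  proof (rule sum_mono)
    fix x assume "x \<in> {..<k} \<times> ?K"
    then obtain i \<tau> where x: "x = (i, \<tau>)" and i: "i \<in> {..<k}" and \<tau>: "\<tau> permutes {0..<n}" "orbit_min n \<tau> k" by auto
    have "min_weight n \<alpha> k \<tau> \<le> min_weight n \<alpha> k (\<tau> \<circ> swap k i)"
      unfolding min_weight_def using \<alpha> orbit_min_switch[OF \<tau>, of i] i by (intro prod_mono) auto
    moreover have "weight n b \<tau> \<le> (C / c)\<^sup>2 * weight n b (\<tau> \<circ> swap k i)"
      using weight_switch[OF \<open>0 < c\<close> b \<tau>(1)] i k by auto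
    ultimately have "?g \<tau> \<le> ((C / c)\<^sup>2 * weight n b (\<tau> \<circ> swap k i)) * min_weight n \<alpha> k (\<tau> \<circ> swap k i)"
      using w0[OF tp[OF \<tau>(1)]] w0[OF \<tau>(1)] m0 i by (intro mult_mono) auto
    then show "(case x of (i, \<tau>) \<Rightarrow> ?g \<tau>) \<le> (C / c)\<^sup>2 * ?g (?h x)" by (simp add: mult.assoc x)
  qed
  also have "\<dots> = (C / c)\<^sup>2 * (\<Sum>\<rho>\<in>?h ` ({..<k} \<times> ?K). ?g \<rho>)"
  proof -
    have "inj_on ?h ({..<k} \<times> ?K)"
    proof (rule inj_onI)
      fix x y assume xy: "x \<in> {..<k} \<times> ?K" "y \<in> {..<k} \<times> ?K" "?h x = ?h y"
      then show "x = y"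
        using orbit_min_switch_inj[of "snd x" n k "fst x" "snd y" "fst y"]
        by (cases x; cases y) auto
    qed
    then show ?thesis by (simp add: sum.reindex sum_distrib_left)
  qed
  also have "\<dots> \<le> (C / c)\<^sup>2 * (\<Sum>\<rho>\<in>?P. ?g \<rho>)"
    using tp w0 m0 finP by (intro mult_left_mono sum_mono2) auto
  finally have "(\<Sum>\<tau>\<in>?K. ?g \<tau>) \<le> ((C / c)\<^sup>2 * (\<Sum>\<rho>\<in>?P. ?g \<rho>)) / k"
    using k by (subst pos_le_divide_eq) (simp_all add: mult.commute)
  then have key: "(\<Sum>\<tau>\<in>?K. ?g \<tau>) \<le> (C / c)\<^sup>2 / k * (\<Sum>\<rho>\<in>?P. ?g \<rho>)"
    by (simp only: times_divide_eq_left)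
  have "(\<Sum>\<tau>\<in>?P. weight n b \<tau> * min_weight n \<alpha> (Suc k) \<tau>)
      = (\<Sum>\<tau>\<in>?P. ?g \<tau> + (\<alpha> - 1) * (if orbit_min n \<tau> k then ?g \<tau> else 0))"
    by (rule sum.cong) (auto simp: min_weight_def algebra_simps)
  also have "\<dots> = (\<Sum>\<tau>\<in>?P. ?g \<tau>) + (\<alpha> - 1) * (\<Sum>\<tau>\<in>?K. ?g \<tau>)"
  proof -
    have "(\<Sum>\<tau>\<in>?P. if orbit_min n \<tau> k then ?g \<tau> else 0) = (\<Sum>\<tau>\<in>?K. ?g \<tau>)"
      using finP by (subst sum.inter_filter[symmetric]) auto
    then show ?thesis by (simp add: sum.distrib sum_distrib_left[symmetric])
  qed
  also have "\<dots> \<le> (\<Sum>\<tau>\<in>?P. ?g \<tau>) + (\<alpha> - 1) * ((C / c)\<^sup>2 / k * (\<Sum>\<rho>\<in>?P. ?g \<rho>))"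
    using key \<alpha> by (intro add_left_mono mult_left_mono) auto
  finally show ?thesis by (simp add: algebra_simps)
qed

lemma prod_one_plus_inverse_le_exp:
  fixes n :: nat and K :: real
  assumes "0 \<le> K" and that: "0 < n"
  shows "(\<Prod>k=1..<n. 1 + K / real k) \<le> exp (K * (1 + ln (real n)))"
proof -
  have "(\<Prod>k=1..<n. 1 + K / real k) \<le> (\<Prod>k=1..<n. exp (K / real k))"
    using assms by (intro prod_mono conjI add_nonneg_nonneg exp_ge_add_one_self) auto
  also have "\<dots> = exp (K * (\<Sum>k=1..<n. 1 / real k))"
    by (simp add: exp_sum sum_distrib_left)
  also have "\<dots> \<le> exp (K * (1 + ln (real n)))"
  proof -
    have "(\<Sum>k=1..<n. 1 / real k) \<le> (\<Sum>k=1..n. 1 / real k)" by (intro sum_mono2) auto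
    also have "\<dots> = harm n" by (simp add: harm_def inverse_eq_divide)
    also have "\<dots> \<le> 1 + ln (real n)"
      using euler_mascheroni_sequence_decreasing[of 1 n] that by (simp add: harm_def)
    finally show ?thesis using assms by (simp add: mult_left_mono)
  qed
  finally show ?thesis .
qed

lemma min_weight_sum_bound:
  assumes "0 < c" and b: "\<And>i j. i < n \<Longrightarrow> j < n \<Longrightarrow> c \<le> b i j \<and> b i j \<le> C"
    and \<alpha>: "1 \<le> \<alpha>" and n: "0 < n"
  shows "(\<Sum>\<tau>\<in>perms n. weight n b \<tau> * min_weight n \<alpha> n \<tau>)
     \<le> \<alpha> * exp ((\<alpha> - 1) * (C / c)\<^sup>2 * (1 + ln (real n))) * (\<Sum>\<tau>\<in>perms n. weight n b \<tau>)"
proof -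
  let ?S = "\<lambda>k. \<Sum>\<tau>\<in>perms n. weight n b \<tau> * min_weight n \<alpha> k \<tau>"
  let ?K = "(\<alpha> - 1) * (C / c)\<^sup>2"
  have w0: "0 \<le> weight n b \<tau>" if "\<tau> permutes {0..<n}" for \<tau>
    by (rule weight_nonneg[OF \<open>0 < c\<close> _ that]) (use b in blast)
  have "?S 1 \<le> \<alpha> * ?S 0"
    unfolding sum_distrib_left using \<alpha> w0
    by (intro sum_mono) (auto simp: min_weight_def intro: mult_right_mono[of 1 \<alpha>, simplified])
  have "?S (Suc m) \<le> \<alpha> * (\<Prod>k=1..<Suc m. 1 + ?K / real k) * ?S 0" if "m < n" for m
    using that
  proof (induction m)
    case 0 then show ?case using \<open>?S 1 \<le> \<alpha> * ?S 0\<close> by simp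
  next
    case (Suc m)
    have "?S (Suc (Suc m)) \<le> (1 + ?K / real (Suc m)) * ?S (Suc m)"
      using min_weight_sum_step[OF \<open>0 < c\<close> b \<alpha>, where k = "Suc m"] Suc.prems by auto
    also have "\<dots> \<le> (1 + ?K / real (Suc m)) * (\<alpha> * (\<Prod>k=1..<Suc m. 1 + ?K / real k) * ?S 0)"
      using Suc \<alpha> by (intro mult_left_mono) auto
    finally show ?case by (simp add: mult_ac)
  qed
  from this[of "n - 1"] n have "?S n \<le> \<alpha> * (\<Prod>k=1..<n. 1 + ?K / real k) * ?S 0" by simp
  also have "\<dots> \<le> \<alpha> * exp (?K * (1 + ln (real n))) * ?S 0"
    using prod_one_plus_inverse_le_exp[of ?K n] \<alpha> n w0
    by (intro mult_right_mono mult_left_mono sum_nonneg) (auto simp: min_weight_def)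
  finally show ?thesis by (simp add: min_weight_def)
qed

lemma permutes_less: "p permutes {0..<n} \<Longrightarrow> i < n \<Longrightarrow> p i < (n::nat)"
  using permutes_in_image[of p "{0..<n}" i] by simp

lemma invariant_colouring_funpow:
  fixes n :: nat
  assumes "\<tau> permutes {0..<n}" "\<forall>i<n. T (\<tau> i) = T i" "i < n"
  shows "(\<tau> ^^ m) i < n \<and> T ((\<tau> ^^ m) i) = T i"
proof (induction m)
  case (Suc m)
  then show ?case using assms(2) permutes_less[OF assms(1), of "(\<tau> ^^ m) i"] by simp
qed (use assms in simp)

text \<open>
  A colouring that is constant on cycles is determined by its values at the minima of the cycles.
\<close>

lemma card_invariant_colourings_le:
  assumes \<tau>: "\<tau> permutes {0..<n}"
  shows "real (card {T \<in> {0..<n} \<rightarrow>\<^sub>E {0..<q::nat}. \<forall>i<n. T (\<tau> i) = T i}) \<le> min_weight n (real q) n \<tau>"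
proof -
  let ?A = "{T \<in> {0..<n} \<rightarrow>\<^sub>E {0..<q}. \<forall>i<n. T (\<tau> i) = T i}"
  let ?M = "{j\<in>{0..<n}. orbit_min n \<tau> j}"
  have inj: "inj_on (\<lambda>T. restrict T ?M) ?A"
  proof (rule inj_onI)
    fix T U assume T: "T \<in> ?A" and U: "U \<in> ?A" and eq: "restrict T ?M = restrict U ?M"
    have "i < n \<longrightarrow> T i = U i" for i
    proof (induction i rule: less_induct)
      case (less i)
      show ?case
      proof
        assume i: "i < n"
        show "T i = U i"
        proof (cases "orbit_min n \<tau> i")
          case True
          then show ?thesis using fun_cong[OF eq, of i] i by simp
        next
          case False
          let ?O = "range (\<lambda>m. (\<tau> ^^ m) i)"
          have "i \<in> ?O" by (rule range_eqI[of _ _ 0]) simp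
          moreover have "\<tau> ` ?O \<subseteq> ?O"
          proof
            fix y assume "y \<in> \<tau> ` ?O"
            then obtain m where "y = \<tau> ((\<tau> ^^ m) i)" by auto
            then show "y \<in> ?O" by (intro range_eqI[of _ _ "Suc m"]) simp
          qed
          ultimately have "?O \<subseteq> {i..<n} \<Longrightarrow> orbit_min n \<tau> i"
            unfolding orbit_min_def by (intro exI[of _ ?O] conjI)
          then have "\<not> ?O \<subseteq> {i..<n}" using False by blast
          then obtain m where m: "(\<tau> ^^ m) i \<notin> {i..<n}" by blast
          have 1: "(\<tau> ^^ m) i < n \<and> T ((\<tau> ^^ m) i) = T i"
            using invariant_colouring_funpow[OF \<tau> _ i, of T] T by blast
          have 2: "U ((\<tau> ^^ m) i) = U i"
            using invariant_colouring_funpow[OF \<tau> _ i, of U] U by blast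
          have "(\<tau> ^^ m) i < i" using m 1 by simp
          then show ?thesis using less.IH[of "(\<tau> ^^ m) i"] 1 2 by simp
        qed
      qed
    qed
    moreover have "T \<in> extensional {0..<n}" "U \<in> extensional {0..<n}"
      using T U by (auto simp: PiE_def)
    ultimately show "T = U" by (intro extensionalityI) auto
  qed
  have "card ?A = card ((\<lambda>T. restrict T ?M) ` ?A)" using card_image[OF inj] by simp
  also have "\<dots> \<le> card (?M \<rightarrow>\<^sub>E {0..<q})"
  proof (rule card_mono)
    show "finite (?M \<rightarrow>\<^sub>E {0..<q})" by (rule finite_PiE) auto
    show "(\<lambda>T. restrict T ?M) ` ?A \<subseteq> ?M \<rightarrow>\<^sub>E {0..<q}" by (auto simp: PiE_def Pi_def)
  qed
  also have "\<dots> = q ^ card ?M" 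
  proof -
    have "finite ?M" by simp
    from card_PiE[OF this, of "\<lambda>_. {0..<q}"]
    show ?thesis by (simp only: prod_constant card_atLeastLessThan diff_zero)
  qed
  finally have "real (card ?A) \<le> real (q ^ card ?M)" by (rule of_nat_mono)
  then have "real (card ?A) \<le> real q ^ card ?M" by (simp only: of_nat_power)
  also have "\<dots> = min_weight n (real q) n \<tau>"
  proof -
    have "min_weight n (real q) n \<tau> = (\<Prod>j\<in>?M. real q)"
      unfolding min_weight_def by (subst prod.inter_filter) auto
    then show ?thesis by simp
  qed
  finally show ?thesis .
qed

text \<open>
  The three ways to split four objects into two pairs of equal ones, numbered by \<open>t\<close>.
\<close>

definition pairing :: "nat \<Rightarrow> 'b \<Rightarrow> 'b \<Rightarrow> 'b \<Rightarrow> 'b \<Rightarrow> bool" where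
  "pairing t x1 x2 x3 x4 \<longleftrightarrow>
     (t = 0 \<and> x1 = x2 \<and> x3 = x4) \<or> (t = 1 \<and> x1 = x3 \<and> x2 = x4) \<or> (t = 2 \<and> x1 = x4 \<and> x2 = x3)"

lemma pairing_cases:
  assumes "pairing t x1 x2 x3 x4"
  obtains "t = 0" "x2 = x1" "x4 = x3" | "t = 1" "x3 = x1" "x4 = x2" | "t = 2" "x4 = x1" "x3 = x2"
  using assms unfolding pairing_def by auto

text \<open>
  This turns a quadruple of permutations with a pairing in every row into a second permutation \<open>p'\<close>: in every row,
  \<open>s1\<close> and \<open>p'\<close> take the values of the two pairs. The row types are then a colouring that is compatible
  with \<open>s1\<close> and \<open>p'\<close>.
\<close>

lemma paired_permutations:
  fixes T :: "nat \<Rightarrow> nat"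
  assumes s: "s1 permutes {0..<n}" "s2 permutes {0..<n}" "s3 permutes {0..<n}" "s4 permutes {0..<n}"
    and p: "\<And>i. i < n \<Longrightarrow> pairing (T i) (s1 i) (s2 i) (s3 i) (s4 i)"
  defines "p' \<equiv> \<lambda>i. if i < n \<and> T i = 0 then s3 i else s2 i"
  shows "p' permutes {0..<n}" "\<And>i k. i < n \<Longrightarrow> k < n \<Longrightarrow> s1 i = p' k \<Longrightarrow> T i = T k"
proof -
  have e: "s1 i = s1 k \<Longrightarrow> i = k" "s2 i = s2 k \<Longrightarrow> i = k" "s3 i = s3 k \<Longrightarrow> i = k" "s4 i = s4 k \<Longrightarrow> i = k" for i k
    using s[THEN permutes_inj] by (simp_all add: inj_eq)
  have p'0: "p' i = s3 i" if "i < n" "T i = 0" for i using that by (simp add: p'_def)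
  have p'1: "p' i = s2 i" if "T i \<noteq> 0" for i using that by (simp add: p'_def)
  have "inj_on p' {0..<n}"
  proof (rule inj_onI)
    fix i k assume ik: "i \<in> {0..<n}" "k \<in> {0..<n}" "p' i = p' k"
    then have "i < n" "k < n" by auto
    \<comment> \<open>In all nine cases one of the four permutations takes the value \<open>p' i\<close> at \<open>i\<close> and
      the value \<open>p' k\<close> at \<open>k\<close>.\<close>
    have "s2 i = s2 k \<or> s3 i = s3 k \<or> s4 i = s4 k"
      using p[OF \<open>i < n\<close>] p[OF \<open>k < n\<close>] ik(3) p'0[OF \<open>i < n\<close>] p'0[OF \<open>k < n\<close>] p'1[of i] p'1[of k]
      by (elim pairing_cases) simp_all
    then show "i = k" using e by blast
  qed
  moreover have "p' ` {0..<n} \<subseteq> {0..<n}"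
    unfolding p'_def using permutes_less[OF s(2)] permutes_less[OF s(3)] by auto
  ultimately have "bij_betw p' {0..<n} {0..<n}"
    by (simp add: bij_betw_def endo_inj_surj)
  moreover have "p' x = x" if "x \<notin> {0..<n}" for x
    using that permutes_not_in[OF s(2) that] by (simp add: p'_def)
  ultimately show "p' permutes {0..<n}" by (intro bij_imp_permutes)
  show "T i = T k" if ik: "i < n" "k < n" "s1 i = p' k" for i k
  proof -
    have "T i = T k \<or> s2 i = s2 k \<or> s3 i = s3 k \<or> s4 i = s4 k"
      using p[OF \<open>i < n\<close>] p[OF \<open>k < n\<close>] ik(3) p'0[OF \<open>k < n\<close>] p'1[of k]
      by (elim pairing_cases) simp_all
    then show ?thesis using e by blast
  qed
qed

text \<open>
  Writing \<open>p = p' \<circ> \<tau>\<close> turns compatibility with \<open>p\<close> and \<open>p'\<close> into invariance under \<open>\<tau>\<close>, and the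
  weights of \<open>p\<close> into weights of \<open>\<tau>\<close> for the matrix with columns permuted by \<open>p'\<close>.
\<close>

lemma sum_invariant_colourings:
  assumes "0 < c" and a: "\<And>i j. i < n \<Longrightarrow> j < n \<Longrightarrow> c \<le> a i j \<and> a i j \<le> C" and n: "0 < n"
    and p': "p' permutes {0..<n}"
  shows "(\<Sum>p\<in>perms n. weight n a p *
            real (card {T \<in> {0..<n} \<rightarrow>\<^sub>E {0..<3::nat}. \<forall>i<n. \<forall>k<n. p i = p' k \<longrightarrow> T i = T k}))
     \<le> 3 * exp (2 * (C / c)\<^sup>2 * (1 + ln (real n))) * (\<Sum>p\<in>perms n. weight n a p)"
proof -
  let ?b = "\<lambda>i j. a i (p' j)"
  have in': "p' x < n" if "x < n" for x using permutes_in_image[OF p', of x] that by simp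
  have b: "c \<le> ?b i j \<and> ?b i j \<le> C" if "i < n" "j < n" for i j using a[OF that(1) in'[OF that(2)]] .
  have w: "weight n a (p' \<circ> \<tau>) = weight n ?b \<tau>" for \<tau> by (simp add: weight_def)
  have "(\<Sum>p\<in>perms n. weight n a p *
            real (card {T \<in> {0..<n} \<rightarrow>\<^sub>E {0..<3::nat}. \<forall>i<n. \<forall>k<n. p i = p' k \<longrightarrow> T i = T k}))
    = (\<Sum>\<tau>\<in>perms n. weight n ?b \<tau> *
            real (card {T \<in> {0..<n} \<rightarrow>\<^sub>E {0..<3::nat}. \<forall>i<n. \<forall>k<n. p' (\<tau> i) = p' k \<longrightarrow> T i = T k}))"
    by (subst setum_permutations_compose_left[OF p']) (simp add: w)
  also have "\<dots> \<le> (\<Sum>\<tau>\<in>perms n. weight n ?b \<tau> * min_weight n 3 n \<tau>)"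
  proof (rule sum_mono)
    fix \<tau> assume "\<tau> \<in> {\<tau>. \<tau> permutes {0..<n}}"
    then have \<tau>: "\<tau> permutes {0..<n}" by simp
    have "card {T \<in> {0..<n} \<rightarrow>\<^sub>E {0..<3::nat}. \<forall>i<n. \<forall>k<n. p' (\<tau> i) = p' k \<longrightarrow> T i = T k}
        \<le> card {T \<in> {0..<n} \<rightarrow>\<^sub>E {0..<3::nat}. \<forall>i<n. T (\<tau> i) = T i}"
    proof (rule card_mono)
      show "finite {T \<in> {0..<n} \<rightarrow>\<^sub>E {0..<3::nat}. \<forall>i<n. T (\<tau> i) = T i}"
        by (rule finite_subset[of _ "{0..<n} \<rightarrow>\<^sub>E {0..<3::nat}"]) (auto intro: finite_PiE)
      show "{T \<in> {0..<n} \<rightarrow>\<^sub>E {0..<3::nat}. \<forall>i<n. \<forall>k<n. p' (\<tau> i) = p' k \<longrightarrow> T i = T k}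
        \<subseteq> {T \<in> {0..<n} \<rightarrow>\<^sub>E {0..<3::nat}. \<forall>i<n. T (\<tau> i) = T i}"
      proof (intro subsetI CollectI conjI allI impI)
        fix T i assume T: "T \<in> {T \<in> {0..<n} \<rightarrow>\<^sub>E {0..<3::nat}. \<forall>i<n. \<forall>k<n. p' (\<tau> i) = p' k \<longrightarrow> T i = T k}"
          and i: "i < n"
        have "\<tau> i < n" using permutes_in_image[OF \<tau>, of i] i by simp
        with T i show "T (\<tau> i) = T i" by simp
      qed simp
    qed
    then have "real (card {T \<in> {0..<n} \<rightarrow>\<^sub>E {0..<3::nat}. \<forall>i<n. \<forall>k<n. p' (\<tau> i) = p' k \<longrightarrow> T i = T k})
        \<le> real (card {T \<in> {0..<n} \<rightarrow>\<^sub>E {0..<3::nat}. \<forall>i<n. T (\<tau> i) = T i})"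
      by (rule of_nat_mono)
    also have "\<dots> \<le> min_weight n (real 3) n \<tau>" by (rule card_invariant_colourings_le[OF \<tau>])
    finally have "real (card {T \<in> {0..<n} \<rightarrow>\<^sub>E {0..<3::nat}. \<forall>i<n. \<forall>k<n. p' (\<tau> i) = p' k \<longrightarrow> T i = T k})
        \<le> min_weight n 3 n \<tau>" by simp
    then show "weight n ?b \<tau> * real (card {T \<in> {0..<n} \<rightarrow>\<^sub>E {0..<3::nat}. \<forall>i<n. \<forall>k<n. p' (\<tau> i) = p' k \<longrightarrow> T i = T k})
       \<le> weight n ?b \<tau> * min_weight n 3 n \<tau>"
      using weight_nonneg[OF \<open>0 < c\<close> _ \<tau>, of ?b] b by (intro mult_left_mono) auto
  qed
  also have "\<dots> \<le> 3 * exp ((3 - 1) * (C / c)\<^sup>2 * (1 + ln (real n))) * (\<Sum>\<tau>\<in>perms n. weight n ?b \<tau>)"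
    using min_weight_sum_bound[OF \<open>0 < c\<close> b _ n, where \<alpha> = 3] by simp
  also have "(\<Sum>\<tau>\<in>perms n. weight n ?b \<tau>) = (\<Sum>p\<in>perms n. weight n a p)"
    by (subst setum_permutations_compose_left[OF p', of "weight n a"]) (simp add: w)
  finally show ?thesis by simp
qed

lemma paired_permutations_sum_le:
  assumes "0 < c" and a: "\<And>i j. i < n \<Longrightarrow> j < n \<Longrightarrow> c \<le> a i j \<and> a i j \<le> C" and n: "0 < n"
  defines "P \<equiv> perms n"
  shows "(\<Sum>(s1, s2, s3, s4)\<in>P \<times> P \<times> P \<times> P. \<Sum>T\<in>{0..<n} \<rightarrow>\<^sub>E {0..<3::nat}.
            \<Prod>i=0..<n. of_bool (pairing (T i) (s1 i) (s2 i) (s3 i) (s4 i))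
               * sqrt (a i (s1 i) * a i (s2 i) * a i (s3 i) * a i (s4 i)))
     \<le> 3 * exp (2 * (C / c)\<^sup>2 * (1 + ln (real n))) * (\<Sum>p\<in>P. weight n a p)\<^sup>2"
proof -
  define X where "X = ({0..<n} \<rightarrow>\<^sub>E {0..<3::nat})"
  define F where "F T s = (case s of (s1, s2, s3, s4) \<Rightarrow> \<Prod>i=0..<n. of_bool (pairing (T i) (s1 i) (s2 i) (s3 i) (s4 i))
               * sqrt (a i (s1 i) * a i (s2 i) * a i (s3 i) * a i (s4 i)))" for T :: "nat \<Rightarrow> nat" and s
  define \<phi> where "\<phi> T s = (case s of (s1, s2, s3, s4) \<Rightarrow> (s1, \<lambda>i. if i < n \<and> T i = 0 then s3 i else s2 i))"
    for T :: "nat \<Rightarrow> nat" and s :: "(nat \<Rightarrow> nat) \<times> (nat \<Rightarrow> nat) \<times> (nat \<Rightarrow> nat) \<times> (nat \<Rightarrow> nat)"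
  define comp where "comp T p p' \<longleftrightarrow> (\<forall>i<n. \<forall>k<n. p i = p' k \<longrightarrow> T i = T k)"
    for T :: "nat \<Rightarrow> nat" and p p' :: "nat \<Rightarrow> nat"
  have finP: "finite P" unfolding P_def by (simp add: finite_permutations)
  have finX: "finite X" unfolding X_def by (simp add: finite_PiE)
  have w0: "0 \<le> weight n a p" if "p \<in> P" for p
  proof (rule weight_nonneg[OF \<open>0 < c\<close>])
    show "c \<le> a i j" if "i < n" "j < n" for i j using a[OF that] ..
    show "p permutes {0..<n}" using \<open>p \<in> P\<close> unfolding P_def by (rule CollectD)
  qed
  have per_T: "(\<Sum>s\<in>P \<times> P \<times> P \<times> P. F T s)
      \<le> (\<Sum>(p, p')\<in>P \<times> P. of_bool (comp T p p') * (weight n a p * weight n a p'))" for T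
  proof -
    let ?V = "{s \<in> P \<times> P \<times> P \<times> P. case s of (s1, s2, s3, s4) \<Rightarrow> \<forall>i<n. pairing (T i) (s1 i) (s2 i) (s3 i) (s4 i)}"
    let ?G = "\<lambda>(p, p'). of_bool (comp T p p') * (weight n a p * weight n a p')"
    have sub: "\<phi> T s \<in> P \<times> P \<and> F T s = ?G (\<phi> T s)" if "s \<in> ?V" for s
    proof -
      obtain s1 s2 s3 s4 where s: "s = (s1, s2, s3, s4)" by (cases s)
      define p' where "p' = (\<lambda>i. if i < n \<and> T i = 0 then s3 i else s2 i)"
      have sP: "s1 permutes {0..<n}" "s2 permutes {0..<n}" "s3 permutes {0..<n}" "s4 permutes {0..<n}"
        and pr: "\<And>i. i < n \<Longrightarrow> pairing (T i) (s1 i) (s2 i) (s3 i) (s4 i)"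
        using that unfolding s P_def by simp_all
      
      have p'P: "p' permutes {0..<n}" unfolding p'_def by (rule paired_permutations(1)[OF sP pr])
      have "comp T s1 p'"
        unfolding comp_def p'_def
      proof (intro allI impI)
        fix i k assume "i < n" "k < n" "s1 i = (if k < n \<and> T k = 0 then s3 k else s2 k)"
        then show "T i = T k" using paired_permutations(2)[OF sP, of T i k] pr by simp
      qed
      moreover have "(\<Prod>i=0..<n. of_bool (pairing (T i) (s1 i) (s2 i) (s3 i) (s4 i))
               * sqrt (a i (s1 i) * a i (s2 i) * a i (s3 i) * a i (s4 i))) = (\<Prod>i=0..<n. a i (s1 i) * a i (p' i))"
      proof (rule prod.cong[OF refl])
        fix i assume "i \<in> {0..<n}"
        then have i: "i < n" by simp
        have nn: "0 \<le> a i (s1 i)" "0 \<le> a i (p' i)"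
          using a[OF i permutes_less[OF sP(1) i]] a[OF i permutes_less[OF p'P i]] \<open>0 < c\<close> by linarith+
        have "a i (s1 i) * a i (s2 i) * a i (s3 i) * a i (s4 i) = (a i (s1 i) * a i (p' i))\<^sup>2"
          using pr[OF i]
        proof (cases rule: pairing_cases)
          case 1
          then have "p' i = s3 i" using i by (simp add: p'_def)
          then show ?thesis using 1 by (simp add: power2_eq_square)
        next
          case 2
          then have "p' i = s2 i" using i by (simp add: p'_def)
          then show ?thesis using 2 by (simp add: power2_eq_square)
        next
          case 3
          then have "p' i = s2 i" using i by (simp add: p'_def)
          then show ?thesis using 3 by (simp add: power2_eq_square)
        qed
        then show "of_bool (pairing (T i) (s1 i) (s2 i) (s3 i) (s4 i))
               * sqrt (a i (s1 i) * a i (s2 i) * a i (s3 i) * a i (s4 i)) = a i (s1 i) * a i (p' i)"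
          using pr[OF i] nn by simp
      qed
      moreover have "F T s = (\<Prod>i=0..<n. of_bool (pairing (T i) (s1 i) (s2 i) (s3 i) (s4 i))
               * sqrt (a i (s1 i) * a i (s2 i) * a i (s3 i) * a i (s4 i)))"
        unfolding F_def s by (simp only: prod.case)
      moreover have "\<phi> T s = (s1, p')" unfolding \<phi>_def s p'_def by (simp only: prod.case)
      moreover have "s1 \<in> P" "p' \<in> P" using sP p'P by (simp_all add: P_def)
      ultimately show ?thesis by (simp add: weight_def prod.distrib)
    qed
    have inj: "inj_on (\<phi> T) ?V"
    proof (rule inj_onI)
      fix s r assume s: "s \<in> ?V" and r: "r \<in> ?V" and eq: "\<phi> T s = \<phi> T r"
      obtain s1 s2 s3 s4 where s': "s = (s1, s2, s3, s4)" by (cases s)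
      obtain r1 r2 r3 r4 where r': "r = (r1, r2, r3, r4)" by (cases r)
      have eq1: "s1 = r1" using eq by (simp add: \<phi>_def s' r')
      have eq2: "(if i < n \<and> T i = 0 then s3 i else s2 i) = (if i < n \<and> T i = 0 then r3 i else r2 i)" for i
      proof -
        have "(\<lambda>i. if i < n \<and> T i = 0 then s3 i else s2 i) = (\<lambda>i. if i < n \<and> T i = 0 then r3 i else r2 i)"
          using eq unfolding \<phi>_def s' r' by simp
        then show ?thesis by (rule fun_cong)
      qed
      have "s2 i = r2 i \<and> s3 i = r3 i \<and> s4 i = r4 i" for i
      proof (cases "i < n")
        case True
        then have "pairing (T i) (s1 i) (s2 i) (s3 i) (s4 i)" "pairing (T i) (r1 i) (r2 i) (r3 i) (r4 i)"
          using s r unfolding s' r' by auto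
        then show ?thesis using eq2[of i] True unfolding eq1
          by (elim pairing_cases) (simp_all split: if_splits)
      next
        case False
        then have "i \<notin> {0..<n}" by simp
        then show ?thesis using s r unfolding s' r' P_def by (simp add: permutes_def)
      qed
      then show "s = r" unfolding s' r' using eq1 by auto
    qed
    have "(\<Sum>s\<in>P \<times> P \<times> P \<times> P. F T s) = (\<Sum>s\<in>?V. F T s)"
    proof (rule sum.mono_neutral_right)
      show "\<forall>s\<in>P \<times> P \<times> P \<times> P - ?V. F T s = 0"
      proof
        fix s assume "s \<in> P \<times> P \<times> P \<times> P - ?V"
        moreover obtain s1 s2 s3 s4 where s: "s = (s1, s2, s3, s4)" by (cases s)
        ultimately have "\<exists>i<n. \<not> pairing (T i) (s1 i) (s2 i) (s3 i) (s4 i)" by simp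
        then have "(\<Prod>i=0..<n. of_bool (pairing (T i) (s1 i) (s2 i) (s3 i) (s4 i))
               * sqrt (a i (s1 i) * a i (s2 i) * a i (s3 i) * a i (s4 i))) = 0"
          by (intro prod_zero) auto
        then show "F T s = 0" unfolding F_def s by simp
      qed
    qed (use finP in auto)
    also have "\<dots> = (\<Sum>s\<in>?V. ?G (\<phi> T s))" using sub by (intro sum.cong) auto
    also have "\<dots> = (\<Sum>x\<in>\<phi> T ` ?V. ?G x)" using inj by (simp add: sum.reindex)
    also have "\<dots> \<le> (\<Sum>x\<in>P \<times> P. ?G x)"
    proof (rule sum_mono2)
      show "\<phi> T ` ?V \<subseteq> P \<times> P" using sub by (intro image_subsetI) (rule conjunct1)
      fix x assume "x \<in> P \<times> P - \<phi> T ` ?V"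
      then show "0 \<le> ?G x" using w0 by (auto intro!: mult_nonneg_nonneg)
    qed (use finP in simp)
    finally show ?thesis by simp
  qed
  have "(\<Sum>s\<in>P \<times> P \<times> P \<times> P. \<Sum>T\<in>X. F T s) = (\<Sum>T\<in>X. \<Sum>s\<in>P \<times> P \<times> P \<times> P. F T s)"
    by (rule sum.swap)
  also have "\<dots> \<le> (\<Sum>T\<in>X. \<Sum>(p, p')\<in>P \<times> P. of_bool (comp T p p') * (weight n a p * weight n a p'))"
    by (rule sum_mono) (rule per_T)
  also have "\<dots> = (\<Sum>(p, p')\<in>P \<times> P. \<Sum>T\<in>X. of_bool (comp T p p') * (weight n a p * weight n a p'))"
    unfolding case_prod_unfold by (rule sum.swap)
  also have "\<dots> = (\<Sum>(p, p')\<in>P \<times> P. real (card {T \<in> X. comp T p p'}) * (weight n a p * weight n a p'))"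
  proof (rule sum.cong[OF refl], clarify)
    fix p p'
    have "(\<Sum>T\<in>X. of_bool (comp T p p') :: real) = real (card {T \<in> X. comp T p p'})"
      using finX by (simp add: sum.If_cases of_bool_def Int_def)
    then show "(\<Sum>T\<in>X. of_bool (comp T p p') * (weight n a p * weight n a p'))
       = real (card {T \<in> X. comp T p p'}) * (weight n a p * weight n a p')"
      by (simp add: sum_distrib_right[symmetric])
  qed
  also have "\<dots> = (\<Sum>p'\<in>P. weight n a p' * (\<Sum>p\<in>P. weight n a p * real (card {T \<in> X. comp T p p'})))"
    unfolding sum.cartesian_product[symmetric] by (subst sum.swap) (simp add: sum_distrib_left mult_ac)
  also have "\<dots> \<le> (\<Sum>p'\<in>P. weight n a p' * (3 * exp (2 * (C / c)\<^sup>2 * (1 + ln (real n))) * (\<Sum>p\<in>P. weight n a p)))"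
    using sum_invariant_colourings[OF \<open>0 < c\<close> a n] w0
    by (intro sum_mono mult_left_mono) (auto simp: P_def X_def comp_def)
  also have "\<dots> = 3 * exp (2 * (C / c)\<^sup>2 * (1 + ln (real n))) * (\<Sum>p\<in>P. weight n a p)\<^sup>2"
    by (simp add: sum_distrib_right[symmetric] power2_eq_square)
  finally show ?thesis by (simp add: F_def X_def case_prod_unfold)
qed

section \<open>Linear forms in independent variables\<close>

text \<open>
  The indicator of \<open>Y \<ge> \<mu>/2\<close> is at least \<open>2 l (Y - \<mu>/2) - l\<^sup>2 Y\<^sup>2\<close> for every \<open>l \<ge> 0\<close>; take
  expectations with \<open>l = \<mu> / (2 q)\<close>, which is the best choice.
\<close>

lemma (in prob_space) paley_zygmund:
  fixes Y :: "'a \<Rightarrow> real"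
  assumes Y: "integrable M Y" "integrable M (\<lambda>\<omega>. (Y \<omega>)\<^sup>2)"
    and \<mu>: "0 < \<mu>" "expectation Y = \<mu>" and q: "expectation (\<lambda>\<omega>. (Y \<omega>)\<^sup>2) \<le> q"
  shows "\<mu>\<^sup>2 / (4 * q) \<le> prob {\<omega> \<in> space M. \<mu> / 2 \<le> Y \<omega>}"
proof -
  have [measurable]: "Y \<in> borel_measurable M" using Y(1) by (rule borel_measurable_integrable)
  have "0 \<le> expectation (\<lambda>\<omega>. (Y \<omega> - \<mu>)\<^sup>2)" by (intro Bochner_Integration.integral_nonneg) simp
  also have "expectation (\<lambda>\<omega>. (Y \<omega> - \<mu>)\<^sup>2) = expectation (\<lambda>\<omega>. (Y \<omega>)\<^sup>2) - \<mu>\<^sup>2"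
  proof -
    have "expectation (\<lambda>\<omega>. (Y \<omega> - \<mu>)\<^sup>2) = expectation (\<lambda>\<omega>. (Y \<omega>)\<^sup>2 - 2 * \<mu> * Y \<omega> + \<mu>\<^sup>2)"
      by (simp add: power2_diff algebra_simps)
    also have "\<dots> = expectation (\<lambda>\<omega>. (Y \<omega>)\<^sup>2) - 2 * \<mu> * \<mu> + \<mu>\<^sup>2"
      using Y \<mu> by (simp add: prob_space)
    finally show ?thesis by (simp add: power2_eq_square)
  qed
  finally have "0 < q" using q \<mu>(1) by (smt (verit) zero_less_power)
  define l where "l = \<mu> / (2 * q)"
  have l: "0 \<le> l" using \<mu>(1) \<open>0 < q\<close> by (simp add: l_def)
  have pt: "2 * l * Y \<omega> - l * \<mu> - l\<^sup>2 * (Y \<omega>)\<^sup>2 \<le> indicator {\<omega> \<in> space M. \<mu> / 2 \<le> Y \<omega>} \<omega>" if "\<omega> \<in> space M" for \<omega>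
  proof (cases "\<mu> / 2 \<le> Y \<omega>")
    case True
    have "0 \<le> (1 - l * Y \<omega>)\<^sup>2" by simp
    moreover have "0 \<le> l * \<mu>" using l \<mu>(1) by simp
    ultimately show ?thesis using True that by (simp add: power2_eq_square algebra_simps)
  next
    case False
    then have "l * (2 * Y \<omega> - \<mu>) \<le> 0" using l by (intro mult_nonneg_nonpos) auto
    then have "2 * l * Y \<omega> - l * \<mu> \<le> 0" by (simp add: algebra_simps)
    moreover have "0 \<le> l\<^sup>2 * (Y \<omega>)\<^sup>2" by simp
    ultimately have "2 * l * Y \<omega> - l * \<mu> - l\<^sup>2 * (Y \<omega>)\<^sup>2 \<le> 0" by linarith
    then show ?thesis using False by simp
  qed
  have "\<mu>\<^sup>2 / (4 * q) = l * \<mu> - l\<^sup>2 * q"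
    using \<open>0 < q\<close> by (simp add: l_def power2_eq_square field_simps)
  also have "\<dots> \<le> 2 * l * \<mu> - l * \<mu> - l\<^sup>2 * expectation (\<lambda>\<omega>. (Y \<omega>)\<^sup>2)"
    using mult_left_mono[OF q, of "l\<^sup>2"] by (simp add: algebra_simps)
  also have "\<dots> = expectation (\<lambda>\<omega>. 2 * l * Y \<omega> - l * \<mu> - l\<^sup>2 * (Y \<omega>)\<^sup>2)"
    using Y \<mu> by (simp add: prob_space)
  also have "\<dots> \<le> expectation (indicator {\<omega> \<in> space M. \<mu> / 2 \<le> Y \<omega>})"
    using Y pt by (intro integral_mono) (auto simp: integrable_indicator_iff emeasure_eq_measure)
  also have "\<dots> = prob {\<omega> \<in> space M. \<mu> / 2 \<le> Y \<omega>}" by simp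
  finally show ?thesis .
qed

lemma (in prob_space) integrable_power_le_4:
  fixes X :: "'a \<Rightarrow> real"
  assumes [measurable]: "X \<in> borel_measurable M" and X: "integrable M (\<lambda>\<omega>. X \<omega> ^ 4)" and k: "k \<le> 4"
  shows "integrable M (\<lambda>\<omega>. X \<omega> ^ k)"
proof (rule Bochner_Integration.integrable_bound)
  show "integrable M (\<lambda>\<omega>. 1 + X \<omega> ^ 4)" using X by simp
  show "AE \<omega> in M. norm (X \<omega> ^ k) \<le> norm (1 + X \<omega> ^ 4)"
  proof (rule AE_I2)
    fix \<omega>
    have e4: "X \<omega> ^ 4 = \<bar>X \<omega>\<bar> ^ 4" by simp
    have "\<bar>X \<omega>\<bar> ^ k \<le> 1 + \<bar>X \<omega>\<bar> ^ 4"
    proof (cases "\<bar>X \<omega>\<bar> \<le> 1")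
      case True
      then have "\<bar>X \<omega>\<bar> ^ k \<le> 1" by (simp add: power_le_one)
      then show ?thesis by (smt (verit) zero_le_power abs_ge_zero)
    next
      case False
      then have "\<bar>X \<omega>\<bar> ^ k \<le> \<bar>X \<omega>\<bar> ^ 4" using k by (intro power_increasing) auto
      then show ?thesis by simp
    qed
    moreover have "0 \<le> X \<omega> ^ 4" by (subst e4) (rule zero_le_power, simp)
    ultimately show "norm (X \<omega> ^ k) \<le> norm (1 + X \<omega> ^ 4)" by (simp add: power_abs)
  qed
qed simp

lemma (in prob_space) indep_pair_expectation:
  fixes X Y :: "'a \<Rightarrow> real" and f :: "real \<times> real \<Rightarrow> real"
  assumes ind: "indep_var borel X borel Y" and f: "f \<in> borel_measurable (borel \<Otimes>\<^sub>M borel)"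
    and int: "integrable M (\<lambda>\<omega>. f (X \<omega>, Y \<omega>))"
  shows "expectation (\<lambda>\<omega>. f (X \<omega>, Y \<omega>)) = (\<integral>r. expectation (\<lambda>\<omega>. f (r, Y \<omega>)) \<partial>distr M borel X)"
    and "integrable (distr M borel X) (\<lambda>r. expectation (\<lambda>\<omega>. f (r, Y \<omega>)))"
proof -
  have rv[measurable]: "random_variable borel X" "random_variable borel Y"
    using ind by (auto dest: indep_var_rv1 indep_var_rv2)
  have eq: "distr M borel X \<Otimes>\<^sub>M distr M borel Y = distr M (borel \<Otimes>\<^sub>M borel) (\<lambda>x. (X x, Y x))"
    using ind by (simp add: indep_var_distribution_eq)
  interpret X: prob_space "distr M borel X" by (rule prob_space_distr) fact
  interpret Y: prob_space "distr M borel Y" by (rule prob_space_distr) fact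
  interpret XY: pair_prob_space "distr M borel X" "distr M borel Y" ..
  have intf: "integrable (distr M borel X \<Otimes>\<^sub>M distr M borel Y) f"
    unfolding eq using int f by (subst integrable_distr_eq) auto
  have inner: "(\<integral>y. f (r, y) \<partial>distr M borel Y) = expectation (\<lambda>\<omega>. f (r, Y \<omega>))" for r
    using f by (subst integral_distr) auto
  have "expectation (\<lambda>\<omega>. f (X \<omega>, Y \<omega>)) = integral\<^sup>L (distr M borel X \<Otimes>\<^sub>M distr M borel Y) f"
    unfolding eq using f by (subst integral_distr) auto
  also have "\<dots> = (\<integral>r. (\<integral>y. f (r, y) \<partial>distr M borel Y) \<partial>distr M borel X)"
    using XY.integral_fst'[OF intf] by simp
  finally show "expectation (\<lambda>\<omega>. f (X \<omega>, Y \<omega>)) = (\<integral>r. expectation (\<lambda>\<omega>. f (r, Y \<omega>)) \<partial>distr M borel X)"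
    unfolding inner .
  show "integrable (distr M borel X) (\<lambda>r. expectation (\<lambda>\<omega>. f (r, Y \<omega>)))"
    using XY.integrable_fst'[OF intf] unfolding inner .
qed

text \<open>
  The sign law and the standard Gaussian law enter through these moments; 3 is the fourth moment of the
  latter.
\<close>

locale standardized = prob_space P for P :: "'a measure" +
  fixes u :: "'i \<Rightarrow> 'a \<Rightarrow> real" and E :: "'i set"
  assumes finE: "finite E" and indep: "indep_vars (\<lambda>_. borel) u E"
    and int4: "\<And>e. e \<in> E \<Longrightarrow> integrable P (\<lambda>\<omega>. u e \<omega> ^ 4)"
    and mean: "\<And>e. e \<in> E \<Longrightarrow> expectation (u e) = 0"
    and var: "\<And>e. e \<in> E \<Longrightarrow> expectation (\<lambda>\<omega>. (u e \<omega>)\<^sup>2) = 1"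
    and fourth: "\<And>e. e \<in> E \<Longrightarrow> expectation (\<lambda>\<omega>. u e \<omega> ^ 4) \<le> 3"
begin

lemma rv: "e \<in> E \<Longrightarrow> u e \<in> borel_measurable P"
  using indep unfolding indep_vars_def by blast

lemma int_power: "e \<in> E \<Longrightarrow> k \<le> 4 \<Longrightarrow> integrable P (\<lambda>\<omega>. u e \<omega> ^ k)"
  by (rule integrable_power_le_4[OF rv int4])

definition lin :: "'i set \<Rightarrow> ('i \<Rightarrow> real) \<Rightarrow> 'a \<Rightarrow> real" where
  "lin B \<alpha> \<omega> = (\<Sum>e\<in>B. \<alpha> e * u e \<omega>)"

lemma lin_rv: "B \<subseteq> E \<Longrightarrow> lin B \<alpha> \<in> borel_measurable P"
  unfolding lin_def using rv by (intro borel_measurable_sum borel_measurable_times) auto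

lemma indep_blocks:
  assumes "A \<inter> B = {}" "A \<subseteq> E" "B \<subseteq> E"
    and "F \<in> measurable (PiM A (\<lambda>_. borel)) N1" "G \<in> measurable (PiM B (\<lambda>_. borel)) N2"
  shows "indep_var N1 (\<lambda>\<omega>. F (restrict (\<lambda>e. u e \<omega>) A)) N2 (\<lambda>\<omega>. G (restrict (\<lambda>e. u e \<omega>) B))"
  using indep_var_compose[OF indep_var_restrict[OF indep assms(1-3)] assms(4,5)] by (simp add: comp_def)

lemma lin_coord_measurable: "(\<lambda>f. \<Sum>e\<in>B. \<alpha> e * f e) \<in> borel_measurable (PiM B (\<lambda>_. borel))"
  for \<alpha> :: "'i \<Rightarrow> real"
  by measurable

lemma lin_restrict: "(\<Sum>e\<in>B. \<alpha> e * restrict (\<lambda>e. u e \<omega>) B e) = lin B \<alpha> \<omega>"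
  unfolding lin_def by (rule sum.cong) auto

lemma indep_lin_coord:
  assumes "B \<subseteq> E" "e \<in> E" "e \<notin> B"
  shows "indep_var borel (lin B \<alpha>) borel (u e)"
proof -
  have "(\<lambda>f. f e) \<in> borel_measurable (PiM {e} (\<lambda>_. borel :: real measure))" by measurable
  from indep_blocks[of B "{e}", OF _ _ _ lin_coord_measurable[where B = B and \<alpha> = \<alpha>] this] assms
  show ?thesis unfolding lin_restrict by simp
qed

lemma lin_moments:
  assumes "B \<subseteq> E"
  shows "integrable P (\<lambda>\<omega>. lin B \<alpha> \<omega> ^ 4) \<and> expectation (lin B \<alpha>) = 0
    \<and> expectation (\<lambda>\<omega>. (lin B \<alpha> \<omega>)\<^sup>2) = (\<Sum>e\<in>B. (\<alpha> e)\<^sup>2)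
    \<and> expectation (\<lambda>\<omega>. lin B \<alpha> \<omega> ^ 4) \<le> 3 * (\<Sum>e\<in>B. (\<alpha> e)\<^sup>2)\<^sup>2"
proof -
  have "finite B" using assms finE finite_subset by blast
  then show ?thesis using assms
  proof (induction B)
    case empty
    have "lin {} \<alpha> = (\<lambda>\<omega>. 0)" by (simp add: lin_def fun_eq_iff)
    then show ?case by simp
  next
    case (insert e B)
    then have B: "B \<subseteq> E" and e: "e \<in> E" "e \<notin> B" by auto
    define s where "s = (\<Sum>e\<in>B. (\<alpha> e)\<^sup>2)"
    define a where "a = \<alpha> e"
    let ?X = "lin B \<alpha>" and ?Y = "u e"
    have IH: "integrable P (\<lambda>\<omega>. ?X \<omega> ^ 4)" "expectation ?X = 0" "expectation (\<lambda>\<omega>. ?X \<omega> ^ 2) = s"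
      "expectation (\<lambda>\<omega>. ?X \<omega> ^ 4) \<le> 3 * s\<^sup>2"
      using insert.IH[OF B] by (auto simp: s_def)
    have iX: "integrable P (\<lambda>\<omega>. ?X \<omega> ^ k)" if "k \<le> 4" for k
      by (rule integrable_power_le_4[OF lin_rv[OF B] IH(1) that])
    have ind: "indep_var borel (\<lambda>\<omega>. ?X \<omega> ^ k) borel (\<lambda>\<omega>. ?Y \<omega> ^ l)" for k l
      using indep_var_compose[OF indep_lin_coord[OF B e], of "\<lambda>x. x ^ k" borel "\<lambda>x. x ^ l" borel]
      by (simp add: comp_def)
    have iXY: "integrable P (\<lambda>\<omega>. ?X \<omega> ^ k * ?Y \<omega> ^ l)"
      and eXY: "expectation (\<lambda>\<omega>. ?X \<omega> ^ k * ?Y \<omega> ^ l) = expectation (\<lambda>\<omega>. ?X \<omega> ^ k) * expectation (\<lambda>\<omega>. ?Y \<omega> ^ l)"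
      if "k \<le> 4" "l \<le> 4" for k l
      using indep_var_integrable[OF ind iX[OF that(1)] int_power[OF e(1) that(2)]]
        indep_var_lebesgue_integral[OF ind iX[OF that(1)] int_power[OF e(1) that(2)]] by auto
    note iXYs = iXY[of 1 1] iXY[of 3 1] iXY[of 2 2] iXY[of 1 3]
    have lin: "lin (insert e B) \<alpha> \<omega> = ?X \<omega> + a * ?Y \<omega>" for \<omega>
      using insert.hyps by (simp add: lin_def a_def)
    have p4: "lin (insert e B) \<alpha> \<omega> ^ 4 = ?X \<omega> ^ 4 + 4 * a * (?X \<omega> ^ 3 * ?Y \<omega> ^ 1)
        + 6 * a\<^sup>2 * (?X \<omega> ^ 2 * ?Y \<omega> ^ 2) + 4 * a ^ 3 * (?X \<omega> ^ 1 * ?Y \<omega> ^ 3) + a ^ 4 * ?Y \<omega> ^ 4" for \<omega>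
      unfolding lin by (simp add: power4_eq_xxxx power3_eq_cube power2_eq_square algebra_simps)
    have p2: "(lin (insert e B) \<alpha> \<omega>)\<^sup>2 = ?X \<omega> ^ 2 + 2 * a * (?X \<omega> ^ 1 * ?Y \<omega> ^ 1) + a\<^sup>2 * ?Y \<omega> ^ 2" for \<omega>
      unfolding lin by (simp add: power2_eq_square algebra_simps)
    have m: "expectation (\<lambda>\<omega>. ?Y \<omega> ^ 1) = 0" "expectation (\<lambda>\<omega>. ?Y \<omega> ^ 2) = 1" "expectation (\<lambda>\<omega>. ?X \<omega> ^ 1) = 0"
      using mean[OF e(1)] var[OF e(1)] IH(2) by simp_all
    have "integrable P (\<lambda>\<omega>. lin (insert e B) \<alpha> \<omega> ^ 4)"
      unfolding p4 using IH(1) int4[OF e(1)] iXYs by (intro Bochner_Integration.integrable_add integrable_mult_right) auto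
    moreover have "expectation (lin (insert e B) \<alpha>) = 0"
    proof -
      have "expectation (lin (insert e B) \<alpha>) = expectation (\<lambda>\<omega>. ?X \<omega> + a * ?Y \<omega>)"
        by (intro Bochner_Integration.integral_cong refl lin)
      also have "\<dots> = 0" using iX[of 1] int_power[OF e(1), of 1] IH(2) mean[OF e(1)] by simp
      finally show ?thesis .
    qed
    moreover have "expectation (\<lambda>\<omega>. (lin (insert e B) \<alpha> \<omega>)\<^sup>2) = (\<Sum>e\<in>insert e B. (\<alpha> e)\<^sup>2)"
    proof -
      have "expectation (\<lambda>\<omega>. (lin (insert e B) \<alpha> \<omega>)\<^sup>2) = expectation (\<lambda>\<omega>. ?X \<omega> ^ 2)
          + 2 * a * expectation (\<lambda>\<omega>. ?X \<omega> ^ 1 * ?Y \<omega> ^ 1) + a\<^sup>2 * expectation (\<lambda>\<omega>. ?Y \<omega> ^ 2)"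
        unfolding p2 using iX[of 2] int_power[OF e(1), of 2] iXYs
        by (subst Bochner_Integration.integral_add; simp)+
      also have "\<dots> = s + a\<^sup>2" using eXY[of 1 1] m IH(3) by simp
      finally show ?thesis using insert.hyps by (simp add: s_def a_def)
    qed
    moreover have "expectation (\<lambda>\<omega>. lin (insert e B) \<alpha> \<omega> ^ 4) \<le> 3 * (\<Sum>e\<in>insert e B. (\<alpha> e)\<^sup>2)\<^sup>2"
    proof -
      have "expectation (\<lambda>\<omega>. lin (insert e B) \<alpha> \<omega> ^ 4) = expectation (\<lambda>\<omega>. ?X \<omega> ^ 4)
          + 4 * a * expectation (\<lambda>\<omega>. ?X \<omega> ^ 3 * ?Y \<omega> ^ 1) + 6 * a\<^sup>2 * expectation (\<lambda>\<omega>. ?X \<omega> ^ 2 * ?Y \<omega> ^ 2)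
          + 4 * a ^ 3 * expectation (\<lambda>\<omega>. ?X \<omega> ^ 1 * ?Y \<omega> ^ 3) + a ^ 4 * expectation (\<lambda>\<omega>. ?Y \<omega> ^ 4)"
        unfolding p4 using IH(1) int4[OF e(1)] iXYs
        by (subst Bochner_Integration.integral_add; simp)+
      also have "\<dots> = expectation (\<lambda>\<omega>. ?X \<omega> ^ 4) + 6 * a\<^sup>2 * s + a ^ 4 * expectation (\<lambda>\<omega>. ?Y \<omega> ^ 4)"
        using eXY[of 1 3] eXY[of 3 1] eXY[of 2 2] m IH(3) by simp
      also have "\<dots> \<le> 3 * s\<^sup>2 + 6 * a\<^sup>2 * s + a ^ 4 * 3"
        using IH(4) fourth[OF e(1)] by (intro add_mono mult_left_mono) auto
      also have "\<dots> = 3 * (a\<^sup>2 + s)\<^sup>2" by (simp add: power4_eq_xxxx power2_eq_square algebra_simps)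
      finally show ?thesis using insert.hyps by (simp add: s_def a_def)
    qed
    ultimately show ?case by blast
  qed
qed

lemma lin_anticoncentrated:
  assumes "B \<subseteq> E" "0 < (\<Sum>e\<in>B. (\<alpha> e)\<^sup>2)"
  shows "1 / 12 \<le> prob {\<omega> \<in> space P. (\<Sum>e\<in>B. (\<alpha> e)\<^sup>2) / 2 \<le> (lin B \<alpha> \<omega>)\<^sup>2}"
proof -
  let ?s = "\<Sum>e\<in>B. (\<alpha> e)\<^sup>2"
  note m = lin_moments[OF assms(1), of \<alpha>]
  have i4: "integrable P (\<lambda>\<omega>. lin B \<alpha> \<omega> ^ 4)" using m by blast
  have p: "((lin B \<alpha> \<omega>)\<^sup>2)\<^sup>2 = lin B \<alpha> \<omega> ^ 4" for \<omega> by simp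
  have "?s\<^sup>2 / (4 * (3 * ?s\<^sup>2)) \<le> prob {\<omega> \<in> space P. ?s / 2 \<le> (lin B \<alpha> \<omega>)\<^sup>2}"
    using m i4 integrable_power_le_4[OF lin_rv[OF assms(1)] i4, of 2] assms(2)
    by (intro paley_zygmund) (simp_all only: p, simp_all?)
  moreover have "?s\<^sup>2 / (4 * (3 * ?s\<^sup>2)) = 1 / 12" using assms(2) by simp
  ultimately show ?thesis by simp
qed

text \<open>
  Each of the forms is small with probability at most 11/12, and forms on disjoint blocks are
  independent.
\<close>

lemma all_lin_small_prob:
  assumes "finite I" and B: "\<And>i. i \<in> I \<Longrightarrow> B i \<subseteq> E" "disjoint_family_on B I"
    and s: "0 < s" "\<And>i. i \<in> I \<Longrightarrow> s \<le> (\<Sum>e\<in>B i. (\<alpha> e)\<^sup>2)"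
  shows "prob {\<omega> \<in> space P. \<forall>i\<in>I. (lin (B i) \<alpha> \<omega>)\<^sup>2 < s / 2} \<le> (11 / 12) ^ card I"
proof (cases "I = {}")
  case True then show ?thesis by simp
next
  case False
  have ind: "indep_vars (\<lambda>_. borel) (\<lambda>i. lin (B i) \<alpha>) I"
    using indep_vars_compose2[OF indep_vars_restrict[OF indep, of I B], of "\<lambda>i f. \<Sum>e\<in>B i. \<alpha> e * f e" "\<lambda>_. borel"]
      B lin_coord_measurable by (simp only: lin_restrict)
  let ?A = "{x::real. x\<^sup>2 < s / 2}"
  have A: "?A \<in> sets borel" by measurable
  have "{\<omega> \<in> space P. \<forall>i\<in>I. (lin (B i) \<alpha> \<omega>)\<^sup>2 < s / 2} = (\<Inter>i\<in>I. lin (B i) \<alpha> -` ?A \<inter> space P)"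
    using False by auto
  then have "prob {\<omega> \<in> space P. \<forall>i\<in>I. (lin (B i) \<alpha> \<omega>)\<^sup>2 < s / 2} = (\<Prod>i\<in>I. prob (lin (B i) \<alpha> -` ?A \<inter> space P))"
    using indep_varsD_finite[OF ind False \<open>finite I\<close>, of "\<lambda>_. ?A"] A by simp
  also have "\<dots> \<le> (\<Prod>i\<in>I. 11 / 12)"
  proof (intro prod_mono conjI measure_nonneg)
    fix i assume i: "i \<in> I"
    have [measurable]: "lin (B i) \<alpha> \<in> borel_measurable P" using lin_rv B(1)[OF i] .
    let ?G = "{\<omega> \<in> space P. (\<Sum>e\<in>B i. (\<alpha> e)\<^sup>2) / 2 \<le> (lin (B i) \<alpha> \<omega>)\<^sup>2}"
    have "1 / 12 \<le> prob ?G" using s(2)[OF i] s(1) by (intro lin_anticoncentrated B(1) i) auto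
    moreover have "prob (space P - ?G) = 1 - prob ?G" by (rule prob_compl) measurable
    moreover have "prob (lin (B i) \<alpha> -` ?A \<inter> space P) \<le> prob (space P - ?G)"
      using s(2)[OF i] by (intro finite_measure_mono) (auto, measurable)
    ultimately show "prob (lin (B i) \<alpha> -` ?A \<inter> space P) \<le> 11 / 12" by linarith
  qed
  finally show ?thesis by simp
qed

text \<open>
  A uniform form of nondegeneracy: by Paley-Zygmund for \<open>(x - u)\<^sup>2\<close>, whose mean is \<open>1 + x\<^sup>2\<close>, no point
  \<open>x\<close> has almost all of the mass within distance 1/2.
\<close>

lemma coord_spread:
  assumes e: "e \<in> E"
  shows "1 / 96 \<le> prob {\<omega> \<in> space P. 1 / 2 \<le> \<bar>x - u e \<omega>\<bar>}"
proof -
  have [measurable]: "u e \<in> borel_measurable P" by (rule rv[OF e])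
  have i: "integrable P (\<lambda>\<omega>. u e \<omega> ^ k)" if "k \<le> 4" for k by (rule int_power[OF e that])
  note ius = i[of 1] i[of 2] i[of 4]
  have b: "(x - y) ^ 4 \<le> 8 * y ^ 4 + 8 * x ^ 4" for y :: real
  proof -
    have "8 * y ^ 4 + 8 * x ^ 4 - (x - y) ^ 4 = (x + y)\<^sup>2 * (7 * x\<^sup>2 - 10 * x * y + 7 * y\<^sup>2)"
      by (simp add: power4_eq_xxxx power2_eq_square algebra_simps)
    also have "7 * x\<^sup>2 - 10 * x * y + 7 * y\<^sup>2 = 5 * (x - y)\<^sup>2 + 2 * x\<^sup>2 + 2 * y\<^sup>2"
      by (simp add: power2_eq_square algebra_simps)
    finally show ?thesis by (smt (verit) mult_nonneg_nonneg zero_le_power2)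
  qed
  have i4: "integrable P (\<lambda>\<omega>. (x - u e \<omega>) ^ 4)"
  proof (rule Bochner_Integration.integrable_bound)
    show "integrable P (\<lambda>\<omega>. 8 * u e \<omega> ^ 4 + 8 * x ^ 4)" using ius by simp
    show "AE \<omega> in P. norm ((x - u e \<omega>) ^ 4) \<le> norm (8 * u e \<omega> ^ 4 + 8 * x ^ 4)"
      using b by (intro AE_I2) (simp add: power_abs[symmetric])
  qed simp
  have e2: "expectation (\<lambda>\<omega>. (x - u e \<omega>)\<^sup>2) = 1 + x\<^sup>2"
  proof -
    have "(x - u e \<omega>)\<^sup>2 = x\<^sup>2 - 2 * x * u e \<omega> + (u e \<omega>)\<^sup>2" for \<omega> by (simp add: power2_diff)
    then show ?thesis using ius mean[OF e] var[OF e] by (simp add: prob_space)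
  qed
  have e4: "expectation (\<lambda>\<omega>. (x - u e \<omega>) ^ 4) \<le> 24 * (1 + x\<^sup>2)\<^sup>2"
  proof -
    have "expectation (\<lambda>\<omega>. (x - u e \<omega>) ^ 4) \<le> expectation (\<lambda>\<omega>. 8 * u e \<omega> ^ 4 + 8 * x ^ 4)"
      using ius i4 b by (intro integral_mono) auto
    also have "\<dots> = 8 * expectation (\<lambda>\<omega>. u e \<omega> ^ 4) + 8 * x ^ 4" using ius by (simp add: prob_space)
    also have "\<dots> \<le> 24 + 8 * x ^ 4" using fourth[OF e] by simp
    also have "\<dots> \<le> 24 * (1 + x\<^sup>2)\<^sup>2"
    proof -
      have "(1 + x\<^sup>2)\<^sup>2 = 1 + 2 * x\<^sup>2 + x ^ 4" by (simp add: power4_eq_xxxx power2_eq_square algebra_simps)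
      moreover have "0 \<le> x ^ 4" by simp
      ultimately show ?thesis by simp
    qed
    finally show ?thesis .
  qed
  have p: "((x - u e \<omega>)\<^sup>2)\<^sup>2 = (x - u e \<omega>) ^ 4" for \<omega> by simp
  have i2: "integrable P (\<lambda>\<omega>. (x - u e \<omega>)\<^sup>2)" by (rule integrable_power_le_4[OF _ i4]) auto
  have "(1 + x\<^sup>2)\<^sup>2 / (4 * (24 * (1 + x\<^sup>2)\<^sup>2)) \<le> prob {\<omega> \<in> space P. (1 + x\<^sup>2) / 2 \<le> (x - u e \<omega>)\<^sup>2}"
    using i2 i4 e2 e4
    by (intro paley_zygmund) (simp_all only: p, (simp_all add: add_pos_nonneg)?)
  moreover have "0 < 1 + x\<^sup>2" by (simp add: add_pos_nonneg)
  then have "(1 + x\<^sup>2)\<^sup>2 / (4 * (24 * (1 + x\<^sup>2)\<^sup>2)) = 1 / 96" by simp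
  moreover have "prob {\<omega> \<in> space P. (1 + x\<^sup>2) / 2 \<le> (x - u e \<omega>)\<^sup>2} \<le> prob {\<omega> \<in> space P. 1 / 2 \<le> \<bar>x - u e \<omega>\<bar>}"
  proof (rule finite_measure_mono)
    show "{\<omega> \<in> space P. (1 + x\<^sup>2) / 2 \<le> (x - u e \<omega>)\<^sup>2} \<subseteq> {\<omega> \<in> space P. 1 / 2 \<le> \<bar>x - u e \<omega>\<bar>}"
    proof safe
      fix \<omega> assume "(1 + x\<^sup>2) / 2 \<le> (x - u e \<omega>)\<^sup>2"
      moreover have "(1 / 4 :: real) \<le> (1 + x\<^sup>2) / 2" using zero_le_power2[of x] by simp
      ultimately have "1 / 4 \<le> (x - u e \<omega>)\<^sup>2" by (rule order.trans[rotated])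
      moreover have "(1 / 2 :: real)\<^sup>2 = 1 / 4" by (simp add: power2_eq_square)
      ultimately have "(1 / 2)\<^sup>2 \<le> (x - u e \<omega>)\<^sup>2" by (simp only:)
      then show "1 / 2 \<le> \<bar>x - u e \<omega>\<bar>" by (simp add: abs_le_square_iff[symmetric])
    qed
  qed measurable
  ultimately show ?thesis by linarith
qed

text \<open>
  Being nondecreasing, this step function of a linear form is positively correlated with every summand,
  and its two jumps separate the interval \<open>[-t, t]\<close> from what lies on either side.
\<close>

definition step3 :: "real \<Rightarrow> real \<Rightarrow> real" where
  "step3 t x = (if x < - t then -1 else if x \<le> t then 0 else 1)"

lemma step3_measurable [measurable]: "step3 t \<in> borel_measurable borel"
  unfolding step3_def by measurable

lemma step3_mono: "x \<le> y \<Longrightarrow> 0 \<le> t \<Longrightarrow> step3 t x \<le> step3 t y"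
  unfolding step3_def by simp

text \<open>
  With \<open>g x = sgn a * step3 t (r + a x)\<close>, a nondecreasing function, and an independent copy \<open>u'\<close> of \<open>u\<close>, the mean of
  \<open>g(u) u\<close> is half the mean of \<open>(g(u) - g(u'))(u - u') \<ge> 0\<close>. When \<open>\<bar>r + a u\<bar> \<le> t\<close> and \<open>\<bar>u - u'\<bar> \<ge> 1/2\<close>,
  the point \<open>r + a u'\<close> has left the interval, so this product is at least 1/2. The function \<open>\<phi>\<close>
  below is the conditional mean of the product given \<open>u\<close>.
\<close>

lemma coord_correlation:
  assumes e: "e \<in> E" and a: "4 * t < \<bar>a\<bar>" and t: "0 \<le> t"
  shows "prob {\<omega> \<in> space P. \<bar>r + a * u e \<omega>\<bar> \<le> t} / 384 \<le> expectation (\<lambda>\<omega>. sgn a * step3 t (r + a * u e \<omega>) * u e \<omega>)"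
proof -
  have [measurable]: "u e \<in> borel_measurable P" by (rule rv[OF e])
  define g where "g x = sgn a * step3 t (r + a * x)" for x
  have [measurable]: "g \<in> borel_measurable borel" unfolding g_def by measurable
  have gb: "\<bar>g x\<bar> \<le> 1" for x unfolding g_def step3_def by (auto simp: sgn_if)
  have iu: "integrable P (u e)" using int_power[OF e, of 1] by simp
  have ig: "integrable P (\<lambda>\<omega>. g (u e \<omega>))"
    by (rule integrable_const_bound[of _ 1]) (use gb in auto)
  have igu: "integrable P (\<lambda>\<omega>. g (u e \<omega>) * u e \<omega>)"
  proof (rule Bochner_Integration.integrable_bound[OF iu])
    show "AE \<omega> in P. norm (g (u e \<omega>) * u e \<omega>) \<le> norm (u e \<omega>)"
      using gb by (intro AE_I2) (simp add: abs_mult mult_left_le_one_le)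
  qed simp
  define G K where "G = expectation (\<lambda>\<omega>. g (u e \<omega>))" and "K = expectation (\<lambda>\<omega>. g (u e \<omega>) * u e \<omega>)"
  define \<phi> where "\<phi> x = g x * x - x * G + K" for x
  have g_mono: "g x \<le> g y" if "x \<le> y" for x y
  proof (cases "a > 0")
    case True
    then have "step3 t (r + a * x) \<le> step3 t (r + a * y)" using that by (intro step3_mono t) simp
    then show ?thesis using True by (simp add: g_def)
  next
    case False
    then have "a < 0" using a t by auto
    then have "step3 t (r + a * y) \<le> step3 t (r + a * x)" using that by (intro step3_mono t) simp
    then show ?thesis using \<open>a < 0\<close> by (simp add: g_def)
  qed
  have mono: "0 \<le> (g x - g y) * (x - y)" for x y
  proof (cases "x \<le> y")
    case True
    then show ?thesis using g_mono[of x y] by (intro mult_nonpos_nonpos) auto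
  next
    case False
    then show ?thesis using g_mono[of y x] by (intro mult_nonneg_nonneg) auto
  qed
  have far: "1 / 2 \<le> (g x - g y) * (x - y)" if x: "\<bar>r + a * x\<bar> \<le> t" and xy: "1 / 2 \<le> \<bar>x - y\<bar>" for x y
  proof -
    have "2 * t < \<bar>a\<bar> * (1 / 2)" using a by simp
    also have "\<dots> \<le> \<bar>a\<bar> * \<bar>x - y\<bar>" using xy by (intro mult_left_mono) auto
    finally have d: "2 * t < \<bar>a * x - a * y\<bar>" by (simp add: abs_mult[symmetric] algebra_simps)
    have "g x = 0" using x by (auto simp: g_def step3_def abs_le_iff)
    moreover have "g y * (y - x) = \<bar>x - y\<bar>"
    proof (cases "r + a * y < - t")
      case True
      then have "0 < a * (x - y)" using x by (simp add: algebra_simps abs_le_iff)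
      then show ?thesis using True by (auto simp: g_def step3_def zero_less_mult_iff)
    next
      case False
      then have y: "r + a * y > t" using d x by (auto simp: abs_le_iff abs_if split: if_splits)
      then have "0 < a * (y - x)" using x by (simp add: algebra_simps abs_le_iff)
      then show ?thesis using False y by (auto simp: g_def step3_def zero_less_mult_iff)
    qed
    ultimately show ?thesis using xy by (simp add: algebra_simps)
  qed
  have \<phi>: "\<phi> x = expectation (\<lambda>\<omega>. (g x - g (u e \<omega>)) * (x - u e \<omega>))" for x
  proof -
    have "(g x - g (u e \<omega>)) * (x - u e \<omega>) = g x * x - g x * u e \<omega> - x * g (u e \<omega>) + g (u e \<omega>) * u e \<omega>" for \<omega>
      by (simp add: algebra_simps)
    then show ?thesis using iu ig igu mean[OF e] by (simp add: \<phi>_def G_def K_def prob_space)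
  qed
  have i\<phi>: "integrable P (\<lambda>\<omega>. (g x - g (u e \<omega>)) * (x - u e \<omega>))" for x
  proof -
    have "(g x - g (u e \<omega>)) * (x - u e \<omega>) = g x * x - g x * u e \<omega> - x * g (u e \<omega>) + g (u e \<omega>) * u e \<omega>" for \<omega>
      by (simp add: algebra_simps)
    then show ?thesis using iu ig igu by simp
  qed
  have \<phi>0: "0 \<le> \<phi> x" for x unfolding \<phi> using mono by (intro Bochner_Integration.integral_nonneg) auto
  have \<phi>1: "1 / 192 \<le> \<phi> x" if x: "\<bar>r + a * x\<bar> \<le> t" for x
  proof -
    let ?F = "{\<omega> \<in> space P. 1 / 2 \<le> \<bar>x - u e \<omega>\<bar>}"
    have "1 / 192 \<le> (1 / 2) * prob ?F" using coord_spread[OF e, of x] by simp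
    also have "\<dots> = expectation (\<lambda>\<omega>. (1 / 2) * indicator ?F \<omega>)" by simp
    also have "\<dots> \<le> \<phi> x" unfolding \<phi>
    proof (rule integral_mono)
      show "integrable P (\<lambda>\<omega>. (1 / 2) * indicator ?F \<omega> :: real)"
        by (intro integrable_mult_right) (auto simp: integrable_indicator_iff emeasure_eq_measure)
      show "(1 / 2) * indicator ?F \<omega> \<le> (g x - g (u e \<omega>)) * (x - u e \<omega>)" for \<omega>
        using far[OF x, of "u e \<omega>"] mono[of x "u e \<omega>"] by (auto simp: indicator_def)
    qed (rule i\<phi>)
    finally show ?thesis .
  qed
  let ?B = "{\<omega> \<in> space P. \<bar>r + a * u e \<omega>\<bar> \<le> t}"
  have "prob ?B / 192 = expectation (\<lambda>\<omega>. (1 / 192) * indicator ?B \<omega>)" by simp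
  also have "\<dots> \<le> expectation (\<lambda>\<omega>. \<phi> (u e \<omega>))"
  proof (rule integral_mono)
    show "integrable P (\<lambda>\<omega>. (1 / 192) * indicator ?B \<omega> :: real)"
      by (intro integrable_mult_right) (auto simp: integrable_indicator_iff emeasure_eq_measure)
    show "integrable P (\<lambda>\<omega>. \<phi> (u e \<omega>))" unfolding \<phi>_def using iu igu by simp
    show "(1 / 192) * indicator ?B \<omega> \<le> \<phi> (u e \<omega>)" if "\<omega> \<in> space P" for \<omega>
      using \<phi>0 \<phi>1 by (auto simp: indicator_def)
  qed
  also have "\<dots> = 2 * K" unfolding \<phi>_def using iu igu mean[OF e] by (simp add: K_def prob_space)
  finally show ?thesis by (simp add: K_def g_def)
qed

text \<open>
  Sum the previous inequality over the coordinates in \<open>J\<close>: the probability times \<open>card J\<close> is at most 384 times the mean of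
  \<open>step3 t S\<close> times a signed sum of \<open>card J\<close> of the variables, and that mean is at most
  \<open>sqrt (card J)\<close> because \<open>step3\<close> is bounded by 1.
\<close>

lemma littlewood_offord:
  assumes B: "B \<subseteq> E" and J: "J \<subseteq> B" and t: "0 \<le> t" and \<alpha>: "\<And>e. e \<in> J \<Longrightarrow> 4 * t < \<bar>\<alpha> e\<bar>"
  shows "prob {\<omega> \<in> space P. \<bar>lin B \<alpha> \<omega>\<bar> \<le> t} * sqrt (card J) \<le> 384"
proof (cases "J = {}")
  case True then show ?thesis by simp
next
  case False
  have finB: "finite B" using B finE finite_subset by blast
  then have finJ: "finite J" using J finite_subset by blast
  have [measurable]: "lin B \<alpha> \<in> borel_measurable P" by (rule lin_rv[OF B])
  let ?p = "prob {\<omega> \<in> space P. \<bar>lin B \<alpha> \<omega>\<bar> \<le> t}"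
  have int: "integrable P (\<lambda>\<omega>. sgn (\<alpha> e) * step3 t (lin B \<alpha> \<omega>) * u e \<omega>)" if "e \<in> E" for e
  proof (rule Bochner_Integration.integrable_bound)
    show "integrable P (u e)" using int_power[OF that, of 1] by simp
    show "AE \<omega> in P. norm (sgn (\<alpha> e) * step3 t (lin B \<alpha> \<omega>) * u e \<omega>) \<le> norm (u e \<omega>)"
      by (intro AE_I2) (auto simp: step3_def sgn_if abs_mult)
  qed (use rv[OF that] in measurable)
  have one: "?p / 384 \<le> expectation (\<lambda>\<omega>. sgn (\<alpha> e) * step3 t (lin B \<alpha> \<omega>) * u e \<omega>)" if e: "e \<in> J" for e
  proof -
    let ?r = "lin (B - {e}) \<alpha>" and ?a = "\<alpha> e"
    have eE: "e \<in> E" and eB: "e \<in> B" using e J B by auto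
    have [measurable]: "u e \<in> borel_measurable P" by (rule rv[OF eE])
    have split: "lin B \<alpha> \<omega> = ?r \<omega> + ?a * u e \<omega>" for \<omega>
      unfolding lin_def using eB finB by (subst sum.remove[of _ e]) auto
    have ind: "indep_var borel ?r borel (u e)" using B eE by (intro indep_lin_coord) auto
    let ?f = "\<lambda>(r, x). sgn ?a * step3 t (r + ?a * x) * x" and ?g = "\<lambda>(r, x). indicator {z. \<bar>z\<bar> \<le> t} (r + ?a * x) / 384 :: real"
    have fm: "?f \<in> borel_measurable (borel \<Otimes>\<^sub>M borel)" by measurable
    have gm: "?g \<in> borel_measurable (borel \<Otimes>\<^sub>M borel)" by measurable
    have fi: "integrable P (\<lambda>\<omega>. ?f (?r \<omega>, u e \<omega>))" using int[OF eE] by (simp add: split)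
    have gi: "integrable P (\<lambda>\<omega>. ?g (?r \<omega>, u e \<omega>))"
    proof (rule integrable_const_bound[of _ 1])
      show "(\<lambda>\<omega>. ?g (?r \<omega>, u e \<omega>)) \<in> borel_measurable P"
        using measurable_compose[OF measurable_Pair[OF lin_rv rv[OF eE]] gm, of "B - {e}" \<alpha>] B by auto
    qed (auto simp: indicator_def)
    note F = indep_pair_expectation[OF ind fm fi] and G = indep_pair_expectation[OF ind gm gi]
    have "?p / 384 = expectation (\<lambda>\<omega>. ?g (?r \<omega>, u e \<omega>))"
    proof -
      have "expectation (\<lambda>\<omega>. ?g (?r \<omega>, u e \<omega>)) = expectation (\<lambda>\<omega>. indicator {\<omega> \<in> space P. \<bar>lin B \<alpha> \<omega>\<bar> \<le> t} \<omega> / 384)"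
        by (intro Bochner_Integration.integral_cong) (auto simp: split indicator_def)
      then show ?thesis by simp
    qed
    also have "\<dots> \<le> expectation (\<lambda>\<omega>. ?f (?r \<omega>, u e \<omega>))"
      unfolding F(1) G(1)
    proof (rule integral_mono[OF G(2) F(2)])
      fix r
      have "expectation (\<lambda>\<omega>. ?g (r, u e \<omega>)) = expectation (\<lambda>\<omega>. indicator {\<omega> \<in> space P. \<bar>r + ?a * u e \<omega>\<bar> \<le> t} \<omega> / 384)"
        by (intro Bochner_Integration.integral_cong) (auto simp: indicator_def)
      also have "\<dots> = prob {\<omega> \<in> space P. \<bar>r + ?a * u e \<omega>\<bar> \<le> t} / 384" by simp
      also have "\<dots> \<le> expectation (\<lambda>\<omega>. ?f (r, u e \<omega>))"
        using coord_correlation[OF eE \<alpha>[OF e] t, of r] by simp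
      finally show "expectation (\<lambda>\<omega>. ?g (r, u e \<omega>)) \<le> expectation (\<lambda>\<omega>. ?f (r, u e \<omega>))" .
    qed
    also have "\<dots> = expectation (\<lambda>\<omega>. sgn ?a * step3 t (lin B \<alpha> \<omega>) * u e \<omega>)"
      by (simp only: split prod.case)
    finally show ?thesis .
  qed
  have JE: "J \<subseteq> E" using J B by auto
  let ?S = "lin J (\<lambda>e. sgn (\<alpha> e))"
  have [measurable]: "?S \<in> borel_measurable P" by (rule lin_rv[OF JE])
  note m = lin_moments[OF JE, of "\<lambda>e. sgn (\<alpha> e)"]
  have i2: "integrable P (\<lambda>\<omega>. (?S \<omega>)\<^sup>2)" 
  proof -
    have i4: "integrable P (\<lambda>\<omega>. ?S \<omega> ^ 4)" using m by blast
    show ?thesis by (rule integrable_power_le_4[OF lin_rv[OF JE] i4]) simp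
  qed
  have var: "expectation (\<lambda>\<omega>. (?S \<omega>)\<^sup>2) = card J"
  proof -
    have "(\<Sum>e\<in>J. (sgn (\<alpha> e))\<^sup>2) = (\<Sum>e\<in>J. 1)"
    proof (rule sum.cong[OF refl])
      fix e assume "e \<in> J"
      then have "\<alpha> e \<noteq> 0" using \<alpha>[of e] t by auto
      then show "(sgn (\<alpha> e))\<^sup>2 = 1" by (simp add: sgn_if)
    qed
    then show ?thesis using m by simp
  qed
  define k where "k = sqrt (card J)"
  have k: "0 < k" "k * k = card J" using False finJ by (auto simp: k_def card_gt_0_iff)
  have "(k * k) * (?p / 384) = (\<Sum>e\<in>J. ?p / 384)" using k by simp
  also have "\<dots> \<le> (\<Sum>e\<in>J. expectation (\<lambda>\<omega>. sgn (\<alpha> e) * step3 t (lin B \<alpha> \<omega>) * u e \<omega>))" by (rule sum_mono) (rule one)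
  also have "\<dots> = expectation (\<lambda>\<omega>. \<Sum>e\<in>J. sgn (\<alpha> e) * step3 t (lin B \<alpha> \<omega>) * u e \<omega>)"
    using int JE by (intro Bochner_Integration.integral_sum[symmetric]) auto
  also have "\<dots> \<le> expectation (\<lambda>\<omega>. k / 2 + (?S \<omega>)\<^sup>2 / (2 * k))"
  proof (rule integral_mono)
    show "integrable P (\<lambda>\<omega>. \<Sum>e\<in>J. sgn (\<alpha> e) * step3 t (lin B \<alpha> \<omega>) * u e \<omega>)"
      by (intro Bochner_Integration.integrable_sum int) (use JE in auto)
    show "integrable P (\<lambda>\<omega>. k / 2 + (?S \<omega>)\<^sup>2 / (2 * k))" using i2 by simp
    fix \<omega>
    have "(\<Sum>e\<in>J. sgn (\<alpha> e) * step3 t (lin B \<alpha> \<omega>) * u e \<omega>) = step3 t (lin B \<alpha> \<omega>) * ?S \<omega>"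
      unfolding lin_def[of J] sum_distrib_left by (simp add: mult_ac)
    also have "\<dots> \<le> \<bar>?S \<omega>\<bar>" by (auto simp: step3_def)
    also have "\<dots> \<le> k / 2 + (?S \<omega>)\<^sup>2 / (2 * k)"
    proof -
      have "0 \<le> (k - \<bar>?S \<omega>\<bar>)\<^sup>2 / (2 * k)" using k by simp
      also have "\<dots> = k / 2 + (?S \<omega>)\<^sup>2 / (2 * k) - \<bar>?S \<omega>\<bar>"
        using k by (simp add: power2_diff divide_simps) (simp add: power2_eq_square algebra_simps)
      finally show ?thesis by simp
    qed
    finally show "(\<Sum>e\<in>J. sgn (\<alpha> e) * step3 t (lin B \<alpha> \<omega>) * u e \<omega>) \<le> k / 2 + (?S \<omega>)\<^sup>2 / (2 * k)" .
  qed
  also have "\<dots> = k / 2 + (k * k) / (2 * k)" using i2 var k by (simp add: prob_space)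
  also have "\<dots> = k" using k(1) by (simp del: k(2))
  finally have "k * (?p * k) \<le> k * 384" by (simp add: algebra_simps)
  then show ?thesis using k(1) by (simp add: k_def)
qed

end

section \<open>Determinants under row replacement\<close>

lemma abs_det_le_prod_row_sums:
  fixes A :: "real mat"
  assumes A: "A \<in> carrier_mat n n"
  shows "\<bar>Determinant.det A\<bar> \<le> (\<Prod>i=0..<n. \<Sum>j=0..<n. \<bar>A $$ (i, j)\<bar>)"
proof -
  have "\<bar>Determinant.det A\<bar> \<le> (\<Sum>p | p permutes {0..<n}. \<bar>signof p * (\<Prod>i=0..<n. A $$ (i, p i))\<bar>)"
    unfolding det_def'[OF A] by (rule sum_abs)
  also have "\<dots> = (\<Sum>p | p permutes {0..<n}. \<Prod>i=0..<n. \<bar>A $$ (i, p i)\<bar>)"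
    by (intro sum.cong) (auto simp: abs_mult abs_prod sign_def)
  also have "\<dots> = (\<Sum>p\<in>(\<lambda>p. restrict p {0..<n}) ` {p. p permutes {0..<n}}. \<Prod>i=0..<n. \<bar>A $$ (i, p i)\<bar>)"
  proof (subst sum.reindex)
    show "inj_on (\<lambda>p. restrict p {0..<n}) {p. p permutes {0..<n}}"
    proof (rule inj_onI, rule ext)
      fix p q i assume pq: "p \<in> {p. p permutes {0..<n}}" "q \<in> {p. p permutes {0..<n}}"
        and eq: "restrict p {0..<n} = restrict q {0..<n}"
      show "p i = q i"
      proof (cases "i \<in> {0..<n}")
        case True then show ?thesis using fun_cong[OF eq, of i] by simp
      next
        case False
        then show ?thesis using pq permutes_not_in[OF _ False, of p] permutes_not_in[OF _ False, of q] by simp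
      qed
    qed
  qed simp
  also have "\<dots> \<le> (\<Sum>p\<in>{0..<n} \<rightarrow>\<^sub>E {0..<n}. \<Prod>i=0..<n. \<bar>A $$ (i, p i)\<bar>)"
  proof (rule sum_mono2)
    show "finite ({0..<n} \<rightarrow>\<^sub>E {0..<n})" by (rule finite_PiE) auto
    show "(\<lambda>p. restrict p {0..<n}) ` {p. p permutes {0..<n}} \<subseteq> {0..<n} \<rightarrow>\<^sub>E {0..<n}"
    proof (rule image_subsetI)
      fix p assume "p \<in> {p. p permutes {0..<n}}"
      then have "p i \<in> {0..<n}" if "i \<in> {0..<n}" for i using that permutes_in_image[of p "{0..<n}" i] by simp
      then show "restrict p {0..<n} \<in> {0..<n} \<rightarrow>\<^sub>E {0..<n}" by (intro restrict_PiE_iff[THEN iffD2]) blast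
    qed
  qed (auto intro: prod_nonneg)
  also have "\<dots> = (\<Prod>i=0..<n. \<Sum>j=0..<n. \<bar>A $$ (i, j)\<bar>)"
    by (rule prod_sum_PiE[symmetric]) auto
  finally show ?thesis .
qed

definition sup_unit :: "nat \<Rightarrow> (nat \<Rightarrow> real) \<Rightarrow> bool" where
  "sup_unit n x \<longleftrightarrow> (\<forall>j<n. \<bar>x j\<bar> \<le> 1) \<and> (\<exists>j<n. \<bar>x j\<bar> = 1)"

lemma sup_unit_normalize:
  assumes k: "k < n" "x k \<noteq> 0"
  shows "\<exists>m\<ge>\<bar>x k\<bar>. 0 < m \<and> sup_unit n (\<lambda>j. x j / m)"
proof -
  define m where "m = Max ((\<lambda>j. \<bar>x j\<bar>) ` {0..<n})"
  have mge: "\<bar>x j\<bar> \<le> m" if "j < n" for j unfolding m_def using that by (intro Max_ge) auto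
  have "m \<in> (\<lambda>j. \<bar>x j\<bar>) ` {0..<n}" unfolding m_def using k by (intro Max_in) auto
  then obtain j where j: "j < n" "m = \<bar>x j\<bar>" by auto
  have m: "0 < m" using mge[OF k(1)] k(2) by linarith
  have "\<bar>x j / m\<bar> = 1" using j(2) m by simp
  then have "sup_unit n (\<lambda>j. x j / m)"
    unfolding sup_unit_def using mge m j(1) by (intro conjI allI impI exI[of _ j]) auto
  then show ?thesis using mge[OF k(1)] m by blast
qed

text \<open>
  A column of the inverse is mapped to a unit vector, so an entry larger than \<open>1/\<kappa>\<close> would
  give, after normalization, a vector of maximum norm 1 that is mapped below \<open>\<kappa>\<close>.
\<close>

lemma bounded_inverse:
  fixes A :: "real mat"
  assumes A: "A \<in> carrier_mat n n" and \<kappa>: "0 < \<kappa>"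
    and inj: "\<And>x. sup_unit n x \<Longrightarrow> \<exists>i<n. \<kappa> < \<bar>\<Sum>j=0..<n. A $$ (i, j) * x j\<bar>"
  shows "\<exists>B \<in> carrier_mat n n. A * B = 1\<^sub>m n \<and> (\<forall>i<n. \<forall>j<n. \<bar>B $$ (i, j)\<bar> \<le> 1 / \<kappa>)"
proof -
  have inj': "\<exists>i<n. \<kappa> * \<bar>x k\<bar> < \<bar>\<Sum>j=0..<n. A $$ (i, j) * x j\<bar>" if k: "k < n" "x k \<noteq> 0" for x k
  proof -
    obtain m where m: "\<bar>x k\<bar> \<le> m" "0 < m" "sup_unit n (\<lambda>j. x j / m)" using sup_unit_normalize[of k n x] k by blast
    obtain i where i: "i < n" "\<kappa> < \<bar>\<Sum>j=0..<n. A $$ (i, j) * (x j / m)\<bar>" using inj[OF m(3)] by blast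
    have "(\<Sum>j=0..<n. A $$ (i, j) * (x j / m)) = (\<Sum>j=0..<n. A $$ (i, j) * x j) / m"
      by (simp add: sum_divide_distrib)
    then have "\<kappa> * m < \<bar>\<Sum>j=0..<n. A $$ (i, j) * x j\<bar>" using i(2) m(2) by (simp add: pos_less_divide_eq)
    moreover have "\<kappa> * \<bar>x k\<bar> \<le> \<kappa> * m" using m(1) \<kappa> by simp
    ultimately show ?thesis using i(1) by (intro exI[of _ i]) simp
  qed
  have det: "Determinant.det A \<noteq> 0"
  proof
    assume "Determinant.det A = 0"
    then obtain v where v: "v \<in> carrier_vec n" "v \<noteq> 0\<^sub>v n" "A *\<^sub>v v = 0\<^sub>v n"
      using det_0_iff_vec_prod_zero[OF A] by auto
    then obtain k where k: "k < n" "v $ k \<noteq> 0" by (metis carrier_vecD eq_vecI index_zero_vec)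
    obtain i where i: "i < n" "\<kappa> * \<bar>v $ k\<bar> < \<bar>\<Sum>j=0..<n. A $$ (i, j) * v $ j\<bar>"
      using inj'[of k "\<lambda>j. v $ j"] k by auto
    have "(\<Sum>j=0..<n. A $$ (i, j) * v $ j) = (A *\<^sub>v v) $ i"
      using A v(1) i(1) by (auto simp: scalar_prod_def)
    then show False using i v(3) \<kappa> by (simp add: mult_less_0_iff)
  qed
  define B where "B = (1 / Determinant.det A) \<cdot>\<^sub>m adj_mat A"
  have B: "B \<in> carrier_mat n n" using adj_mat(1)[OF A] by (simp add: B_def)
  have AB: "A * B = 1\<^sub>m n"
    unfolding B_def mult_smult_distrib[OF A adj_mat(1)[OF A]] adj_mat(2)[OF A]
    by (rule eq_matI) (auto simp: det)
  moreover have "\<bar>B $$ (j, k)\<bar> \<le> 1 / \<kappa>" if jk: "j < n" "k < n" for j k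
  proof (cases "B $$ (j, k) = 0")
    case True then show ?thesis using \<kappa> by simp
  next
    case False
    obtain i where i: "i < n" "\<kappa> * \<bar>B $$ (j, k)\<bar> < \<bar>\<Sum>l=0..<n. A $$ (i, l) * B $$ (l, k)\<bar>"
      using inj'[of j "\<lambda>l. B $$ (l, k)"] jk False by auto
    have "(\<Sum>l=0..<n. A $$ (i, l) * B $$ (l, k)) = (A * B) $$ (i, k)"
      using A B i(1) jk by (auto simp: scalar_prod_def)
    also have "\<dots> = (if i = k then 1 else 0)" unfolding AB using i(1) jk by simp
    finally have "\<kappa> * \<bar>B $$ (j, k)\<bar> < 1" using i(2) \<kappa> by (auto split: if_splits simp: mult_less_0_iff)
    then show ?thesis using \<kappa> by (simp add: field_simps)
  qed
  ultimately show ?thesis using B by blast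
qed

definition rdet :: "nat \<Rightarrow> (nat \<Rightarrow> nat \<Rightarrow> real) \<Rightarrow> real" where
  "rdet n x = Determinant.det (Matrix.mat n n (\<lambda>(i, j). x i j))"

text \<open>
  If \<open>B\<close> is the inverse of the matrix \<open>x\<close>, then the new matrix times \<open>B\<close> has unit vectors as its rows
  outside \<open>I\<close> and bounded rows in \<open>I\<close>; its determinant is the ratio of the two determinants.
  The second inequality bounds the determinant of \<open>B\<close> itself in the same way.
\<close>

lemma rdet_row_replacement:
  assumes inj: "\<And>y. sup_unit n y \<Longrightarrow> \<exists>i<n. \<kappa> < \<bar>\<Sum>j=0..<n. x i j * y j\<bar>"
    and \<kappa>: "0 < \<kappa>" and Q: "\<And>i j. i < n \<Longrightarrow> j < n \<Longrightarrow> \<bar>Q i j\<bar> \<le> K" and I: "I \<subseteq> {0..<n}" and K: "0 \<le> K"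
  shows "\<bar>rdet n (\<lambda>i. if i \<in> I then Q i else x i)\<bar> \<le> (real n * (real n * K / \<kappa>)) ^ card I * \<bar>rdet n x\<bar>"
    and "1 \<le> (real n / \<kappa>) ^ n * \<bar>rdet n x\<bar>"
proof -
  let ?A = "Matrix.mat n n (\<lambda>(i, j). x i j)"
  let ?R = "Matrix.mat n n (\<lambda>(i, j). (if i \<in> I then Q i else x i) j)"
  have A: "?A \<in> carrier_mat n n" and R: "?R \<in> carrier_mat n n" by auto
  have "\<exists>B \<in> carrier_mat n n. ?A * B = 1\<^sub>m n \<and> (\<forall>i<n. \<forall>j<n. \<bar>B $$ (i, j)\<bar> \<le> 1 / \<kappa>)"
  proof (rule bounded_inverse[OF A \<kappa>])
    fix y :: "nat \<Rightarrow> real" assume "sup_unit n y"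
    then obtain i where i: "i < n" "\<kappa> < \<bar>\<Sum>j=0..<n. x i j * y j\<bar>" using inj by blast
    have "(\<Sum>j=0..<n. ?A $$ (i, j) * y j) = (\<Sum>j=0..<n. x i j * y j)" using i(1) by (intro sum.cong) auto
    then show "\<exists>i<n. \<kappa> < \<bar>\<Sum>j=0..<n. ?A $$ (i, j) * y j\<bar>" using i by (intro exI[of _ i]) simp
  qed
  then obtain B where B: "B \<in> carrier_mat n n" "?A * B = 1\<^sub>m n" "\<And>i j. i < n \<Longrightarrow> j < n \<Longrightarrow> \<bar>B $$ (i, j)\<bar> \<le> 1 / \<kappa>"
    by blast
  have dAB: "Determinant.det ?A * Determinant.det B = 1"
    using det_mult[OF A B(1)] B(2) by simp
  have ent: "(?R * B) $$ (i, k) = (\<Sum>l=0..<n. (if i \<in> I then Q i else x i) l * B $$ (l, k))" if "i < n" "k < n" for i k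
    using that B(1) by (auto simp: scalar_prod_def)
  have entA: "(\<Sum>l=0..<n. x i l * B $$ (l, k)) = (if i = k then 1 else 0)" if "i < n" "k < n" for i k
  proof -
    have "(?A * B) $$ (i, k) = (\<Sum>l=0..<n. x i l * B $$ (l, k))" using that B(1) by (auto simp: scalar_prod_def)
    then show ?thesis unfolding B(2) using that by simp
  qed
  have "Determinant.det ?R = Determinant.det (?R * B) * Determinant.det ?A"
    using det_mult[OF R B(1)] dAB by (simp add: mult.assoc mult.commute)
  then have 1: "\<bar>rdet n (\<lambda>i. if i \<in> I then Q i else x i)\<bar> = \<bar>Determinant.det (?R * B)\<bar> * \<bar>rdet n x\<bar>"
    by (simp add: rdet_def abs_mult)
  have "\<bar>Determinant.det (?R * B)\<bar> \<le> (\<Prod>i=0..<n. \<Sum>j=0..<n. \<bar>(?R * B) $$ (i, j)\<bar>)"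
    using R B(1) by (intro abs_det_le_prod_row_sums) auto
  also have "\<dots> \<le> (\<Prod>i=0..<n. if i \<in> I then real n * (real n * K / \<kappa>) else 1)"
  proof (intro prod_mono conjI sum_nonneg)
    fix i assume "i \<in> {0..<n}"
    then have i: "i < n" by simp
    show "(\<Sum>j=0..<n. \<bar>(?R * B) $$ (i, j)\<bar>) \<le> (if i \<in> I then real n * (real n * K / \<kappa>) else 1)"
    proof (cases "i \<in> I")
      case True
      have "\<bar>(?R * B) $$ (i, j)\<bar> \<le> real n * K / \<kappa>" if j: "j < n" for j
      proof -
        have "\<bar>(?R * B) $$ (i, j)\<bar> \<le> (\<Sum>l=0..<n. \<bar>Q i l * B $$ (l, j)\<bar>)"
          unfolding ent[OF i j] using True by simp
        also have "\<dots> \<le> (\<Sum>l=0..<n. K * (1 / \<kappa>))"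
          unfolding abs_mult using Q[OF i] B(3)[OF _ j] K by (intro sum_mono mult_mono) auto
        finally show ?thesis by simp
      qed
      then have "(\<Sum>j=0..<n. \<bar>(?R * B) $$ (i, j)\<bar>) \<le> (\<Sum>j=0..<n. real n * K / \<kappa>)"
        by (intro sum_mono) auto
      then show ?thesis using True by simp
    next
      case False
      have "(\<Sum>j=0..<n. \<bar>(?R * B) $$ (i, j)\<bar>) = (\<Sum>j=0..<n. if i = j then 1 else 0)"
        by (rule sum.cong[OF refl]) (use ent[OF i] entA[OF i] False in auto)
      then show ?thesis using False i by simp
    qed
  qed auto
  also have "\<dots> = (real n * (real n * K / \<kappa>)) ^ card I"
  proof -
    have "(\<Prod>i=0..<n. if i \<in> I then real n * (real n * K / \<kappa>) else 1) = (\<Prod>i\<in>{0..<n} \<inter> I. real n * (real n * K / \<kappa>))"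
      by (rule prod.inter_restrict[symmetric]) simp
    also have "{0..<n} \<inter> I = I" using I by blast
    finally show ?thesis by simp
  qed
  finally show "\<bar>rdet n (\<lambda>i. if i \<in> I then Q i else x i)\<bar> \<le> (real n * (real n * K / \<kappa>)) ^ card I * \<bar>rdet n x\<bar>"
    unfolding 1 by (intro mult_right_mono) auto
  have "\<bar>Determinant.det B\<bar> \<le> (\<Prod>i=0..<n. \<Sum>j=0..<n. \<bar>B $$ (i, j)\<bar>)" by (rule abs_det_le_prod_row_sums[OF B(1)])
  also have "\<dots> \<le> (\<Prod>i=0..<n. real n / \<kappa>)"
  proof (intro prod_mono conjI sum_nonneg)
    fix i assume "i \<in> {0..<n}"
    then have "(\<Sum>j=0..<n. \<bar>B $$ (i, j)\<bar>) \<le> (\<Sum>j=0..<n. 1 / \<kappa>)" using B(3) by (intro sum_mono) auto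
    then show "(\<Sum>j=0..<n. \<bar>B $$ (i, j)\<bar>) \<le> real n / \<kappa>" by simp
  qed auto
  finally have b: "\<bar>Determinant.det B\<bar> \<le> (real n / \<kappa>) ^ n" by simp
  have "1 = \<bar>Determinant.det B\<bar> * \<bar>rdet n x\<bar>"
    using dAB unfolding rdet_def abs_mult[symmetric] by (simp add: mult.commute)
  also have "\<dots> \<le> (real n / \<kappa>) ^ n * \<bar>rdet n x\<bar>" using b by (intro mult_right_mono) auto
  finally show "1 \<le> (real n / \<kappa>) ^ n * \<bar>rdet n x\<bar>" .
qed

lemma rdet_cong: "(\<And>i j. i < n \<Longrightarrow> j < n \<Longrightarrow> x i j = y i j) \<Longrightarrow> rdet n x = rdet n y"
  unfolding rdet_def by (intro arg_cong[where f = Determinant.det] eq_matI) auto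

text \<open>
  The determinant is linear in row \<open>i\<close>, so over a cube its absolute value is largest at a vertex.
\<close>

lemma abs_rdet_row_vertex:
  assumes i: "i < n" and K: "0 \<le> K" and xi: "\<And>j. j < n \<Longrightarrow> \<bar>x i j\<bar> \<le> K"
  shows "\<exists>q \<in> {0..<n} \<rightarrow>\<^sub>E {-K, K}. \<bar>rdet n x\<bar> \<le> \<bar>rdet n (x(i := q))\<bar>"
proof -
  let ?A = "\<lambda>x. Matrix.mat n n (\<lambda>(i, j). x i j)"
  define cf where "cf j = cofactor (?A x) i j" for j
  have exp: "rdet n (x(i := r)) = (\<Sum>j<n. r j * cf j)" for r
  proof -
    have "cofactor (?A (x(i := r))) i j = cf j" if "j < n" for j
    proof -
      have "mat_delete (?A (x(i := r))) i j = mat_delete (?A x) i j"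
        unfolding mat_delete_def by (rule cong_mat) (auto simp: i)
      then show ?thesis by (simp add: cf_def cofactor_def)
    qed
    moreover have "rdet n (x(i := r)) = (\<Sum>j<n. ?A (x(i := r)) $$ (i, j) * cofactor (?A (x(i := r))) i j)"
      unfolding rdet_def by (rule laplace_expansion_row) (auto simp: i)
    ultimately show ?thesis using i by simp
  qed
  define q where "q = (\<lambda>j\<in>{0..<n}. if cf j < 0 then - K else K)"
  have q: "q j * cf j = K * \<bar>cf j\<bar>" if "j < n" for j using that by (simp add: q_def abs_if)
  have "\<bar>rdet n x\<bar> = \<bar>\<Sum>j<n. x i j * cf j\<bar>" using exp[of "x i"] by simp
  also have "\<dots> \<le> (\<Sum>j<n. \<bar>x i j * cf j\<bar>)" by (rule sum_abs)
  also have "\<dots> \<le> (\<Sum>j<n. K * \<bar>cf j\<bar>)" using xi by (intro sum_mono) (auto simp: abs_mult intro: mult_right_mono)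
  also have "\<dots> = (\<Sum>j<n. q j * cf j)" using q by simp
  also have "\<dots> = rdet n (x(i := q))" by (rule exp[symmetric])
  finally have "\<bar>rdet n x\<bar> \<le> \<bar>rdet n (x(i := q))\<bar>" by simp
  moreover have "q \<in> {0..<n} \<rightarrow>\<^sub>E {-K, K}" by (auto simp: q_def)
  ultimately show ?thesis by blast
qed

text \<open>
  Replacing the rows in \<open>I\<close> by \<open>Q\<close> costs a factor \<open>exp b\<close> for every row. It suffices to let \<open>Q\<close> run over the vertices of a
  cube; so the maximum that defines \<open>sup_det\<close> is over a finite set, and it is a measurable function of the matrix.
\<close>

definition sup_det_terms :: "nat \<Rightarrow> real \<Rightarrow> (nat set \<times> (nat \<Rightarrow> nat \<Rightarrow> real)) set" where
  "sup_det_terms n K = Pow {0..<n} \<times> ({0..<n} \<rightarrow>\<^sub>E ({0..<n} \<rightarrow>\<^sub>E {-K, K}))"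

definition sup_det_term :: "nat \<Rightarrow> real \<Rightarrow> (nat \<Rightarrow> nat \<Rightarrow> real) \<Rightarrow> nat set \<times> (nat \<Rightarrow> nat \<Rightarrow> real) \<Rightarrow> real" where
  "sup_det_term n b x = (\<lambda>(I, Q). exp (- b * real (card I)) * \<bar>rdet n (\<lambda>i. if i \<in> I then Q i else x i)\<bar>)"

definition sup_det :: "nat \<Rightarrow> real \<Rightarrow> real \<Rightarrow> (nat \<Rightarrow> nat \<Rightarrow> real) \<Rightarrow> real" where
  "sup_det n K b x = Max (sup_det_term n b x ` sup_det_terms n K)"

lemma finite_sup_det_terms: "finite (sup_det_terms n K)"
  unfolding sup_det_terms_def by (intro finite_cartesian_product finite_PiE) auto

lemma sup_det_terms_nonempty: "({}, \<lambda>i\<in>{0..<n}. \<lambda>j\<in>{0..<n}. K) \<in> sup_det_terms n K"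
  unfolding sup_det_terms_def by auto

lemma sup_det_upper: "T \<in> sup_det_terms n K \<Longrightarrow> sup_det_term n b x T \<le> sup_det n K b x"
  unfolding sup_det_def using finite_sup_det_terms by (intro Max_ge) auto

lemma sup_det_least: "(\<And>T. T \<in> sup_det_terms n K \<Longrightarrow> sup_det_term n b x T \<le> z) \<Longrightarrow> sup_det n K b x \<le> z"
  unfolding sup_det_def using finite_sup_det_terms sup_det_terms_nonempty[of K n] by (subst Max_le_iff) auto

lemma abs_rdet_le_sup_det: "\<bar>rdet n x\<bar> \<le> sup_det n K b x"
  using sup_det_upper[OF sup_det_terms_nonempty, of n b x K] by (simp add: sup_det_term_def)

lemma sup_det_nonneg: "0 \<le> sup_det n K b x"
  using abs_rdet_le_sup_det[of n x K b] by linarith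

text \<open>
  If row \<open>i\<close> is kept by a competitor for \<open>x\<close>, it can be replaced by a vertex row without a decrease
  of the determinant. The result is a competitor for \<open>y\<close>, at the price of one more row.
\<close>

lemma sup_det_row_lipschitz:
  assumes i: "i < n" and K: "0 \<le> K" and b: "0 \<le> b" and xi: "\<And>j. j < n \<Longrightarrow> \<bar>x i j\<bar> \<le> K"
    and xy: "\<And>k. k < n \<Longrightarrow> k \<noteq> i \<Longrightarrow> x k = y k"
  shows "sup_det n K b x \<le> exp b * sup_det n K b y"
proof (rule sup_det_least)
  fix T assume T: "T \<in> sup_det_terms n K"
  obtain I Q where IQ: "T = (I, Q)" by (cases T)
  have I: "I \<subseteq> {0..<n}" and Q: "Q \<in> {0..<n} \<rightarrow>\<^sub>E ({0..<n} \<rightarrow>\<^sub>E {-K, K})"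
    using T unfolding IQ sup_det_terms_def by auto
  have finI: "finite I" using I finite_subset by blast
  show "sup_det_term n b x T \<le> exp b * sup_det n K b y"
  proof (cases "i \<in> I")
    case True
    have "rdet n (\<lambda>k. if k \<in> I then Q k else x k) = rdet n (\<lambda>k. if k \<in> I then Q k else y k)"
      by (rule rdet_cong) (use xy True in metis)
    then have "sup_det_term n b x T = sup_det_term n b y T" by (simp add: IQ sup_det_term_def)
    also have "\<dots> \<le> sup_det n K b y" by (rule sup_det_upper[OF T])
    also have "\<dots> \<le> exp b * sup_det n K b y"
      using mult_right_mono[of 1 "exp b" "sup_det n K b y"] b sup_det_nonneg by simp
    finally show ?thesis .
  next
    case False
    let ?z = "\<lambda>k. if k \<in> I then Q k else x k"
    obtain q where q: "q \<in> {0..<n} \<rightarrow>\<^sub>E {-K, K}" "\<bar>rdet n ?z\<bar> \<le> \<bar>rdet n (?z(i := q))\<bar>"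
      using abs_rdet_row_vertex[OF i K, of ?z] xi False by auto
    let ?T = "(insert i I, Q(i := q))"
    have T': "?T \<in> sup_det_terms n K"
      using I Q q(1) i unfolding sup_det_terms_def by (auto simp: PiE_iff extensional_def)
    have "rdet n (?z(i := q)) = rdet n (\<lambda>k. if k \<in> insert i I then (Q(i := q)) k else y k)"
      by (rule rdet_cong) (use xy in auto)
    then have "\<bar>rdet n ?z\<bar> \<le> \<bar>rdet n (\<lambda>k. if k \<in> insert i I then (Q(i := q)) k else y k)\<bar>" using q(2) by simp
    then have "exp (- b * real (card I)) * \<bar>rdet n ?z\<bar>
        \<le> exp (- b * real (card I)) * \<bar>rdet n (\<lambda>k. if k \<in> insert i I then (Q(i := q)) k else y k)\<bar>"
      by (intro mult_left_mono) auto
    also have "\<dots> = exp b * (exp (- b * real (card (insert i I)))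
        * \<bar>rdet n (\<lambda>k. if k \<in> insert i I then (Q(i := q)) k else y k)\<bar>)"
    proof -
      have e: "exp (- b * real (card I)) = exp b * exp (- b * real (card (insert i I)))"
        using False finI by (simp add: exp_add[symmetric] algebra_simps)
      show ?thesis by (simp only: e mult.assoc)
    qed
    finally have "sup_det_term n b x T \<le> exp b * sup_det_term n b y ?T"
      unfolding IQ sup_det_term_def prod.case .
    also have "\<dots> \<le> exp b * sup_det n K b y" by (intro mult_left_mono sup_det_upper[OF T']) auto
    finally show ?thesis .
  qed
qed

lemma sup_det_eq:
  assumes inj: "\<And>y. sup_unit n y \<Longrightarrow> \<exists>i<n. \<kappa> < \<bar>\<Sum>j=0..<n. x i j * y j\<bar>"
    and \<kappa>: "0 < \<kappa>" and K: "0 \<le> K" and b: "real n * (real n * K / \<kappa>) \<le> exp b"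
  shows "sup_det n K b x = \<bar>rdet n x\<bar>"
proof (rule antisym[OF sup_det_least abs_rdet_le_sup_det])
  fix T assume T: "T \<in> sup_det_terms n K"
  obtain I Q where IQ: "T = (I, Q)" by (cases T)
  have I: "I \<subseteq> {0..<n}" and Q: "Q \<in> {0..<n} \<rightarrow>\<^sub>E ({0..<n} \<rightarrow>\<^sub>E {-K, K})"
    using T unfolding IQ sup_det_terms_def by auto
  have QK: "\<bar>Q i j\<bar> \<le> K" if "i < n" "j < n" for i j
  proof -
    have "Q i \<in> {0..<n} \<rightarrow>\<^sub>E {-K, K}" using PiE_mem[OF Q, of i] that by simp
    then have "Q i j \<in> {-K, K}" using PiE_mem[of "Q i" "{0..<n}" "\<lambda>_. {-K, K}" j] that by simp
    then show ?thesis using K by auto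
  qed
  have "\<bar>rdet n (\<lambda>i. if i \<in> I then Q i else x i)\<bar> \<le> (real n * (real n * K / \<kappa>)) ^ card I * \<bar>rdet n x\<bar>"
    by (rule rdet_row_replacement(1)[OF inj \<kappa> QK I K])
  also have "\<dots> \<le> exp b ^ card I * \<bar>rdet n x\<bar>"
    using K \<kappa> by (intro mult_right_mono power_mono b) auto
  finally have "exp (- b * real (card I)) * \<bar>rdet n (\<lambda>i. if i \<in> I then Q i else x i)\<bar>
      \<le> exp (- b * real (card I)) * (exp b ^ card I * \<bar>rdet n x\<bar>)"
    by (intro mult_left_mono) auto
  also have "\<dots> = \<bar>rdet n x\<bar>"
    by (simp add: exp_of_nat_mult[symmetric] mult.assoc[symmetric] exp_add[symmetric])
  finally show "sup_det_term n b x T \<le> \<bar>rdet n x\<bar>" by (simp add: IQ sup_det_term_def)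
qed

lemma sup_det_bound:
  assumes K: "0 \<le> K" and b: "0 \<le> b" and x: "\<And>i j. i < n \<Longrightarrow> j < n \<Longrightarrow> \<bar>x i j\<bar> \<le> K"
  shows "sup_det n K b x \<le> (real n * K) ^ n"
proof (rule sup_det_least)
  fix T assume T: "T \<in> sup_det_terms n K"
  obtain I Q where IQ: "T = (I, Q)" by (cases T)
  have Q: "Q \<in> {0..<n} \<rightarrow>\<^sub>E ({0..<n} \<rightarrow>\<^sub>E {-K, K})"
    using T unfolding IQ sup_det_terms_def by auto
  let ?z = "\<lambda>i. if i \<in> I then Q i else x i"
  have z: "\<bar>?z i j\<bar> \<le> K" if "i < n" "j < n" for i j
  proof -
    have "Q i \<in> {0..<n} \<rightarrow>\<^sub>E {-K, K}" using PiE_mem[OF Q, of i] that by simp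
    then have "Q i j \<in> {-K, K}" using PiE_mem[of "Q i" "{0..<n}" "\<lambda>_. {-K, K}" j] that by simp
    then show ?thesis using K x[OF that] by auto
  qed
  have "\<bar>rdet n ?z\<bar> \<le> (\<Prod>i=0..<n. \<Sum>j=0..<n. \<bar>Matrix.mat n n (\<lambda>(i, j). ?z i j) $$ (i, j)\<bar>)"
    unfolding rdet_def by (rule abs_det_le_prod_row_sums) simp
  also have "\<dots> \<le> (\<Prod>i=0..<n. real n * K)"
  proof (intro prod_mono conjI sum_nonneg)
    fix i assume i: "i \<in> {0..<n}"
    have "(\<Sum>j=0..<n. \<bar>Matrix.mat n n (\<lambda>(i, j). ?z i j) $$ (i, j)\<bar>) \<le> (\<Sum>j=0..<n. K)"
      using z i by (intro sum_mono) auto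
    then show "(\<Sum>j=0..<n. \<bar>Matrix.mat n n (\<lambda>(i, j). ?z i j) $$ (i, j)\<bar>) \<le> real n * K" by simp
  qed auto
  finally have z': "\<bar>rdet n ?z\<bar> \<le> (real n * K) ^ n" by simp
  have "sup_det_term n b x T \<le> 1 * \<bar>rdet n ?z\<bar>"
    unfolding IQ sup_det_term_def prod.case using b by (intro mult_right_mono) auto
  then show "sup_det_term n b x T \<le> (real n * K) ^ n" using z' by simp
qed

section \<open>Functions with bounded differences\<close>

text \<open>
  Integrate out one coordinate at a time: the partial mean inherits the bounds, and Hoeffding's lemma applies
  to the fluctuation in that coordinate.
\<close>

lemma mcdiarmid_mgf:
  fixes f :: "('i \<Rightarrow> 'a) \<Rightarrow> real" and M :: "'i \<Rightarrow> 'a measure"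
  assumes M: "\<And>i. prob_space (M i)" and "finite I" and "f \<in> borel_measurable (PiM I M)"
    and "\<And>x. x \<in> space (PiM I M) \<Longrightarrow> \<bar>f x\<bar> \<le> R"
    and "\<And>x i y. x \<in> space (PiM I M) \<Longrightarrow> i \<in> I \<Longrightarrow> y \<in> space (M i) \<Longrightarrow> \<bar>f (x(i := y)) - f x\<bar> \<le> b"
    and l: "0 < l"
  shows "(\<integral>x. exp (l * f x) \<partial>PiM I M) \<le> exp (l * (\<integral>x. f x \<partial>PiM I M) + real (card I) * (l\<^sup>2 * b\<^sup>2 / 2))"
  using assms(2-5)
proof (induction I arbitrary: f rule: finite_induct)
  case empty
  then show ?case by (simp add: PiM_empty lebesgue_integral_count_space_finite)
next
  case (insert i I)
  interpret product_sigma_finite M using M by (simp add: product_sigma_finite_def prob_space_imp_sigma_finite)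
  note fm[measurable] = insert.prems(1) and bound = insert.prems(2) and lip = insert.prems(3)
  let ?P = "PiM I M"
  interpret P: prob_space ?P by (rule prob_space_PiM) (rule M)
  interpret PI: prob_space "PiM (insert i I) M" by (rule prob_space_PiM) (rule M)
  interpret N: prob_space "M i" by (rule M)
  have upd: "x(i := y) \<in> space (PiM (insert i I) M)" if "x \<in> space ?P" "y \<in> space (M i)" for x y
    using that by (auto simp: space_PiM PiE_iff extensional_def)
  have m2: "(\<lambda>(x, y). f (x(i := y))) \<in> borel_measurable (?P \<Otimes>\<^sub>M M i)"
    using measurable_compose[OF measurable_add_dim fm] by (simp add: case_prod_beta')
  have my: "(\<lambda>y. f (x(i := y))) \<in> borel_measurable (M i)" if "x \<in> space ?P" for x
    using measurable_compose[OF measurable_Pair1'[OF that] m2] by simp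
  define g where "g x = (\<integral>y. f (x(i := y)) \<partial>M i)" for x
  have gm[measurable]: "g \<in> borel_measurable ?P"
    unfolding g_def using sigma_finite_measure.borel_measurable_lebesgue_integral[OF prob_space_imp_sigma_finite[OF M] m2] by simp
  have iy: "integrable (M i) (\<lambda>y. f (x(i := y)))" if "x \<in> space ?P" for x
    by (rule N.integrable_const_bound[of _ R]) (use bound upd that my in auto)
  have gb: "\<bar>g x\<bar> \<le> R" if x: "x \<in> space ?P" for x
  proof -
    have "\<bar>g x\<bar> \<le> (\<integral>y. \<bar>f (x(i := y))\<bar> \<partial>M i)" unfolding g_def by (rule integral_abs_bound)
    also have "\<dots> \<le> (\<integral>y. R \<partial>M i)"
      using iy[OF x] bound upd[OF x] by (intro integral_mono) auto
    finally show ?thesis by (simp add: N.prob_space)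
  qed
  have glip: "\<bar>g (x(j := z)) - g x\<bar> \<le> b" if x: "x \<in> space ?P" and j: "j \<in> I" and z: "z \<in> space (M j)" for x j z
  proof -
    have ij: "i \<noteq> j" using j insert.hyps by auto
    have x': "x(j := z) \<in> space ?P" using x j z by (auto simp: space_PiM PiE_iff extensional_def)
    have "g (x(j := z)) - g x = (\<integral>y. f (x(j := z, i := y)) - f (x(i := y)) \<partial>M i)"
      unfolding g_def using iy[OF x] iy[OF x'] by simp
    then have "\<bar>g (x(j := z)) - g x\<bar> \<le> (\<integral>y. \<bar>f (x(j := z, i := y)) - f (x(i := y))\<bar> \<partial>M i)"
      using integral_abs_bound by simp
    also have "\<dots> \<le> (\<integral>y. b \<partial>M i)"
    proof (rule integral_mono)
      show "\<bar>f (x(j := z, i := y)) - f (x(i := y))\<bar> \<le> b" if "y \<in> space (M i)" for y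
        unfolding fun_upd_twist[OF ij[symmetric]]
        by (rule lip[OF upd[OF x that]]) (use j z in auto)
    qed (use iy[OF x] iy[OF x'] in auto)
    finally show ?thesis by (simp add: N.prob_space)
  qed
  have near: "\<bar>f (x(i := y)) - g x\<bar> \<le> b" if x: "x \<in> space ?P" and y: "y \<in> space (M i)" for x y
  proof -
    have "f (x(i := y)) - g x = (\<integral>z. f (x(i := y)) - f (x(i := z)) \<partial>M i)"
      unfolding g_def using iy[OF x] by (simp add: N.prob_space)
    then have "\<bar>f (x(i := y)) - g x\<bar> \<le> (\<integral>z. \<bar>f (x(i := y)) - f (x(i := z))\<bar> \<partial>M i)"
      using integral_abs_bound by simp
    also have "\<dots> \<le> (\<integral>z. b \<partial>M i)"
    proof (rule integral_mono)
      show "\<bar>f (x(i := y)) - f (x(i := z))\<bar> \<le> b" if "z \<in> space (M i)" for z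
      proof -
        have "\<bar>f ((x(i := z))(i := y)) - f (x(i := z))\<bar> \<le> b"
          by (rule lip[OF upd[OF x that]]) (use y in auto)
        then show ?thesis by (simp only: fun_upd_upd)
      qed
    qed (use iy[OF x] in auto)
    finally show ?thesis by (simp add: N.prob_space)
  qed
  have hoeffding: "(\<integral>y. exp (l * f (x(i := y))) \<partial>M i) \<le> exp (l\<^sup>2 * b\<^sup>2 / 2) * exp (l * g x)" if x: "x \<in> space ?P" for x
  proof -
    interpret V: interval_bounded_random_variable "M i" "\<lambda>y. f (x(i := y))" "g x - b" "g x + b"
    proof
      show "AE y in M i. f (x(i := y)) \<in> {g x - b..g x + b}"
        by (rule AE_I2) (use near[OF x] in \<open>auto simp: abs_le_iff algebra_simps\<close>)
    qed (rule my[OF x])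
    have "(\<integral>\<^sup>+y. ennreal (exp (l * (f (x(i := y)) - g x))) \<partial>M i) \<le> ennreal (exp (l\<^sup>2 * (g x + b - (g x - b))\<^sup>2 / 8))"
      using V.Hoeffdings_lemma_nn_integral[OF l] by (simp add: g_def)
    then have "(\<integral>y. exp (l * (f (x(i := y)) - g x)) \<partial>M i) \<le> exp (l\<^sup>2 * (g x + b - (g x - b))\<^sup>2 / 8)"
      by (intro integral_real_bounded) auto
    also have "l\<^sup>2 * (g x + b - (g x - b))\<^sup>2 / 8 = l\<^sup>2 * b\<^sup>2 / 2" by (simp add: power2_eq_square algebra_simps)
    finally have "exp (l * g x) * (\<integral>y. exp (l * (f (x(i := y)) - g x)) \<partial>M i) \<le> exp (l * g x) * exp (l\<^sup>2 * b\<^sup>2 / 2)"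
      by (rule mult_left_mono) (rule exp_ge_zero)
    moreover have "exp (l * g x) * (\<integral>y. exp (l * (f (x(i := y)) - g x)) \<partial>M i) = (\<integral>y. exp (l * f (x(i := y))) \<partial>M i)"
      by (subst integral_mult_right_zero[symmetric]) (simp add: exp_add[symmetric] algebra_simps)
    ultimately show ?thesis by (simp add: mult.commute)
  qed
  have eb: "\<bar>exp (l * f x)\<bar> \<le> exp (l * R)" if "x \<in> space (PiM (insert i I) M)" for x
    using bound[OF that] l by (auto simp: abs_le_iff)
  have iexp: "integrable (PiM (insert i I) M) (\<lambda>x. exp (l * f x))"
    by (rule PI.integrable_const_bound[of _ "exp (l * R)"]) (use eb in auto)
  have if': "integrable (PiM (insert i I) M) f"
    by (rule PI.integrable_const_bound[of _ R]) (use bound in auto)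
  have ig: "integrable ?P (\<lambda>x. exp (l * g x))"
    by (rule P.integrable_const_bound[of _ "exp (l * R)"]) (use gb l in \<open>auto simp: abs_le_iff\<close>)
  have m2e: "(\<lambda>(x, y). exp (l * f (x(i := y)))) \<in> borel_measurable (?P \<Otimes>\<^sub>M M i)"
    using m2 by (simp add: case_prod_beta')
  have "(\<integral>x. exp (l * f x) \<partial>PiM (insert i I) M) = (\<integral>x. (\<integral>y. exp (l * f (x(i := y))) \<partial>M i) \<partial>?P)"
    by (rule product_integral_insert[OF insert.hyps(1,2) iexp])
  also have "\<dots> \<le> (\<integral>x. exp (l\<^sup>2 * b\<^sup>2 / 2) * exp (l * g x) \<partial>?P)"
  proof (rule integral_mono)
    show "integrable ?P (\<lambda>x. \<integral>y. exp (l * f (x(i := y))) \<partial>M i)"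
    proof (rule P.integrable_const_bound[of _ "exp (l\<^sup>2 * b\<^sup>2 / 2) * exp (l * R)"])
      show "AE x in ?P. norm (\<integral>y. exp (l * f (x(i := y))) \<partial>M i) \<le> exp (l\<^sup>2 * b\<^sup>2 / 2) * exp (l * R)"
      proof (rule AE_I2)
        fix x assume x: "x \<in> space ?P"
        have "0 \<le> (\<integral>y. exp (l * f (x(i := y))) \<partial>M i)" by (rule Bochner_Integration.integral_nonneg) simp
        moreover have "exp (l\<^sup>2 * b\<^sup>2 / 2) * exp (l * g x) \<le> exp (l\<^sup>2 * b\<^sup>2 / 2) * exp (l * R)"
          using gb[OF x] l by (intro mult_left_mono) auto
        moreover have "(\<integral>y. exp (l * f (x(i := y))) \<partial>M i) \<le> exp (l\<^sup>2 * b\<^sup>2 / 2) * exp (l * R)"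
          by (rule order.trans[OF hoeffding[OF x]]) fact
        ultimately show "norm (\<integral>y. exp (l * f (x(i := y))) \<partial>M i) \<le> exp (l\<^sup>2 * b\<^sup>2 / 2) * exp (l * R)"
          by (simp only: real_norm_def abs_of_nonneg)
      qed
      show "(\<lambda>x. \<integral>y. exp (l * f (x(i := y))) \<partial>M i) \<in> borel_measurable ?P"
        using sigma_finite_measure.borel_measurable_lebesgue_integral[OF prob_space_imp_sigma_finite[OF M] m2e] by simp
    qed
  qed (use ig hoeffding in auto)
  also have "\<dots> = exp (l\<^sup>2 * b\<^sup>2 / 2) * (\<integral>x. exp (l * g x) \<partial>?P)" by simp
  also have "\<dots> \<le> exp (l\<^sup>2 * b\<^sup>2 / 2) * exp (l * (\<integral>x. g x \<partial>?P) + real (card I) * (l\<^sup>2 * b\<^sup>2 / 2))"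
    using insert.IH[OF gm gb glip] by (intro mult_left_mono) auto
  also have "(\<integral>x. g x \<partial>?P) = (\<integral>x. f x \<partial>PiM (insert i I) M)"
    unfolding g_def using product_integral_insert[OF insert.hyps(1,2) if'] by simp
  also have "exp (l\<^sup>2 * b\<^sup>2 / 2) * exp (l * (\<integral>x. f x \<partial>PiM (insert i I) M) + real (card I) * (l\<^sup>2 * b\<^sup>2 / 2))
      = exp (l * (\<integral>x. f x \<partial>PiM (insert i I) M) + real (card (insert i I)) * (l\<^sup>2 * b\<^sup>2 / 2))"
    using insert.hyps by (simp add: exp_add[symmetric] algebra_simps)
  finally show ?case .
qed

lemma mcdiarmid:
  fixes f :: "('i \<Rightarrow> 'a) \<Rightarrow> real" and M :: "'i \<Rightarrow> 'a measure"
  assumes M: "\<And>i. prob_space (M i)" and I: "finite I" "I \<noteq> {}" and fm[measurable]: "f \<in> borel_measurable (PiM I M)"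
    and bound: "\<And>x. x \<in> space (PiM I M) \<Longrightarrow> \<bar>f x\<bar> \<le> R"
    and lip: "\<And>x i y. x \<in> space (PiM I M) \<Longrightarrow> i \<in> I \<Longrightarrow> y \<in> space (M i) \<Longrightarrow> \<bar>f (x(i := y)) - f x\<bar> \<le> b"
    and b: "0 < b" and r: "0 < r"
  shows "measure (PiM I M) {x \<in> space (PiM I M). (\<integral>x. f x \<partial>PiM I M) + r \<le> f x} \<le> exp (- r\<^sup>2 / (2 * b\<^sup>2 * card I))"
proof -
  interpret PI: prob_space "PiM I M" by (rule prob_space_PiM) (rule M)
  define n where "n = real (card I)"
  have n: "0 < n" using I by (simp add: n_def card_gt_0_iff)
  define \<mu> where "\<mu> = (\<integral>x. f x \<partial>PiM I M)"
  \<comment> \<open>This \<open>l\<close> minimizes \<open>n l\<^sup>2 b\<^sup>2 / 2 - l r\<close>.\<close>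
  define l where "l = r / (b\<^sup>2 * n)"
  have l: "0 < l" using n b r by (simp add: l_def)
  have iexp: "integrable (PiM I M) (\<lambda>x. exp (l * f x))"
    by (rule PI.integrable_const_bound[of _ "exp (l * R)"]) (use bound l in \<open>auto simp: abs_le_iff\<close>)
  have "{x \<in> space (PiM I M). \<mu> + r \<le> f x} = {x \<in> space (PiM I M). exp (l * (\<mu> + r)) \<le> exp (l * f x)}"
    using l by auto
  then have "measure (PiM I M) {x \<in> space (PiM I M). \<mu> + r \<le> f x} \<le> (\<integral>x. exp (l * f x) \<partial>PiM I M) / exp (l * (\<mu> + r))"
    using integral_Markov_inequality_measure[OF iexp sets.top, of "exp (l * (\<mu> + r))"] by simp
  also have "\<dots> \<le> exp (l * \<mu> + n * (l\<^sup>2 * b\<^sup>2 / 2)) / exp (l * (\<mu> + r))"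
    using mcdiarmid_mgf[OF M I(1) fm bound lip l] by (intro divide_right_mono) (auto simp: \<mu>_def n_def)
  also have "\<dots> = exp (n * (l\<^sup>2 * b\<^sup>2 / 2) - l * r)" by (simp add: exp_diff[symmetric] algebra_simps)
  also have "n * (l\<^sup>2 * b\<^sup>2 / 2) - l * r = - r\<^sup>2 / (2 * b\<^sup>2 * n)"
    using n b by (simp add: l_def power2_eq_square field_simps)
  finally show ?thesis by (simp add: \<mu>_def n_def)
qed

section \<open>The second moment of the estimator\<close>

lemma half_sum_bound:
  fixes p r s a b c d :: real
  assumes "p \<le> (r + s) / 2" "r \<le> (a + b) / 2" "s \<le> (c + d) / 2" "0 \<le> a" "0 \<le> b" "0 \<le> c" "0 \<le> d"
  shows "p \<le> a + b + c + d"
proof -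
  have "2 * p \<le> r + s" "2 * r \<le> a + b" "2 * s \<le> c + d" using assms(1-3) by simp_all
  then show ?thesis using assms(4-7) by linarith
qed

context standardized
begin

lemma indep_prod_isolated:
  assumes "e \<in> E" "f1 \<in> E" "f2 \<in> E" "f3 \<in> E" "e \<noteq> f1" "e \<noteq> f2" "e \<noteq> f3"
  shows "expectation (\<lambda>\<omega>. u e \<omega> * (u f1 \<omega> * u f2 \<omega> * u f3 \<omega>)) = 0"
proof -
  have ind: "indep_var borel (\<lambda>\<omega>. restrict (\<lambda>e. u e \<omega>) {e} e) borel
     (\<lambda>\<omega>. restrict (\<lambda>e. u e \<omega>) {f1, f2, f3} f1 * restrict (\<lambda>e. u e \<omega>) {f1, f2, f3} f2 * restrict (\<lambda>e. u e \<omega>) {f1, f2, f3} f3)"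
    by (rule indep_blocks[of "{e}" "{f1, f2, f3}" "\<lambda>f. f e" borel "\<lambda>f. f f1 * f f2 * f f3" borel])
       (use assms in auto)
  then have ind: "indep_var borel (u e) borel (\<lambda>\<omega>. u f1 \<omega> * u f2 \<omega> * u f3 \<omega>)" by simp
  have "integrable P (\<lambda>\<omega>. u f1 \<omega> * u f2 \<omega> * u f3 \<omega>)"
  proof (rule Bochner_Integration.integrable_bound)
    show "integrable P (\<lambda>\<omega>. 1 + u f1 \<omega> ^ 4 + u f2 \<omega> ^ 4 + u f3 \<omega> ^ 4)" using int4 assms by simp
    show "AE \<omega> in P. norm (u f1 \<omega> * u f2 \<omega> * u f3 \<omega>) \<le> norm (1 + u f1 \<omega> ^ 4 + u f2 \<omega> ^ 4 + u f3 \<omega> ^ 4)"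
    proof (rule AE_I2)
      fix \<omega>
      define x y z where "x = \<bar>u f1 \<omega>\<bar>" and "y = \<bar>u f2 \<omega>\<bar>" and "z = \<bar>u f3 \<omega>\<bar>"
      have xy: "x * y \<le> (x\<^sup>2 + y\<^sup>2) / 2" for x y :: real
        using zero_le_power2[of "x - y"] by (simp add: power2_diff)
      have "x * y * z * 1 \<le> ((x * y)\<^sup>2 + z\<^sup>2) / 2" using xy[of "x * y" z] by simp
      moreover have "(x * y)\<^sup>2 \<le> (x ^ 4 + y ^ 4) / 2" using xy[of "x\<^sup>2" "y\<^sup>2"] by (simp add: power_mult_distrib)
      moreover have "z\<^sup>2 \<le> (z ^ 4 + 1) / 2" using xy[of "z\<^sup>2" 1] by simp
      moreover have "0 \<le> x ^ 4" "0 \<le> y ^ 4" "0 \<le> z ^ 4" by simp_all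
      ultimately have "x * y * z * 1 \<le> x ^ 4 + y ^ 4 + z ^ 4 + 1" by (intro half_sum_bound) simp_all
      then have "x * y * z \<le> 1 + x ^ 4 + y ^ 4 + z ^ 4" by (simp add: add_ac)
      then show "norm (u f1 \<omega> * u f2 \<omega> * u f3 \<omega>) \<le> norm (1 + u f1 \<omega> ^ 4 + u f2 \<omega> ^ 4 + u f3 \<omega> ^ 4)"
        by (simp add: x_def y_def z_def abs_mult)
    qed
    show "(\<lambda>\<omega>. u f1 \<omega> * u f2 \<omega> * u f3 \<omega>) \<in> borel_measurable P"
      by (intro borel_measurable_times rv assms)
  qed
  then show ?thesis
    using indep_var_lebesgue_integral[OF ind] int_power[OF assms(1), of 1] mean[OF assms(1)] by simp
qed

lemma integrable_prod4:
  assumes "e1 \<in> E" "e2 \<in> E" "e3 \<in> E" "e4 \<in> E"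
  shows "integrable P (\<lambda>\<omega>. u e1 \<omega> * u e2 \<omega> * u e3 \<omega> * u e4 \<omega>)"
proof (rule Bochner_Integration.integrable_bound)
  show "integrable P (\<lambda>\<omega>. u e1 \<omega> ^ 4 + u e2 \<omega> ^ 4 + u e3 \<omega> ^ 4 + u e4 \<omega> ^ 4)" using int4 assms by simp
  show "AE \<omega> in P. norm (u e1 \<omega> * u e2 \<omega> * u e3 \<omega> * u e4 \<omega>)
      \<le> norm (u e1 \<omega> ^ 4 + u e2 \<omega> ^ 4 + u e3 \<omega> ^ 4 + u e4 \<omega> ^ 4)"
  proof (rule AE_I2)
    fix \<omega>
    define x y z w where "x = \<bar>u e1 \<omega>\<bar>" and "y = \<bar>u e2 \<omega>\<bar>" and "z = \<bar>u e3 \<omega>\<bar>" and "w = \<bar>u e4 \<omega>\<bar>"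
    have xy: "x * y \<le> (x\<^sup>2 + y\<^sup>2) / 2" for x y :: real
      using zero_le_power2[of "x - y"] by (simp add: power2_diff)
    have "x * y * (z * w) \<le> ((x * y)\<^sup>2 + (z * w)\<^sup>2) / 2" by (rule xy)
    moreover have "(x * y)\<^sup>2 \<le> (x ^ 4 + y ^ 4) / 2" using xy[of "x\<^sup>2" "y\<^sup>2"] by (simp add: power_mult_distrib)
    moreover have "(z * w)\<^sup>2 \<le> (z ^ 4 + w ^ 4) / 2" using xy[of "z\<^sup>2" "w\<^sup>2"] by (simp add: power_mult_distrib)
    moreover have "0 \<le> x ^ 4" "0 \<le> y ^ 4" "0 \<le> z ^ 4" "0 \<le> w ^ 4" by simp_all
    ultimately have "x * y * (z * w) \<le> x ^ 4 + y ^ 4 + z ^ 4 + w ^ 4" by (rule half_sum_bound)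
    then show "norm (u e1 \<omega> * u e2 \<omega> * u e3 \<omega> * u e4 \<omega>)
      \<le> norm (u e1 \<omega> ^ 4 + u e2 \<omega> ^ 4 + u e3 \<omega> ^ 4 + u e4 \<omega> ^ 4)"
      by (simp add: x_def y_def z_def w_def abs_mult mult.assoc)
  qed
  show "(\<lambda>\<omega>. u e1 \<omega> * u e2 \<omega> * u e3 \<omega> * u e4 \<omega>) \<in> borel_measurable P"
    by (intro borel_measurable_times rv assms)
qed

lemma expectation_two_squares:
  assumes e: "e \<in> E" "f \<in> E"
  shows "expectation (\<lambda>\<omega>. (u e \<omega>)\<^sup>2 * (u f \<omega>)\<^sup>2) \<le> (if e = f then 3 else 1)"
    and "0 \<le> expectation (\<lambda>\<omega>. (u e \<omega>)\<^sup>2 * (u f \<omega>)\<^sup>2)"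
proof -
  show "expectation (\<lambda>\<omega>. (u e \<omega>)\<^sup>2 * (u f \<omega>)\<^sup>2) \<le> (if e = f then 3 else 1)"
  proof (cases "e = f")
    case True
    have "(u e \<omega>)\<^sup>2 * (u e \<omega>)\<^sup>2 = u e \<omega> ^ 4" for \<omega> by (simp add: power4_eq_xxxx power2_eq_square mult_ac)
    then show ?thesis using fourth[OF e(1)] True by simp
  next
    case False
    have "indep_var borel (\<lambda>\<omega>. (restrict (\<lambda>e. u e \<omega>) {e} e)\<^sup>2) borel (\<lambda>\<omega>. (restrict (\<lambda>e. u e \<omega>) {f} f)\<^sup>2)"
      by (rule indep_blocks[of "{e}" "{f}" "\<lambda>g. (g e)\<^sup>2" borel "\<lambda>g. (g f)\<^sup>2" borel]) (use e False in auto)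
    then have ind: "indep_var borel (\<lambda>\<omega>. (u e \<omega>)\<^sup>2) borel (\<lambda>\<omega>. (u f \<omega>)\<^sup>2)" by simp
    have "expectation (\<lambda>\<omega>. (u e \<omega>)\<^sup>2 * (u f \<omega>)\<^sup>2) = 1"
      using indep_var_lebesgue_integral[OF ind] int_power[OF e(1), of 2] int_power[OF e(2), of 2] var e by simp
    then show ?thesis using False by simp
  qed
  show "0 \<le> expectation (\<lambda>\<omega>. (u e \<omega>)\<^sup>2 * (u f \<omega>)\<^sup>2)" by (rule Bochner_Integration.integral_nonneg) simp
qed

text \<open>
  A variable that occurs once is independent of the others and has mean zero. If all four agree, the
  right-hand side is 3 and the left-hand side is a fourth moment.
\<close>

lemma expectation_prod4_le:
  assumes e: "e1 \<in> E" "e2 \<in> E" "e3 \<in> E" "e4 \<in> E"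
  shows "\<bar>expectation (\<lambda>\<omega>. u e1 \<omega> * u e2 \<omega> * u e3 \<omega> * u e4 \<omega>)\<bar> \<le> (\<Sum>t\<in>{0..<3}. of_bool (pairing t e1 e2 e3 e4))"
    (is "\<bar>expectation ?f\<bar> \<le> ?S")
proof -
  have S: "?S = of_bool (e1 = e2 \<and> e3 = e4) + of_bool (e1 = e3 \<and> e2 = e4) + of_bool (e1 = e4 \<and> e2 = e3)"
    by (simp add: pairing_def numeral_3_eq_3 numeral_2_eq_2)
  have S0: "0 \<le> ?S" by (rule sum_nonneg) simp
  have iso1: "expectation ?f = 0" if "e1 \<noteq> e2" "e1 \<noteq> e3" "e1 \<noteq> e4"
    using indep_prod_isolated[OF e(1,2,3,4) that] by (simp add: mult_ac)
  have iso2: "expectation ?f = 0" if "e2 \<noteq> e1" "e2 \<noteq> e3" "e2 \<noteq> e4"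
    using indep_prod_isolated[OF e(2,1,3,4) that] by (simp add: mult_ac)
  have iso3: "expectation ?f = 0" if "e3 \<noteq> e1" "e3 \<noteq> e2" "e3 \<noteq> e4"
    using indep_prod_isolated[OF e(3,1,2,4) that] by (simp add: mult_ac)
  have iso4: "expectation ?f = 0" if "e4 \<noteq> e1" "e4 \<noteq> e2" "e4 \<noteq> e3"
    using indep_prod_isolated[OF e(4,1,2,3) that] by (simp add: mult_ac)
  have sq: "\<bar>expectation ?f\<bar> \<le> (if x = y then 3 else 1)"
    if "\<And>\<omega>. ?f \<omega> = (u x \<omega>)\<^sup>2 * (u y \<omega>)\<^sup>2" "x \<in> E" "y \<in> E" for x y
    unfolding that(1) using expectation_two_squares[OF that(2,3)] by simp
  consider "e1 = e2" "e3 = e4" | "e1 = e3" "e2 = e4" | "e1 = e4" "e2 = e3"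
    | "e1 \<noteq> e2" "e1 \<noteq> e3" "e1 \<noteq> e4" | "e2 \<noteq> e1" "e2 \<noteq> e3" "e2 \<noteq> e4"
    | "e3 \<noteq> e1" "e3 \<noteq> e2" "e3 \<noteq> e4" | "e4 \<noteq> e1" "e4 \<noteq> e2" "e4 \<noteq> e3" by metis
  then show ?thesis
  proof cases
    case 1
    have "\<bar>expectation ?f\<bar> \<le> (if e1 = e3 then 3 else 1)"
      by (rule sq) (use 1 e in \<open>simp_all add: power2_eq_square mult_ac\<close>)
    also have "\<dots> \<le> ?S" unfolding S using 1 by simp
    finally show ?thesis .
  next
    case 2
    have "\<bar>expectation ?f\<bar> \<le> (if e1 = e2 then 3 else 1)"
      by (rule sq) (use 2 e in \<open>simp_all add: power2_eq_square mult_ac\<close>)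
    also have "\<dots> \<le> ?S" unfolding S using 2 by simp
    finally show ?thesis .
  next
    case 3
    have "\<bar>expectation ?f\<bar> \<le> (if e1 = e2 then 3 else 1)"
      by (rule sq) (use 3 e in \<open>simp_all add: power2_eq_square mult_ac\<close>)
    also have "\<dots> \<le> ?S" unfolding S using 3 by simp
    finally show ?thesis .
  next
    case 4 then show ?thesis using iso1 S0 by simp
  next
    case 5 then show ?thesis using iso2 S0 by simp
  next
    case 6 then show ?thesis using iso3 S0 by simp
  next
    case 7 then show ?thesis using iso4 S0 by simp
  qed
qed

end

text \<open>
  The random matrix of the estimator: entries \<open>sqrt (a i j) * u (i, j)\<close> with variances between \<open>c\<close>
  and \<open>C\<close>.
\<close>

locale random_matrix = standardized P u "{0..<n} \<times> {0..<n}"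
  for P :: "'a measure" and u :: "nat \<times> nat \<Rightarrow> 'a \<Rightarrow> real" and n :: nat +
  fixes a :: "nat \<Rightarrow> nat \<Rightarrow> real" and c C :: real
  assumes npos: "0 < n" and cpos: "0 < c" and a: "\<And>i j. i < n \<Longrightarrow> j < n \<Longrightarrow> c \<le> a i j \<and> a i j \<le> C"
begin

abbreviation "A \<omega> i j \<equiv> sqrt (a i j) * u (i, j) \<omega>"
abbreviation "Pm \<equiv> perms n"

lemma a_nonneg: "i < n \<Longrightarrow> j < n \<Longrightarrow> 0 \<le> a i j"
  using a[of i j] cpos by linarith

lemma weight_pos: "p \<in> Pm \<Longrightarrow> 0 < weight n a p"
  unfolding weight_def using a permutes_less cpos
  by (intro prod_pos) (metis atLeastLessThan_iff less_le_trans mem_Collect_eq)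

definition per :: real where "per = (\<Sum>p\<in>Pm. weight n a p)"

lemma per_pos: "0 < per"
  unfolding per_def using weight_pos
  by (intro sum_pos) (auto simp: finite_permutations intro: exI[of _ id] permutes_id)

lemma rdet_A: "rdet n (A \<omega>) = (\<Sum>p\<in>Pm. signof p * (\<Prod>i=0..<n. A \<omega> i (p i)))"
  unfolding rdet_def
  by (subst det_def'[where n = n]) (auto intro!: sum.cong prod.cong simp: permutes_less)

lemma expectation_prod_rows:
  assumes F: "\<And>i. i < n \<Longrightarrow> F i \<in> borel_measurable (PiM ({i} \<times> {0..<n}) (\<lambda>_. borel :: real measure))"
    and X: "\<And>i \<omega>. i < n \<Longrightarrow> F i (restrict (\<lambda>e. u e \<omega>) ({i} \<times> {0..<n})) = X i \<omega>"
    and int: "\<And>i. i < n \<Longrightarrow> integrable P (X i)"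
  shows "integrable P (\<lambda>\<omega>. \<Prod>i=0..<n. X i \<omega>)"
    and "expectation (\<lambda>\<omega>. \<Prod>i=0..<n. X i \<omega>) = (\<Prod>i=0..<n. expectation (X i) :: real)"
proof -
  have "indep_vars (\<lambda>i. PiM ({i} \<times> {0..<n}) (\<lambda>_. borel)) (\<lambda>i \<omega>. restrict (\<lambda>e. u e \<omega>) ({i} \<times> {0..<n})) {0..<n}"
    by (rule indep_vars_restrict[OF indep]) (auto simp: disjoint_family_on_def)
  then have "indep_vars (\<lambda>_. borel) (\<lambda>i \<omega>. F i (restrict (\<lambda>e. u e \<omega>) ({i} \<times> {0..<n}))) {0..<n}"
    by (rule indep_vars_compose2) (use F in auto)
  also have "?this \<longleftrightarrow> indep_vars (\<lambda>_. borel) X {0..<n}"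
    by (rule indep_vars_cong[OF refl _ refl], rule ext) (rule X, simp)
  finally have ind: "indep_vars (\<lambda>_. borel) X {0..<n}" .
  show "integrable P (\<lambda>\<omega>. \<Prod>i=0..<n. X i \<omega>)"
    by (rule indep_vars_integrable[OF _ ind]) (use int in auto)
  show "expectation (\<lambda>\<omega>. \<Prod>i=0..<n. X i \<omega>) = (\<Prod>i=0..<n. expectation (X i))"
    by (rule indep_vars_lebesgue_integral[OF _ ind]) (use int in auto)
qed

lemma expectation_prod4_rows:
  assumes s: "s1 \<in> Pm" "s2 \<in> Pm" "s3 \<in> Pm" "s4 \<in> Pm"
  defines "X \<equiv> \<lambda>i \<omega>. u (i, s1 i) \<omega> * u (i, s2 i) \<omega> * u (i, s3 i) \<omega> * u (i, s4 i) \<omega>"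
  shows "integrable P (\<lambda>\<omega>. \<Prod>i=0..<n. X i \<omega>)"
    and "expectation (\<lambda>\<omega>. \<Prod>i=0..<n. X i \<omega>) = (\<Prod>i=0..<n. expectation (X i))"
proof -
  have lt: "s1 i < n \<and> s2 i < n \<and> s3 i < n \<and> s4 i < n" if "i < n" for i
    using s permutes_less that by auto
  let ?F = "\<lambda>i f. f (i, s1 i) * f (i, s2 i) * f (i, s3 i) * f (i, s4 i)"
  have F: "?F i \<in> borel_measurable (PiM ({i} \<times> {0..<n}) (\<lambda>_. borel :: real measure))" if i: "i < n" for i
    using lt[OF i] by (intro borel_measurable_times measurable_component_singleton) auto
  have X: "?F i (restrict (\<lambda>e. u e \<omega>) ({i} \<times> {0..<n})) = X i \<omega>" if "i < n" for i \<omega>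
    using lt[OF that] that by (simp add: X_def)
  have int: "integrable P (X i)" if "i < n" for i
    unfolding X_def using that lt by (intro integrable_prod4) auto
  show "integrable P (\<lambda>\<omega>. \<Prod>i=0..<n. X i \<omega>)"
    and "expectation (\<lambda>\<omega>. \<Prod>i=0..<n. X i \<omega>) = (\<Prod>i=0..<n. expectation (X i))"
    by (rule expectation_prod_rows[OF F X int]; assumption)+
qed

lemma det_power4_expand:
  "rdet n (A \<omega>) ^ 4 = (\<Sum>(s1, s2, s3, s4)\<in>Pm \<times> Pm \<times> Pm \<times> Pm.
     (signof s1 * signof s2 * signof s3 * signof s4 *
       (\<Prod>i=0..<n. sqrt (a i (s1 i) * a i (s2 i) * a i (s3 i) * a i (s4 i)))) *
     (\<Prod>i=0..<n. u (i, s1 i) \<omega> * u (i, s2 i) \<omega> * u (i, s3 i) \<omega> * u (i, s4 i) \<omega>))"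
proof -
  let ?g = "\<lambda>p. signof p * (\<Prod>i=0..<n. A \<omega> i (p i))"
  have "rdet n (A \<omega>) ^ 4 = (\<Sum>p\<in>Pm. ?g p) * ((\<Sum>p\<in>Pm. ?g p) * ((\<Sum>p\<in>Pm. ?g p) * (\<Sum>p\<in>Pm. ?g p)))"
    unfolding rdet_A by (simp only: power4_eq_xxxx mult.assoc)
  also have "\<dots> = (\<Sum>(s1, s2, s3, s4)\<in>Pm \<times> Pm \<times> Pm \<times> Pm. ?g s1 * (?g s2 * (?g s3 * ?g s4)))"
    unfolding sum_product sum.cartesian_product by (simp add: case_prod_unfold)
  also have "\<dots> = (\<Sum>(s1, s2, s3, s4)\<in>Pm \<times> Pm \<times> Pm \<times> Pm.
     (signof s1 * signof s2 * signof s3 * signof s4 *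
       (\<Prod>i=0..<n. sqrt (a i (s1 i) * a i (s2 i) * a i (s3 i) * a i (s4 i)))) *
     (\<Prod>i=0..<n. u (i, s1 i) \<omega> * u (i, s2 i) \<omega> * u (i, s3 i) \<omega> * u (i, s4 i) \<omega>))"
    by (intro sum.cong refl) (simp add: case_prod_unfold real_sqrt_mult prod.distrib mult_ac)
  finally show ?thesis .
qed

lemma det_fourth_moment:
  "integrable P (\<lambda>\<omega>. rdet n (A \<omega>) ^ 4)"
  "expectation (\<lambda>\<omega>. rdet n (A \<omega>) ^ 4) \<le> 3 * exp (2 * (C / c)\<^sup>2 * (1 + ln (real n))) * per\<^sup>2"
proof -
  let ?sg = "\<lambda>(s1, s2, s3, s4). signof s1 * signof s2 * signof s3 * signof s4 *
       (\<Prod>i=0..<n. sqrt (a i (s1 i) * a i (s2 i) * a i (s3 i) * a i (s4 i))) :: real"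
  let ?U = "\<lambda>(s1, s2, s3, s4) \<omega>. \<Prod>i=0..<n. u (i, s1 i) \<omega> * u (i, s2 i) \<omega> * u (i, s3 i) \<omega> * u (i, s4 i) \<omega>"
  let ?S = "Pm \<times> Pm \<times> Pm \<times> Pm"
  have ex: "rdet n (A \<omega>) ^ 4 = (\<Sum>s\<in>?S. ?sg s * ?U s \<omega>)" for \<omega>
    unfolding det_power4_expand by (rule sum.cong) (auto simp: case_prod_unfold)
  have iU: "integrable P (?U s)" if "s \<in> ?S" for s
    using that expectation_prod4_rows(1) by (cases s) auto
  show "integrable P (\<lambda>\<omega>. rdet n (A \<omega>) ^ 4)"
    unfolding ex using iU by (intro Bochner_Integration.integrable_sum integrable_mult_right) auto
  have "expectation (\<lambda>\<omega>. rdet n (A \<omega>) ^ 4) = (\<Sum>s\<in>?S. ?sg s * expectation (?U s))"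
    unfolding ex using iU by (subst Bochner_Integration.integral_sum) auto
  also have "\<dots> \<le> (\<Sum>s\<in>?S. case s of (s1, s2, s3, s4) \<Rightarrow> \<Sum>T\<in>{0..<n} \<rightarrow>\<^sub>E {0..<3::nat}.
            \<Prod>i=0..<n. of_bool (pairing (T i) (s1 i) (s2 i) (s3 i) (s4 i))
               * sqrt (a i (s1 i) * a i (s2 i) * a i (s3 i) * a i (s4 i)))"
  proof (rule sum_mono)
    fix s assume s: "s \<in> ?S"
    obtain s1 s2 s3 s4 where s': "s = (s1, s2, s3, s4)" by (cases s)
    have sP: "s1 \<in> Pm" "s2 \<in> Pm" "s3 \<in> Pm" "s4 \<in> Pm" using s unfolding s' by auto
    let ?r = "\<lambda>i. sqrt (a i (s1 i) * a i (s2 i) * a i (s3 i) * a i (s4 i))"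
    let ?e = "\<lambda>i. expectation (\<lambda>\<omega>. u (i, s1 i) \<omega> * u (i, s2 i) \<omega> * u (i, s3 i) \<omega> * u (i, s4 i) \<omega>)"
    have r0: "0 \<le> ?r i" if "i \<in> {0..<n}" for i
      using that sP permutes_less a_nonneg by (intro real_sqrt_ge_zero mult_nonneg_nonneg) auto
    have sgn1: "\<bar>signof p :: real\<bar> = 1" for p :: "nat \<Rightarrow> nat" by (simp add: sign_def)
    have "?sg s * expectation (?U s) \<le> \<bar>?sg s * expectation (?U s)\<bar>" by simp
    also have "\<dots> = (\<Prod>i=0..<n. \<bar>?r i\<bar> * \<bar>?e i\<bar>)"
      unfolding s' prod.case expectation_prod4_rows(2)[OF sP] abs_mult sgn1 abs_prod by (simp add: prod.distrib)
    also have "\<dots> \<le> (\<Prod>i=0..<n. \<Sum>t\<in>{0..<3}. of_bool (pairing t (s1 i) (s2 i) (s3 i) (s4 i)) * ?r i)"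
    proof (rule prod_mono, rule conjI)
      fix i assume i: "i \<in> {0..<n}"
      have pr: "pairing t (i, s1 i) (i, s2 i) (i, s3 i) (i, s4 i) \<longleftrightarrow> pairing t (s1 i) (s2 i) (s3 i) (s4 i)" for t
        by (simp add: pairing_def)
      have "\<bar>?e i\<bar> \<le> (\<Sum>t\<in>{0..<3}. of_bool (pairing t (s1 i) (s2 i) (s3 i) (s4 i)))"
        using expectation_prod4_le[of "(i, s1 i)" "(i, s2 i)" "(i, s3 i)" "(i, s4 i)"] i sP permutes_less
        unfolding pr by auto
      then have "?r i * \<bar>?e i\<bar> \<le> ?r i * (\<Sum>t\<in>{0..<3}. of_bool (pairing t (s1 i) (s2 i) (s3 i) (s4 i)))"
        using r0[OF i] by (rule mult_left_mono)
      then show "\<bar>?r i\<bar> * \<bar>?e i\<bar> \<le> (\<Sum>t\<in>{0..<3}. of_bool (pairing t (s1 i) (s2 i) (s3 i) (s4 i)) * ?r i)"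
        using r0[OF i] by (simp add: sum_distrib_left mult.commute)
    qed simp
    also have "\<dots> = (\<Sum>T\<in>{0..<n} \<rightarrow>\<^sub>E {0..<3::nat}. \<Prod>i=0..<n. of_bool (pairing (T i) (s1 i) (s2 i) (s3 i) (s4 i)) * ?r i)"
      by (rule prod_sum_PiE) auto
    finally show "?sg s * expectation (?U s) \<le> (case s of (s1, s2, s3, s4) \<Rightarrow> \<Sum>T\<in>{0..<n} \<rightarrow>\<^sub>E {0..<3::nat}.
            \<Prod>i=0..<n. of_bool (pairing (T i) (s1 i) (s2 i) (s3 i) (s4 i))
               * sqrt (a i (s1 i) * a i (s2 i) * a i (s3 i) * a i (s4 i)))"
      unfolding s' prod.case .
  qed
  also have "\<dots> \<le> 3 * exp (2 * (C / c)\<^sup>2 * (1 + ln (real n))) * per\<^sup>2"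
    unfolding per_def by (rule paired_permutations_sum_le[OF cpos a npos])
  finally show "expectation (\<lambda>\<omega>. rdet n (A \<omega>) ^ 4) \<le> 3 * exp (2 * (C / c)\<^sup>2 * (1 + ln (real n))) * per\<^sup>2" .
qed

lemma rdet_A_measurable [measurable]: "(\<lambda>\<omega>. rdet n (A \<omega>)) \<in> borel_measurable P"
  unfolding rdet_A using rv permutes_less
  by (intro borel_measurable_sum borel_measurable_times borel_measurable_const borel_measurable_prod) auto

lemma det_second_moment:
  "integrable P (\<lambda>\<omega>. (rdet n (A \<omega>))\<^sup>2)"
  "expectation (\<lambda>\<omega>. (rdet n (A \<omega>))\<^sup>2) = per"
proof -
  show "integrable P (\<lambda>\<omega>. (rdet n (A \<omega>))\<^sup>2)"
    by (rule integrable_power_le_4[OF rdet_A_measurable det_fourth_moment(1)]) simp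
  let ?w = "\<lambda>(p, q). signof p * signof q * (\<Prod>i=0..<n. sqrt (a i (p i)) * sqrt (a i (q i))) :: real"
  let ?U = "\<lambda>(p, q) \<omega>. \<Prod>i=0..<n. u (i, p i) \<omega> * u (i, q i) \<omega>"
  have ex: "(rdet n (A \<omega>))\<^sup>2 = (\<Sum>s\<in>Pm \<times> Pm. ?w s * ?U s \<omega>)" for \<omega>
  proof -
    have "(rdet n (A \<omega>))\<^sup>2 = (\<Sum>(p, q)\<in>Pm \<times> Pm. (signof p * (\<Prod>i=0..<n. A \<omega> i (p i))) * (signof q * (\<Prod>i=0..<n. A \<omega> i (q i))))"
      unfolding rdet_A power2_eq_square sum_product sum.cartesian_product ..
    also have "\<dots> = (\<Sum>s\<in>Pm \<times> Pm. ?w s * ?U s \<omega>)"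
      by (intro sum.cong refl) (simp add: case_prod_unfold prod.distrib mult_ac)
    finally show ?thesis .
  qed
  have row: "integrable P (\<lambda>\<omega>. u e \<omega> * u f \<omega>)"
    "expectation (\<lambda>\<omega>. u e \<omega> * u f \<omega>) = of_bool (e = f)"
    if e: "e \<in> {0..<n} \<times> {0..<n}" "f \<in> {0..<n} \<times> {0..<n}" for e f
  proof -
    have "integrable P (\<lambda>\<omega>. u e \<omega> * u f \<omega>) \<and> expectation (\<lambda>\<omega>. u e \<omega> * u f \<omega>) = of_bool (e = f)"
    proof (cases "e = f")
      case True
      then show ?thesis using int_power[OF e(1), of 2] var[OF e(1)] by (simp add: power2_eq_square)
    next
      case False
      have "indep_var borel (\<lambda>\<omega>. restrict (\<lambda>e. u e \<omega>) {e} e) borel (\<lambda>\<omega>. restrict (\<lambda>e. u e \<omega>) {f} f)"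
        by (rule indep_blocks[of "{e}" "{f}" "\<lambda>g. g e" borel "\<lambda>g. g f" borel]) (use e False in auto)
      then have ind: "indep_var borel (u e) borel (u f)" by simp
      show ?thesis
        using indep_var_lebesgue_integral[OF ind] indep_var_integrable[OF ind] int_power[OF e(1), of 1]
          int_power[OF e(2), of 1] mean e False by simp
    qed
    then show "integrable P (\<lambda>\<omega>. u e \<omega> * u f \<omega>)"
      "expectation (\<lambda>\<omega>. u e \<omega> * u f \<omega>) = of_bool (e = f)" by auto
  qed
  have U: "integrable P (?U s) \<and> expectation (?U s) = of_bool (fst s = snd s)" if s: "s \<in> Pm \<times> Pm" for s
  proof -
    obtain p q where pq: "s = (p, q)" by (cases s)
    have pqP: "p permutes {0..<n}" "q permutes {0..<n}" using s unfolding pq by auto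
    have lt: "p i < n \<and> q i < n" if "i < n" for i using pqP permutes_less that by auto
    let ?F = "\<lambda>i f. f (i, p i) * f (i, q i)"
    have Fm: "?F i \<in> borel_measurable (PiM ({i} \<times> {0..<n}) (\<lambda>_. borel :: real measure))" if i: "i < n" for i
      using lt[OF i] by (intro borel_measurable_times measurable_component_singleton) auto
    have Xe: "?F i (restrict (\<lambda>e. u e \<omega>) ({i} \<times> {0..<n})) = u (i, p i) \<omega> * u (i, q i) \<omega>"
      if "i < n" for i \<omega> using lt[OF that] by simp
    have int: "integrable P (\<lambda>\<omega>. u (i, p i) \<omega> * u (i, q i) \<omega>)" if "i < n" for i
      using that lt by (intro row(1)) auto
    note rows = expectation_prod_rows[OF Fm Xe int]
    have "expectation (?U s) = (\<Prod>i=0..<n. expectation (\<lambda>\<omega>. u (i, p i) \<omega> * u (i, q i) \<omega>))"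
      unfolding pq prod.case by (rule rows(2))
    also have "\<dots> = (\<Prod>i=0..<n. of_bool (p i = q i))"
      using lt by (intro prod.cong refl) (subst row(2), auto)
    also have "\<dots> = of_bool (p = q)"
    proof (cases "p = q")
      case True then show ?thesis by simp
    next
      case False
      then obtain i where i: "p i \<noteq> q i" by auto
      have "i \<in> {0..<n}"
      proof (rule ccontr)
        assume "i \<notin> {0..<n}"
        then have "p i = i" "q i = i" using permutes_not_in pqP by metis+
        then show False using i by simp
      qed
      then show ?thesis using i False by (auto intro!: prod_zero)
    qed
    finally have "expectation (?U s) = of_bool (p = q)" .
    moreover have "integrable P (?U s)"
      unfolding pq prod.case by (rule rows(1))
    ultimately show ?thesis by (simp add: pq)
  qed
  have "expectation (\<lambda>\<omega>. (rdet n (A \<omega>))\<^sup>2) = (\<Sum>s\<in>Pm \<times> Pm. ?w s * of_bool (fst s = snd s))"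
    unfolding ex using U by (subst Bochner_Integration.integral_sum) auto
  also have "\<dots> = (\<Sum>p\<in>Pm. \<Sum>q\<in>Pm. if p = q then ?w (p, q) else 0)"
    unfolding sum.cartesian_product by (intro sum.cong refl) (auto simp: case_prod_unfold)
  also have "\<dots> = (\<Sum>p\<in>Pm. ?w (p, p))"
  proof (rule sum.cong[OF refl])
    fix p assume "p \<in> Pm"
    then show "(\<Sum>q\<in>Pm. if p = q then ?w (p, q) else 0) = ?w (p, p)"
      using sum.delta'[of Pm p "\<lambda>q. ?w (p, q)"] finite_permutations[of "{0..<n}"] by simp
  qed
  also have "\<dots> = per"
    unfolding per_def
  proof (rule sum.cong[OF refl])
    fix p assume p: "p \<in> Pm"
    have "(\<Prod>i=0..<n. sqrt (a i (p i)) * sqrt (a i (p i))) = weight n a p"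
      unfolding weight_def using p permutes_less a_nonneg by (intro prod.cong refl) auto
    moreover have "signof p * signof p = (1::real)" by (simp add: sign_def)
    ultimately show "?w (p, p) = weight n a p" by simp
  qed
  finally show "expectation (\<lambda>\<omega>. (rdet n (A \<omega>))\<^sup>2) = per" .
qed

text \<open>
  The constant is the quotient \<open>(E D)\<^sup>2 / (4 E D\<^sup>2)\<close> of the Paley-Zygmund inequality.
\<close>

lemma det_anticoncentration:
  "exp (- (2 * (C / c)\<^sup>2 * (1 + ln (real n)))) / 12 \<le> prob {\<omega> \<in> space P. per / 2 \<le> (rdet n (A \<omega>))\<^sup>2}"
proof -
  let ?\<Gamma> = "3 * exp (2 * (C / c)\<^sup>2 * (1 + ln (real n)))"
  have p: "((rdet n (A \<omega>))\<^sup>2)\<^sup>2 = rdet n (A \<omega>) ^ 4" for \<omega> by simp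
  have "per\<^sup>2 / (4 * (?\<Gamma> * per\<^sup>2)) \<le> prob {\<omega> \<in> space P. per / 2 \<le> (rdet n (A \<omega>))\<^sup>2}"
    using det_second_moment det_fourth_moment per_pos
    by (intro paley_zygmund) (simp_all only: p)
  also have "per\<^sup>2 / (4 * (?\<Gamma> * per\<^sup>2)) = exp (- (2 * (C / c)\<^sup>2 * (1 + ln (real n)))) / 12"
    using per_pos by (simp add: exp_minus field_simps)
  finally show ?thesis .
qed

end

section \<open>Almost null vectors\<close>

definition grid :: "nat \<Rightarrow> real set" where
  "grid N = (\<lambda>z. real_of_int z / real N) ` {- int N..int N}"

text \<open>
  An explicit net for the vectors of maximum norm 1 with at most \<open>k\<close> large coordinates: small
  coordinates are rounded to 0, the others to multiples of \<open>1/N\<close>.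
\<close>

definition sparse_grid :: "nat \<Rightarrow> nat \<Rightarrow> nat \<Rightarrow> (nat \<Rightarrow> real) set" where
  "sparse_grid n N k = {f \<in> {0..<n} \<rightarrow>\<^sub>E grid N. sup_unit n f \<and> card {j\<in>{0..<n}. f j \<noteq> 0} \<le> k}"

definition grid_round :: "nat \<Rightarrow> real \<Rightarrow> real" where
  "grid_round N x = real_of_int \<lfloor>x * real N\<rfloor> / real N"

lemma card_grid: "card (grid N) \<le> 2 * N + 1" "finite (grid N)"
proof -
  have "card (grid N) \<le> card {- int N..int N}" unfolding grid_def by (rule card_image_le) simp
  then show "card (grid N) \<le> 2 * N + 1" by simp
qed (simp add: grid_def)

lemma grid_round_in: "\<bar>x\<bar> \<le> 1 \<Longrightarrow> grid_round N x \<in> grid N"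
proof -
  assume x: "\<bar>x\<bar> \<le> 1"
  have "- 1 * real N \<le> x * real N" using x by (intro mult_right_mono) auto
  then have "- int N \<le> \<lfloor>x * real N\<rfloor>" by (simp add: le_floor_iff)
  moreover have "x * real N \<le> 1 * real N" using x by (intro mult_right_mono) auto
  then have "\<lfloor>x * real N\<rfloor> \<le> int N" by (simp add: floor_le_iff)
  ultimately show ?thesis unfolding grid_round_def grid_def by auto
qed

lemma grid_round_error: "0 < N \<Longrightarrow> \<bar>x - grid_round N x\<bar> \<le> 1 / real N"
proof -
  assume N: "0 < N"
  have "x - grid_round N x = (x * real N - real_of_int \<lfloor>x * real N\<rfloor>) / real N"
    using N by (simp add: grid_round_def diff_divide_distrib)
  also have "\<bar>\<dots>\<bar> = \<bar>x * real N - real_of_int \<lfloor>x * real N\<rfloor>\<bar> / real N" by simp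
  also have "\<dots> \<le> 1 / real N"
    by (intro divide_right_mono) (auto simp: abs_le_iff, linarith+)
  finally show ?thesis .
qed

lemma grid_round_unit: "0 < N \<Longrightarrow> \<bar>x\<bar> = 1 \<Longrightarrow> grid_round N x = x"
proof -
  assume N: "0 < N" and "\<bar>x\<bar> = 1"
  then consider "x = 1" | "x = -1" by linarith
  then show ?thesis
  proof cases
    case 1 then show ?thesis using N by (simp add: grid_round_def)
  next
    case 2
    have "\<lfloor>- real N\<rfloor> = - int N" by (metis floor_of_int of_int_minus of_int_of_nat_eq)
    then show ?thesis using 2 N by (simp add: grid_round_def)
  qed
qed

text \<open>
  A grid vector is given by a list of \<open>k\<close> pairs of a position and a value that covers its support; shorter supports are
  padded by repeating a position.
\<close>

lemma card_sparse_grid: "finite (sparse_grid n N k)" "card (sparse_grid n N k) \<le> (n * (2 * N + 1)) ^ k"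
proof -
  let ?D = "{0..<n} \<times> grid N"
  let ?L = "{xs. set xs \<subseteq> ?D \<and> length xs = k}"
  let ?h = "\<lambda>xs. \<lambda>j\<in>{0..<n}. case map_of xs j of Some y \<Rightarrow> y | None \<Rightarrow> (0::real)"
  have finD: "finite ?D" using card_grid by simp
  have finL: "finite ?L" by (rule finite_lists_length_eq[OF finD])
  have sub: "sparse_grid n N k \<subseteq> ?h ` ?L"
  proof
    fix f assume f: "f \<in> sparse_grid n N k"
    let ?S = "{j\<in>{0..<n}. f j \<noteq> 0}"
    obtain j0 where j0: "j0 < n" using f unfolding sparse_grid_def sup_unit_def by auto
    define ys where "ys = sorted_list_of_set ?S @ replicate (k - card ?S) j0"
    define xs where "xs = map (\<lambda>j. (j, f j)) ys"
    have ys: "set ys \<subseteq> {0..<n}" "?S \<subseteq> set ys" "length ys = k"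
      using f j0 unfolding ys_def sparse_grid_def by auto
    have fg: "f j \<in> grid N" if "j < n" for j using f that unfolding sparse_grid_def by (auto simp: PiE_iff)
    have "xs \<in> ?L" using ys fg unfolding xs_def by auto
    moreover have "f = ?h xs"
    proof
      fix j
      show "f j = ?h xs j"
      proof (cases "j < n")
        case True
        have "map_of xs j = (if j \<in> set ys then Some (f j) else None)"
          unfolding xs_def by (simp add: map_of_map_restrict restrict_map_def)
        then show ?thesis using True ys(2) by auto
      next
        case False
        then show ?thesis using f unfolding sparse_grid_def by (auto simp: PiE_iff extensional_def)
      qed
    qed
    ultimately show "f \<in> ?h ` ?L" by blast
  qed
  show "finite (sparse_grid n N k)" by (rule finite_subset[OF sub]) (rule finite_imageI[OF finL])
  have "card (sparse_grid n N k) \<le> card (?h ` ?L)" by (rule card_mono[OF finite_imageI[OF finL] sub])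
  also have "\<dots> \<le> card ?L" by (rule card_image_le[OF finL])
  also have "\<dots> = card ?D ^ k" by (rule card_lists_length_eq[OF finD])
  also have "\<dots> \<le> (n * (2 * N + 1)) ^ k"
  proof (rule power_mono)
    show "card ?D \<le> n * (2 * N + 1)"
      unfolding card_cartesian_product card_atLeastLessThan diff_zero by (rule mult_left_mono[OF card_grid(1)]) simp
  qed simp
  finally show "card (sparse_grid n N k) \<le> (n * (2 * N + 1)) ^ k" .
qed

text \<open>
  The \<open>n - 1\<close> equations become \<open>n\<close> by a zero row, and a square matrix with a zero row is singular.
\<close>

lemma homogeneous_system_solution:
  fixes y :: "nat \<Rightarrow> nat \<Rightarrow> real"
  assumes j: "j < n"
  shows "\<exists>w. sup_unit n w \<and> (\<forall>l<n. l \<noteq> j \<longrightarrow> (\<Sum>i=0..<n. w i * y i l) = 0)"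
proof -
  let ?B = "Matrix.mat n n (\<lambda>(l, i). if l = j then 0 else y i l)"
  have B: "?B \<in> carrier_mat n n" by simp
  have "Determinant.det ?B = (\<Sum>i<n. ?B $$ (j, i) * cofactor ?B j i)" by (rule laplace_expansion_row[OF B j])
  also have "\<dots> = 0" using j by simp
  finally obtain v where v: "v \<in> carrier_vec n" "v \<noteq> 0\<^sub>v n" "?B *\<^sub>v v = 0\<^sub>v n"
    using det_0_iff_vec_prod_zero[OF B] by auto
  then obtain k where k: "k < n" "v $ k \<noteq> 0" by (metis carrier_vecD eq_vecI index_zero_vec)
  obtain m where "sup_unit n (\<lambda>i. v $ i / m)" using sup_unit_normalize[of k n "\<lambda>i. v $ i"] k by blast
  moreover have "(\<Sum>i=0..<n. v $ i / m * y i l) = 0" if l: "l < n" "l \<noteq> j" for l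
  proof -
    have "(\<Sum>i=0..<n. v $ i / m * y i l) = (\<Sum>i=0..<n. y i l * v $ i) / m"
      by (simp add: sum_divide_distrib mult.commute)
    also have "(\<Sum>i=0..<n. y i l * v $ i) = (?B *\<^sub>v v) $ l"
      using l v(1) by (auto simp: scalar_prod_def intro!: sum.cong)
    also have "\<dots> = 0" using v(3) l by simp
    finally show ?thesis by simp
  qed
  ultimately show ?thesis by (intro exI[of _ "\<lambda>i. v $ i / m"]) auto
qed

context standardized
begin

text \<open>
  The equations are indexed by \<open>I\<close>, and \<open>ent i j\<close> names the variable that multiplies \<open>x j\<close> in the \<open>i\<close>-th of
  them. This covers the rows of the matrix as well as its columns with one column removed.
\<close>

definition grid_bad :: "nat \<Rightarrow> nat \<Rightarrow> nat \<Rightarrow> real \<Rightarrow> nat set \<Rightarrow> (nat \<Rightarrow> nat \<Rightarrow> 'i) \<Rightarrow> ('i \<Rightarrow> real) \<Rightarrow> 'a set" where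
  "grid_bad n N k c I ent \<sigma> = {\<omega> \<in> space P. \<exists>x\<in>sparse_grid n N k. \<forall>i\<in>I.
     (\<Sum>j=0..<n. x j * (\<sigma> (ent i j) * u (ent i j) \<omega>))\<^sup>2 < c / 2}"

lemma grid_bad_prob:
  assumes I: "finite I" and ent: "\<And>i j. i \<in> I \<Longrightarrow> j < n \<Longrightarrow> ent i j \<in> E"
    and inj: "\<And>i j i' j'. i \<in> I \<Longrightarrow> i' \<in> I \<Longrightarrow> j < n \<Longrightarrow> j' < n \<Longrightarrow> ent i j = ent i' j' \<Longrightarrow> i = i' \<and> j = j'"
    and \<sigma>: "\<And>e. e \<in> E \<Longrightarrow> c \<le> (\<sigma> e)\<^sup>2" and c: "0 < c"
  shows "grid_bad n N k c I ent \<sigma> \<in> events"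
    and "prob (grid_bad n N k c I ent \<sigma>) \<le> real (n * (2 * N + 1)) ^ k * (11 / 12) ^ card I"
proof -
  let ?F = "\<lambda>x i \<omega>. \<Sum>j=0..<n. x j * (\<sigma> (ent i j) * u (ent i j) \<omega>)"
  let ?Z = "\<lambda>x. {\<omega> \<in> space P. \<forall>i\<in>I. (?F x i \<omega>)\<^sup>2 < c / 2}"
  have F[measurable]: "(\<lambda>\<omega>. ?F x i \<omega>) \<in> borel_measurable P" if "i \<in> I" for x i
    using rv[OF ent[OF that]] by (intro borel_measurable_sum borel_measurable_times borel_measurable_const) auto
  have Z: "?Z x \<in> events" for x
    using I F by (intro sets.sets_Collect_finite_All) (auto intro!: borel_measurable_less borel_measurable_power)
  have eq: "grid_bad n N k c I ent \<sigma> = (\<Union>x\<in>sparse_grid n N k. ?Z x)"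
    unfolding grid_bad_def by auto
  show "grid_bad n N k c I ent \<sigma> \<in> events"
    unfolding eq using Z card_sparse_grid(1) by (intro sets.finite_UN) auto
  have one: "prob (?Z x) \<le> (11 / 12) ^ card I" if x: "x \<in> sparse_grid n N k" for x
  proof -
    define B where "B i = ent i ` {0..<n}" for i
    \<comment> \<open>The column position of a variable, by which a coefficient vector becomes a function of the variables.\<close>
    define pos where "pos e = (THE j. j < n \<and> (\<exists>i\<in>I. e = ent i j))" for e
    have pos: "pos (ent i j) = j" if "i \<in> I" "j < n" for i j
      unfolding pos_def using inj that by (intro the_equality) blast+
    define \<alpha> where "\<alpha> e = x (pos e) * \<sigma> e" for e
    have injB: "inj_on (ent i) {0..<n}" if "i \<in> I" for i
      using inj[OF that that] by (intro inj_onI) auto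
    have lin: "lin (B i) \<alpha> \<omega> = ?F x i \<omega>" if i: "i \<in> I" for i \<omega>
      unfolding lin_def B_def sum.reindex[OF injB[OF i]] using pos[OF i]
      by (intro sum.cong) (auto simp: \<alpha>_def)
    have "prob {\<omega> \<in> space P. \<forall>i\<in>I. (lin (B i) \<alpha> \<omega>)\<^sup>2 < c / 2} \<le> (11 / 12) ^ card I"
    proof (rule all_lin_small_prob[OF I])
      show "B i \<subseteq> E" if "i \<in> I" for i using ent[OF that] unfolding B_def by auto
      show "disjoint_family_on B I"
        unfolding disjoint_family_on_def B_def using inj by fastforce
      show "c \<le> (\<Sum>e\<in>B i. (\<alpha> e)\<^sup>2)" if i: "i \<in> I" for i
      proof -
        obtain j where j: "j < n" "\<bar>x j\<bar> = 1" using x unfolding sparse_grid_def sup_unit_def by auto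
        have "c \<le> (\<alpha> (ent i j))\<^sup>2"
          using \<sigma>[OF ent[OF i j(1)]] j(2) unfolding \<alpha>_def pos[OF i j(1)]
          by (simp add: power_mult_distrib) (metis power2_abs one_power2 mult_1)
        also have "\<dots> \<le> (\<Sum>e\<in>B i. (\<alpha> e)\<^sup>2)"
          unfolding B_def using j(1) by (intro member_le_sum) auto
        finally show ?thesis .
      qed
    qed (rule c)
    also have "{\<omega> \<in> space P. \<forall>i\<in>I. (lin (B i) \<alpha> \<omega>)\<^sup>2 < c / 2} = ?Z x" using lin by auto
    finally show ?thesis .
  qed
  have "prob (grid_bad n N k c I ent \<sigma>) \<le> (\<Sum>x\<in>sparse_grid n N k. prob (?Z x))"
    unfolding eq using Z card_sparse_grid(1) by (intro finite_measure_subadditive_finite) auto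
  also have "\<dots> \<le> (\<Sum>x\<in>sparse_grid n N k. (11 / 12) ^ card I)" using one by (rule sum_mono)
  also have "\<dots> = real (card (sparse_grid n N k)) * (11 / 12) ^ card I" by simp
  also have "\<dots> \<le> real (n * (2 * N + 1)) ^ k * (11 / 12) ^ card I"
    using of_nat_mono[OF card_sparse_grid(2)[of n N k], where 'a = real] unfolding of_nat_power by (intro mult_right_mono) auto
  finally show "prob (grid_bad n N k c I ent \<sigma>) \<le> real (n * (2 * N + 1)) ^ k * (11 / 12) ^ card I" .
qed

text \<open>
  Rounding \<open>x\<close> to the grid moves every form by at most \<open>n q / N\<close>, and coordinates equal to 1 or -1 are
  kept, so that the rounded vector is again of maximum norm 1.
\<close>

lemma sparse_approx_bad:
  assumes \<omega>: "\<omega> \<in> space P" and N: "2 \<le> N" and x: "sup_unit n x"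
    and sparse: "card {j\<in>{0..<n}. 1 / real N < \<bar>x j\<bar>} \<le> k"
    and bnd: "\<And>i j. i \<in> I \<Longrightarrow> j < n \<Longrightarrow> \<bar>\<sigma> (ent i j) * u (ent i j) \<omega>\<bar> \<le> q"
    and small: "\<And>i. i \<in> I \<Longrightarrow> \<bar>\<Sum>j=0..<n. x j * (\<sigma> (ent i j) * u (ent i j) \<omega>)\<bar> \<le> \<kappa>"
    and par: "\<kappa> + real n * (q / real N) < sqrt (c / 2)" and c: "0 < c"
  shows "\<omega> \<in> grid_bad n N k c I ent \<sigma>"
proof -
  define y where "y = (\<lambda>j\<in>{0..<n}. if 1 / real N < \<bar>x j\<bar> then grid_round N (x j) else 0)"
  have xb: "\<bar>x j\<bar> \<le> 1" if "j < n" for j using x that unfolding sup_unit_def by auto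
  have g0: "0 \<in> grid N" unfolding grid_def by (rule image_eqI[of _ _ 0]) auto
  have yg: "y j \<in> grid N" if "j < n" for j using grid_round_in[OF xb[OF that]] g0 that by (simp add: y_def)
  have err: "\<bar>y j - x j\<bar> \<le> 1 / real N" if "j < n" for j
    using grid_round_error[of N "x j"] N that by (auto simp: y_def abs_minus_commute)
  have "y \<in> sparse_grid n N k"
    unfolding sparse_grid_def
  proof (intro CollectI conjI)
    show "y \<in> {0..<n} \<rightarrow>\<^sub>E grid N" using yg by (auto simp: PiE_iff y_def extensional_def)
    obtain j where j: "j < n" "\<bar>x j\<bar> = 1" using x unfolding sup_unit_def by auto
    have "y j = x j" using j N grid_round_unit[of N "x j"] by (simp add: y_def)
    moreover have "\<bar>y j\<bar> \<le> 1" if "j < n" for j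
    proof -
      have "y j \<in> grid N" by (rule yg[OF that])
      then obtain z where "y j = real_of_int z / real N" "z \<in> {- int N..int N}" unfolding grid_def by (rule imageE)
      then show ?thesis using N by (simp add: abs_le_iff)
    qed
    ultimately show "sup_unit n y" unfolding sup_unit_def using j by auto
    have "card {j\<in>{0..<n}. y j \<noteq> 0} \<le> card {j\<in>{0..<n}. 1 / real N < \<bar>x j\<bar>}"
      by (rule card_mono) (auto simp: y_def split: if_splits)
    then show "card {j\<in>{0..<n}. y j \<noteq> 0} \<le> k" using sparse by simp
  qed
  moreover have "(\<Sum>j=0..<n. y j * (\<sigma> (ent i j) * u (ent i j) \<omega>))\<^sup>2 < c / 2" if i: "i \<in> I" for i
  proof -
    let ?A = "\<lambda>j. \<sigma> (ent i j) * u (ent i j) \<omega>"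
    have "(\<Sum>j=0..<n. y j * ?A j) = (\<Sum>j=0..<n. x j * ?A j) + (\<Sum>j=0..<n. (y j - x j) * ?A j)"
      by (simp add: sum.distrib[symmetric] algebra_simps)
    moreover have "\<bar>\<Sum>j=0..<n. (y j - x j) * ?A j\<bar> \<le> real n * (q / real N)"
    proof -
      have "\<bar>\<Sum>j=0..<n. (y j - x j) * ?A j\<bar> \<le> (\<Sum>j=0..<n. \<bar>(y j - x j) * ?A j\<bar>)" by (rule sum_abs)
      also have "\<dots> \<le> (\<Sum>j=0..<n. 1 / real N * q)"
        unfolding abs_mult[of "y _ - x _"] using err bnd[OF i] by (intro sum_mono mult_mono) auto
      finally show ?thesis by simp
    qed
    ultimately have "\<bar>\<Sum>j=0..<n. y j * ?A j\<bar> < sqrt (c / 2)" using small[OF i] par by linarith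
    then have "\<bar>\<Sum>j=0..<n. y j * ?A j\<bar>\<^sup>2 < (sqrt (c / 2))\<^sup>2" by (intro power_strict_mono) auto
    then show ?thesis using c by simp
  qed
  ultimately show ?thesis unfolding grid_bad_def using \<omega> by blast
qed

end

context random_matrix
begin

abbreviation "wt \<equiv> (\<lambda>(i, j). sqrt (a i j))"

lemma entry_large_prob:
  assumes q: "0 < q" and ij: "i < n" "j < n"
  shows "prob {\<omega> \<in> space P. q < \<bar>A \<omega> i j\<bar>} \<le> C / q\<^sup>2"
proof -
  have e: "(i, j) \<in> {0..<n} \<times> {0..<n}" using ij by simp
  have [measurable]: "u (i, j) \<in> borel_measurable P" by (rule rv[OF e])
  have A2: "(A \<omega> i j)\<^sup>2 = a i j * (u (i, j) \<omega>)\<^sup>2" for \<omega>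
    using a_nonneg[OF ij] by (simp add: power_mult_distrib)
  have int: "integrable P (\<lambda>\<omega>. (A \<omega> i j)\<^sup>2)" unfolding A2 using int_power[OF e, of 2] by simp
  have "prob {\<omega> \<in> space P. q < \<bar>A \<omega> i j\<bar>} \<le> prob {\<omega> \<in> space P. q\<^sup>2 \<le> (A \<omega> i j)\<^sup>2}"
  proof (rule finite_measure_mono)
    show "{\<omega> \<in> space P. q < \<bar>A \<omega> i j\<bar>} \<subseteq> {\<omega> \<in> space P. q\<^sup>2 \<le> (A \<omega> i j)\<^sup>2}"
    proof safe
      fix \<omega> assume "q < \<bar>A \<omega> i j\<bar>"
      then have "\<bar>q\<bar> \<le> \<bar>A \<omega> i j\<bar>" using q by simp
      then show "q\<^sup>2 \<le> (A \<omega> i j)\<^sup>2" by (simp only: abs_le_square_iff)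
    qed
  qed measurable
  also have "\<dots> \<le> expectation (\<lambda>\<omega>. (A \<omega> i j)\<^sup>2) / q\<^sup>2"
    using integral_Markov_inequality_measure[OF int sets.top, of "q\<^sup>2"] q by simp
  also have "expectation (\<lambda>\<omega>. (A \<omega> i j)\<^sup>2) = a i j" unfolding A2 using var[OF e] by simp
  also have "a i j / q\<^sup>2 \<le> C / q\<^sup>2" using a[OF ij] q by (intro divide_right_mono) auto
  finally show ?thesis .
qed

definition entries_large :: "real \<Rightarrow> 'a set" where
  "entries_large q = {\<omega> \<in> space P. \<exists>i\<in>{0..<n}. \<exists>j\<in>{0..<n}. q < \<bar>A \<omega> i j\<bar>}"

lemma entries_large_prob:
  assumes q: "0 < q"
  shows "entries_large q \<in> events" "prob (entries_large q) \<le> (real n)\<^sup>2 * C / q\<^sup>2"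
proof -
  let ?X = "\<lambda>(i, j). {\<omega> \<in> space P. q < \<bar>A \<omega> i j\<bar>}"
  have X: "?X e \<in> events" if e: "e \<in> {0..<n} \<times> {0..<n}" for e
  proof -
    obtain i j where ij: "e = (i, j)" by (cases e)
    have [measurable]: "u (i, j) \<in> borel_measurable P" by (rule rv) (use e ij in simp)
    show ?thesis unfolding ij prod.case by measurable
  qed
  have eq: "entries_large q = (\<Union>e\<in>{0..<n} \<times> {0..<n}. ?X e)" unfolding entries_large_def by auto
  show "entries_large q \<in> events" unfolding eq using X by (intro sets.finite_UN) auto
  have "prob (entries_large q) \<le> (\<Sum>e\<in>{0..<n} \<times> {0..<n}. prob (?X e))"
    unfolding eq using X by (intro finite_measure_subadditive_finite) auto
  also have "\<dots> \<le> (\<Sum>e\<in>{0..<n} \<times> {0..<n}. C / q\<^sup>2)"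
    using entry_large_prob[OF q] by (intro sum_mono) auto
  finally show "prob (entries_large q) \<le> (real n)\<^sup>2 * C / q\<^sup>2" by (simp add: power2_eq_square)
qed

definition null_candidates :: "nat \<Rightarrow> nat \<Rightarrow> nat \<Rightarrow> (nat \<Rightarrow> real) set" where
  "null_candidates N N2 k = {w \<in> {0..<n} \<rightarrow>\<^sub>E grid N2. k < card {i\<in>{0..<n}. 1 / (2 * real N) < \<bar>w i\<bar>}}"

text \<open>
  The grid vectors that are almost orthogonal to all columns except column \<open>j\<close>. An exact null vector
  would have to be chosen measurably; among finitely many grid vectors any choice will do.
\<close>

definition near_null :: "nat \<Rightarrow> nat \<Rightarrow> nat \<Rightarrow> real \<Rightarrow> nat \<Rightarrow> 'a \<Rightarrow> (nat \<Rightarrow> real) set" where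
  "near_null N N2 k \<nu> j \<omega> = {w \<in> null_candidates N N2 k. \<forall>l\<in>{0..<n} - {j}. \<bar>\<Sum>i=0..<n. w i * A \<omega> i l\<bar> \<le> \<nu>}"

abbreviation pick :: "(nat \<Rightarrow> real) set \<Rightarrow> nat \<Rightarrow> real" where
  "pick S \<equiv> (SOME w. w \<in> S)"

text \<open>
  Column \<open>j\<close> is almost orthogonal to the normal vector that was picked on the basis of the other columns.
\<close>

definition close_column :: "nat \<Rightarrow> nat \<Rightarrow> nat \<Rightarrow> real \<Rightarrow> real \<Rightarrow> nat \<Rightarrow> 'a set" where
  "close_column N N2 k \<nu> \<tau> j = {\<omega> \<in> space P. near_null N N2 k \<nu> j \<omega> \<noteq> {} \<and>
     \<bar>\<Sum>i=0..<n. pick (near_null N N2 k \<nu> j \<omega>) i * A \<omega> i j\<bar> \<le> \<tau>}"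

lemma finite_null_candidates: "finite (null_candidates N N2 k)"
  unfolding null_candidates_def
  by (rule finite_subset[of _ "{0..<n} \<rightarrow>\<^sub>E grid N2"]) (auto intro: finite_PiE card_grid(2))

text \<open>
  The set of candidates depends on the other columns only. Conditioned on its value, the picked vector is fixed and the
  Littlewood-Offord inequality applies to column \<open>j\<close>.
\<close>

lemma close_column_prob:
  assumes j: "j < n" and \<tau>: "0 \<le> \<tau>" "4 * \<tau> < sqrt c / (2 * real N)" and N: "0 < N"
  shows "close_column N N2 k \<nu> \<tau> j \<in> events"
    and "prob (close_column N N2 k \<nu> \<tau> j) * sqrt (real k) \<le> 384"
proof -
  let ?W = "null_candidates N N2 k"
  let ?X = "\<lambda>S. {\<omega> \<in> space P. near_null N N2 k \<nu> j \<omega> = S}"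
  let ?Y = "\<lambda>w. {\<omega> \<in> space P. \<bar>\<Sum>i=0..<n. w i * A \<omega> i j\<bar> \<le> \<tau>}"
  let ?BA = "{0..<n} \<times> ({0..<n} - {j})" and ?BB = "{0..<n} \<times> {j}"
  let ?F = "\<lambda>S f. \<forall>w\<in>?W. (\<forall>l\<in>{0..<n} - {j}. \<bar>\<Sum>i=0..<n. w i * (sqrt (a i l) * f (i, l))\<bar> \<le> \<nu>) \<longleftrightarrow> w \<in> S"
  let ?G = "\<lambda>w f. \<Sum>i=0..<n. w i * (sqrt (a i j) * f (i, j))"
  let ?S = "Pow ?W - {{}}"
  have finS: "finite ?S" using finite_null_candidates by simp
  have Fm: "?F S \<in> measurable (PiM ?BA (\<lambda>_. borel)) (count_space UNIV)" for S
  proof -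
    have 1: "(\<lambda>f. \<Sum>i=0..<n. w i * (sqrt (a i l) * f (i, l))) \<in> borel_measurable (PiM ?BA (\<lambda>_. borel))"
      if "l \<in> {0..<n} - {j}" for w :: "nat \<Rightarrow> real" and l
      using that by (intro borel_measurable_sum borel_measurable_times borel_measurable_const measurable_component_singleton) auto
    have 2: "Measurable.pred (PiM ?BA (\<lambda>_. borel)) (\<lambda>f. \<forall>l\<in>{0..<n} - {j}. \<bar>\<Sum>i=0..<n. w i * (sqrt (a i l) * f (i, l))\<bar> \<le> \<nu>)"
      for w :: "nat \<Rightarrow> real"
    proof (rule pred_intros_finite(3))
      fix l assume l: "l \<in> {0..<n} - {j}"
      note [measurable] = 1[OF l, of w]
      show "Measurable.pred (PiM ?BA (\<lambda>_. borel)) (\<lambda>f. \<bar>\<Sum>i=0..<n. w i * (sqrt (a i l) * f (i, l))\<bar> \<le> \<nu>)"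
        by measurable
    qed simp
    show ?thesis
    proof (rule pred_intros_finite(3)[OF finite_null_candidates])
      fix w assume "w \<in> ?W"
      show "Measurable.pred (PiM ?BA (\<lambda>_. borel))
        (\<lambda>f. (\<forall>l\<in>{0..<n} - {j}. \<bar>\<Sum>i=0..<n. w i * (sqrt (a i l) * f (i, l))\<bar> \<le> \<nu>) \<longleftrightarrow> w \<in> S)"
        using 2[of w] by (cases "w \<in> S") (simp_all add: pred_intros_logic)
    qed
  qed
  have Gm: "?G w \<in> borel_measurable (PiM ?BB (\<lambda>_. borel))" for w
    by (intro borel_measurable_sum borel_measurable_times borel_measurable_const measurable_component_singleton) auto
  have Fe: "?F S (restrict (\<lambda>e. u e \<omega>) ?BA) \<longleftrightarrow> near_null N N2 k \<nu> j \<omega> = S" if "S \<subseteq> ?W" for S \<omega>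
  proof -
    have s: "(\<Sum>i=0..<n. w i * (sqrt (a i l) * restrict (\<lambda>e. u e \<omega>) ?BA (i, l))) = (\<Sum>i=0..<n. w i * A \<omega> i l)"
      if "l \<in> {0..<n} - {j}" for w :: "nat \<Rightarrow> real" and l
      using that by (intro sum.cong) auto
    have "?F S (restrict (\<lambda>e. u e \<omega>) ?BA) \<longleftrightarrow>
      (\<forall>w\<in>?W. (\<forall>l\<in>{0..<n} - {j}. \<bar>\<Sum>i=0..<n. w i * A \<omega> i l\<bar> \<le> \<nu>) \<longleftrightarrow> w \<in> S)"
      using s by (intro ball_cong refl) (simp only: s cong: ball_cong)
    also have "\<dots> \<longleftrightarrow> near_null N N2 k \<nu> j \<omega> = S" unfolding near_null_def using that by blast
    finally show ?thesis .
  qed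
  have Ge: "?G w (restrict (\<lambda>e. u e \<omega>) ?BB) = (\<Sum>i=0..<n. w i * A \<omega> i j)" for w \<omega>
    by (intro sum.cong) auto
  let ?Fr = "\<lambda>S f. of_bool (?F S f) :: real"
  have Frm: "?Fr S \<in> borel_measurable (PiM ?BA (\<lambda>_. borel))" for S
    by (rule measurable_compose[OF Fm]) simp
  have ind: "indep_var borel (\<lambda>\<omega>. of_bool (near_null N N2 k \<nu> j \<omega> = S) :: real) borel (\<lambda>\<omega>. \<Sum>i=0..<n. w i * A \<omega> i j)"
    if S: "S \<subseteq> ?W" for S w
  proof -
    have "indep_var borel (\<lambda>\<omega>. ?Fr S (restrict (\<lambda>e. u e \<omega>) ?BA)) borel (\<lambda>\<omega>. ?G w (restrict (\<lambda>e. u e \<omega>) ?BB))"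
      by (rule indep_blocks[OF _ _ _ Frm Gm]) (use j in auto)
    then show ?thesis unfolding Fe[OF S] Ge .
  qed
  have X: "?X S \<in> events" if "S \<in> ?S" for S
  proof -
    have S: "S \<subseteq> ?W" using that by simp
    have [measurable]: "(\<lambda>\<omega>. of_bool (near_null N N2 k \<nu> j \<omega> = S) :: real) \<in> borel_measurable P"
      using indep_var_rv1[OF ind[OF S]] .
    have "{\<omega> \<in> space P. of_bool (near_null N N2 k \<nu> j \<omega> = S) = (1::real)} \<in> events" by measurable
    then show ?thesis by simp
  qed
  have Y: "?Y w \<in> events" for w
  proof -
    have [measurable]: "(\<lambda>\<omega>. \<Sum>i=0..<n. w i * A \<omega> i j) \<in> borel_measurable P"
      using indep_var_rv2[OF ind[of "{}" w]] by simp
    show ?thesis by measurable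
  qed
  have prod: "prob (?X S \<inter> ?Y w) = prob (?X S) * prob (?Y w)" if "S \<in> ?S" for S w
  proof -
    have S: "S \<subseteq> ?W" using that by simp
    let ?f = "\<lambda>\<omega>. of_bool (near_null N N2 k \<nu> j \<omega> = S) :: real" and ?g = "\<lambda>\<omega>. \<Sum>i=0..<n. w i * A \<omega> i j"
    have "prob ((\<lambda>\<omega>. (?f \<omega>, ?g \<omega>)) -` ({1} \<times> {y. \<bar>y\<bar> \<le> \<tau>}) \<inter> space P)
      = prob (?f -` {1} \<inter> space P) * prob (?g -` {y. \<bar>y\<bar> \<le> \<tau>} \<inter> space P)"
      by (rule indep_varD[OF ind[OF S]]) (simp, measurable)
    moreover have "(\<lambda>\<omega>. (?f \<omega>, ?g \<omega>)) -` ({1} \<times> {y. \<bar>y\<bar> \<le> \<tau>}) \<inter> space P = ?X S \<inter> ?Y w" by auto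
    moreover have "?f -` {1} \<inter> space P = ?X S" by auto
    moreover have "?g -` {y. \<bar>y\<bar> \<le> \<tau>} \<inter> space P = ?Y w" by auto
    ultimately show ?thesis by simp
  qed
  have LO: "prob (?Y w) * sqrt (real k) \<le> 384" if w: "w \<in> ?W" for w
  proof -
    let ?J = "(\<lambda>i. (i, j)) ` {i\<in>{0..<n}. 1 / (2 * real N) < \<bar>w i\<bar>}"
    let ?\<alpha> = "\<lambda>(i, l). w i * sqrt (a i l)"
    have lin: "lin ?BB ?\<alpha> \<omega> = (\<Sum>i=0..<n. w i * A \<omega> i j)" for \<omega>
    proof -
      have "?BB = (\<lambda>i. (i, j)) ` {0..<n}" by auto
      then show ?thesis unfolding lin_def by (simp add: sum.reindex inj_on_def mult.assoc)
    qed
    have "prob {\<omega> \<in> space P. \<bar>lin ?BB ?\<alpha> \<omega>\<bar> \<le> \<tau>} * sqrt (card ?J) \<le> 384"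
    proof (rule littlewood_offord[OF _ _ \<tau>(1)])
      fix e assume "e \<in> ?J"
      then obtain i where i: "e = (i, j)" "i < n" "1 / (2 * real N) < \<bar>w i\<bar>" by auto
      have "4 * \<tau> < (1 / (2 * real N)) * sqrt c" using \<tau>(2) by simp
      also have "\<dots> \<le> \<bar>w i\<bar> * sqrt (a i j)"
        using i(3) a[OF i(2) j] cpos by (intro mult_mono) auto
      also have "\<dots> = \<bar>?\<alpha> e\<bar>" using a_nonneg[OF i(2) j] by (simp add: i(1) abs_mult)
      finally show "4 * \<tau> < \<bar>?\<alpha> e\<bar>" .
    qed (use j in auto)
    moreover have "k \<le> card ?J"
      using w by (subst card_image) (auto simp: inj_on_def null_candidates_def)
    ultimately have "prob (?Y w) * sqrt (card ?J) \<le> 384" "sqrt k \<le> sqrt (card ?J)" by (simp_all add: lin)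
    then show ?thesis using mult_left_mono[of "sqrt k" "sqrt (card ?J)" "prob (?Y w)"] by simp
  qed
  have "near_null N N2 k \<nu> j \<omega> \<subseteq> ?W" for \<omega> unfolding near_null_def by (rule Collect_restrict)
  then have eq: "close_column N N2 k \<nu> \<tau> j = (\<Union>S\<in>?S. ?X S \<inter> ?Y (pick S))"
    unfolding close_column_def by auto
  show "close_column N N2 k \<nu> \<tau> j \<in> events"
    unfolding eq by (rule sets.finite_UN[OF finS]) (intro sets.Int X Y)
  have "prob (close_column N N2 k \<nu> \<tau> j) * sqrt (real k) \<le> (\<Sum>S\<in>?S. prob (?X S \<inter> ?Y (pick S))) * sqrt (real k)"
    unfolding eq
  proof (rule mult_right_mono[OF finite_measure_subadditive_finite[OF finS]])
    show "(\<lambda>S. ?X S \<inter> ?Y (pick S)) ` ?S \<subseteq> events" using X Y by (intro image_subsetI sets.Int)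
  qed simp
  also have "\<dots> = (\<Sum>S\<in>?S. prob (?X S) * (prob (?Y (pick S)) * sqrt (real k)))"
    using prod by (simp add: sum_distrib_right mult.assoc)
  also have "\<dots> \<le> (\<Sum>S\<in>?S. prob (?X S) * 384)"
  proof (intro sum_mono mult_left_mono LO)
    fix S assume S: "S \<in> ?S"
    then have "pick S \<in> S" by (metis DiffD2 insertI1 some_in_eq)
    then show "pick S \<in> ?W" using S by blast
  qed simp
  also have "\<dots> = prob (\<Union>S\<in>?S. ?X S) * 384"
    using X finS by (subst finite_measure_finite_Union) (auto simp: disjoint_family_on_def sum_distrib_right)
  also have "\<dots> \<le> 384" by simp
  finally show "prob (close_column N N2 k \<nu> \<tau> j) * sqrt (real k) \<le> 384" .
qed

text \<open>
  Suppose that \<open>x\<close> is an almost null vector. If column \<open>j\<close> is not close to the span of the others, pair \<open>A x\<close> with the normal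
  vector picked for \<open>j\<close>: all other columns nearly disappear, which forces \<open>x j\<close> to be small. So
  only few coordinates of \<open>x\<close> are large, and such vectors are excluded by the grid of rows.
\<close>

lemma no_almost_null_vector:
  assumes \<omega>: "\<omega> \<in> space P" and bnd: "\<omega> \<notin> entries_large q"
    and rows: "\<omega> \<notin> grid_bad n N k c {0..<n} Pair wt"
    and cols: "\<And>j. j < n \<Longrightarrow> \<omega> \<notin> grid_bad n N k c ({0..<n} - {j}) (\<lambda>l i. (i, l)) wt"
    and few: "card {j\<in>{0..<n}. \<omega> \<in> close_column N N2 k (real n * (q / real N2)) \<tau> j} \<le> k"
    and N: "2 \<le> N" "2 * N \<le> N2" and \<kappa>: "0 \<le> \<kappa>" and \<tau>: "0 < \<tau>"
    and par1: "\<kappa> + real n * (q / real N) < sqrt (c / 2)"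
    and par2: "real n * \<kappa> + real n * (real n * (q / real N2)) \<le> \<tau> / real N"
    and x: "sup_unit n x"
  shows "\<exists>i<n. \<kappa> < \<bar>\<Sum>j=0..<n. A \<omega> i j * x j\<bar>"
proof (rule ccontr)
  let ?\<nu> = "real n * (q / real N2)"
  assume nex: "\<not> ?thesis"
  have small: "\<bar>\<Sum>j=0..<n. x j * A \<omega> i j\<bar> \<le> \<kappa>" if "i < n" for i
  proof -
    have "\<not> \<kappa> < \<bar>\<Sum>j=0..<n. A \<omega> i j * x j\<bar>" using nex that by blast
    then show ?thesis by (simp add: mult.commute)
  qed
  have Aq: "\<bar>A \<omega> i j\<bar> \<le> q" if "i < n" "j < n" for i j
    using bnd that \<omega> unfolding entries_large_def by (auto simp: not_less)
  have xb: "\<bar>x j\<bar> \<le> 1" if "j < n" for j using x that unfolding sup_unit_def by auto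
  have far: "\<bar>x j\<bar> \<le> 1 / real N" if j: "j < n" and nc: "\<omega> \<notin> close_column N N2 k ?\<nu> \<tau> j" for j
  proof -
    obtain w where w: "sup_unit n w" "\<And>l. l < n \<Longrightarrow> l \<noteq> j \<Longrightarrow> (\<Sum>i=0..<n. w i * A \<omega> i l) = 0"
      using homogeneous_system_solution[OF j, of "\<lambda>i l. A \<omega> i l"] by blast
    have wb: "\<bar>w i\<bar> \<le> 1" if "i < n" for i using w(1) that unfolding sup_unit_def by auto
    have many: "k < card {i\<in>{0..<n}. 1 / real N < \<bar>w i\<bar>}"
    proof (rule ccontr)
      assume "\<not> ?thesis"
      then have "\<omega> \<in> grid_bad n N k c ({0..<n} - {j}) (\<lambda>l i. (i, l)) wt"
        using Aq w par1 cpos \<kappa>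
        by (intro sparse_approx_bad[OF \<omega> N(1) w(1), where q = q and \<kappa> = 0]) auto
      then show False using cols[OF j] by simp
    qed
    define v where "v = (\<lambda>i\<in>{0..<n}. grid_round N2 (w i))"
    have N2: "0 < N2" using N by simp
    have err: "\<bar>v i - w i\<bar> \<le> 1 / real N2" if "i < n" for i
      using grid_round_error[OF N2, of "w i"] that by (simp add: v_def abs_minus_commute)
    have "1 / (2 * real N) < \<bar>v i\<bar>" if i: "i < n" and big: "1 / real N < \<bar>w i\<bar>" for i
    proof -
      have "2 * real N \<le> real N2" using of_nat_mono[OF N(2), where 'a = real] by simp
      then have "1 / real N2 \<le> 1 / (2 * real N)" using N by (intro divide_left_mono) auto
      moreover have "1 / real N = 1 / (2 * real N) + 1 / (2 * real N)" using N by (simp add: field_simps)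
      ultimately show ?thesis using err[OF i] big by (smt (verit))
    qed
    then have "{i\<in>{0..<n}. 1 / real N < \<bar>w i\<bar>} \<subseteq> {i\<in>{0..<n}. 1 / (2 * real N) < \<bar>v i\<bar>}" by auto
    then have "card {i\<in>{0..<n}. 1 / real N < \<bar>w i\<bar>} \<le> card {i\<in>{0..<n}. 1 / (2 * real N) < \<bar>v i\<bar>}"
      by (intro card_mono) auto
    then have vW: "v \<in> null_candidates N N2 k"
      unfolding null_candidates_def using many grid_round_in[OF wb] by (auto simp: v_def)
    have "\<bar>\<Sum>i=0..<n. v i * A \<omega> i l\<bar> \<le> ?\<nu>" if l: "l < n" "l \<noteq> j" for l
    proof -
      have "(\<Sum>i=0..<n. v i * A \<omega> i l) = (\<Sum>i=0..<n. (v i - w i) * A \<omega> i l) + (\<Sum>i=0..<n. w i * A \<omega> i l)"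
        by (simp add: sum.distrib[symmetric] algebra_simps)
      then have "\<bar>\<Sum>i=0..<n. v i * A \<omega> i l\<bar> = \<bar>\<Sum>i=0..<n. (v i - w i) * A \<omega> i l\<bar>" using w(2)[OF l] by simp
      also have "\<dots> \<le> (\<Sum>i=0..<n. \<bar>(v i - w i) * A \<omega> i l\<bar>)" by (rule sum_abs)
      also have "\<dots> \<le> (\<Sum>i=0..<n. 1 / real N2 * q)"
        unfolding abs_mult[of "v _ - w _"] using err Aq[OF _ l(1)] by (intro sum_mono mult_mono) auto
      finally show ?thesis by simp
    qed
    then have "v \<in> near_null N N2 k ?\<nu> j \<omega>" using vW unfolding near_null_def by auto
    then have ne: "near_null N N2 k ?\<nu> j \<omega> \<noteq> {}" by blast
    define p where "p = pick (near_null N N2 k ?\<nu> j \<omega>)"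
    have p: "p \<in> near_null N N2 k ?\<nu> j \<omega>" unfolding p_def using ne by (simp add: some_in_eq)
    have pb: "\<bar>p i\<bar> \<le> 1" if i: "i < n" for i
    proof -
      have "p i \<in> grid N2" using p i unfolding near_null_def null_candidates_def by (auto simp: PiE_iff)
      then obtain z where "p i = real_of_int z / real N2" "z \<in> {- int N2..int N2}" unfolding grid_def by (rule imageE)
      then show ?thesis using N2 by (simp add: abs_le_iff)
    qed
    let ?s = "\<lambda>l. \<Sum>i=0..<n. p i * A \<omega> i l"
    have sj: "\<tau> < \<bar>?s j\<bar>" using nc ne \<omega> unfolding close_column_def p_def by auto
    have sl: "\<bar>?s l\<bar> \<le> ?\<nu>" if "l \<in> {0..<n} - {j}" for l using p that unfolding near_null_def by blast
    have "(\<Sum>i=0..<n. p i * (\<Sum>l=0..<n. x l * A \<omega> i l)) = (\<Sum>i=0..<n. \<Sum>l=0..<n. x l * (p i * A \<omega> i l))"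
      by (simp add: sum_distrib_left mult_ac)
    also have "\<dots> = (\<Sum>l=0..<n. \<Sum>i=0..<n. x l * (p i * A \<omega> i l))" by (rule sum.swap)
    also have "\<dots> = (\<Sum>l=0..<n. x l * ?s l)" by (simp add: sum_distrib_left)
    also have "\<dots> = x j * ?s j + (\<Sum>l\<in>{0..<n} - {j}. x l * ?s l)" using j by (subst sum.remove[of _ j]) auto
    finally have eq: "x j * ?s j = (\<Sum>i=0..<n. p i * (\<Sum>l=0..<n. x l * A \<omega> i l)) - (\<Sum>l\<in>{0..<n} - {j}. x l * ?s l)"
      by simp
    have b1: "\<bar>\<Sum>i=0..<n. p i * (\<Sum>l=0..<n. x l * A \<omega> i l)\<bar> \<le> real n * \<kappa>"
    proof -
      have "\<bar>\<Sum>i=0..<n. p i * (\<Sum>l=0..<n. x l * A \<omega> i l)\<bar> \<le> (\<Sum>i=0..<n. \<bar>p i * (\<Sum>l=0..<n. x l * A \<omega> i l)\<bar>)"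
        by (rule sum_abs)
      also have "\<dots> \<le> (\<Sum>i=0..<n. 1 * \<kappa>)"
        unfolding abs_mult[of "p _"] using pb small by (intro sum_mono mult_mono) auto
      finally show ?thesis by simp
    qed
    have b2: "\<bar>\<Sum>l\<in>{0..<n} - {j}. x l * ?s l\<bar> \<le> real n * ?\<nu>"
    proof -
      have \<nu>0: "0 \<le> ?\<nu>" using Aq[OF j j] by (intro mult_nonneg_nonneg divide_nonneg_nonneg) (auto intro: order.trans[OF abs_ge_zero])
      have "\<bar>\<Sum>l\<in>{0..<n} - {j}. x l * ?s l\<bar> \<le> (\<Sum>l\<in>{0..<n} - {j}. \<bar>x l * ?s l\<bar>)" by (rule sum_abs)
      also have "\<dots> \<le> (\<Sum>l\<in>{0..<n} - {j}. 1 * ?\<nu>)"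
        unfolding abs_mult[of "x _"] using xb sl by (intro sum_mono mult_mono) auto
      also have "\<dots> = real (card ({0..<n} - {j})) * ?\<nu>" by simp
      also have "\<dots> \<le> real n * ?\<nu>"
        using \<nu>0 card_mono[of "{0..<n}" "{0..<n} - {j}"] by (intro mult_right_mono) auto
      finally show ?thesis .
    qed
    have "\<bar>x j\<bar> * \<tau> \<le> \<bar>x j\<bar> * \<bar>?s j\<bar>" using sj by (intro mult_left_mono) auto
    also have "\<dots> = \<bar>x j * ?s j\<bar>" by (rule abs_mult[symmetric])
    also have "\<dots> \<le> real n * \<kappa> + real n * ?\<nu>" unfolding eq using b1 b2 by linarith
    also have "\<dots> \<le> \<tau> / real N" by (rule par2)
    also have "\<dots> = 1 / real N * \<tau>" by simp
    finally show ?thesis using \<tau> by (simp only: mult_le_cancel_right_pos)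
  qed
  have "{j\<in>{0..<n}. 1 / real N < \<bar>x j\<bar>} \<subseteq> {j\<in>{0..<n}. \<omega> \<in> close_column N N2 k ?\<nu> \<tau> j}"
    using far by force
  then have "card {j\<in>{0..<n}. 1 / real N < \<bar>x j\<bar>} \<le> card {j\<in>{0..<n}. \<omega> \<in> close_column N N2 k ?\<nu> \<tau> j}"
    by (intro card_mono) auto
  then have "card {j\<in>{0..<n}. 1 / real N < \<bar>x j\<bar>} \<le> k" using few by simp
  then have "\<omega> \<in> grid_bad n N k c {0..<n} Pair wt"
    using Aq small par1 cpos by (intro sparse_approx_bad[OF \<omega> N(1) x, where q = q and \<kappa> = \<kappa>]) auto
  then show False using rows by simp
qed

text \<open>
  The expected number of close columns is at most \<open>384 n / sqrt k\<close>, so by Markov's inequality there are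
  rarely as many as \<open>k\<close> of them. The remaining exceptional events are those of large entries and of
  sparse almost null vectors, of the matrix and of its transpose with one row removed.
\<close>

lemma invertible_with_high_probability:
  assumes N: "2 \<le> N" "2 * N \<le> N2" and \<kappa>: "0 \<le> \<kappa>" and \<tau>: "0 < \<tau>" "4 * \<tau> < sqrt c / (2 * real N)" and q: "0 < q"
    and par1: "\<kappa> + real n * (q / real N) < sqrt (c / 2)"
    and par2: "real n * \<kappa> + real n * (real n * (q / real N2)) \<le> \<tau> / real N" and k: "0 < k"
  shows "\<exists>G\<in>events. 1 - ((real n)\<^sup>2 * C / q\<^sup>2 + (real n + 1) * (real (n * (2 * N + 1)) ^ k * (11 / 12) ^ (n - 1))
        + 384 * real n / (real k * sqrt (real k))) \<le> prob G \<and>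
     (\<forall>\<omega>\<in>G. (\<forall>i<n. \<forall>j<n. \<bar>A \<omega> i j\<bar> \<le> q) \<and>
       (\<forall>x. sup_unit n x \<longrightarrow> (\<exists>i<n. \<kappa> < \<bar>\<Sum>j=0..<n. A \<omega> i j * x j\<bar>)))"
proof -
  let ?\<nu> = "real n * (q / real N2)"
  let ?cc = "\<lambda>j. close_column N N2 k ?\<nu> \<tau> j"
  define R where "R = grid_bad n N k c {0..<n} Pair wt"
  define K where "K j = grid_bad n N k c ({0..<n} - {j}) (\<lambda>l i. (i, l)) wt" for j
  define Z where "Z = {\<omega> \<in> space P. real k \<le> (\<Sum>j=0..<n. indicator (?cc j) \<omega>)}"
  define \<Gamma> where "\<Gamma> = real (n * (2 * N + 1)) ^ k * (11 / 12) ^ (n - 1)"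
  have wt2: "c \<le> (wt e)\<^sup>2" if e: "e \<in> {0..<n} \<times> {0..<n}" for e
  proof -
    obtain i j where ij: "e = (i, j)" by (cases e)
    then have "i < n" "j < n" using e by auto
    then show ?thesis unfolding ij using a[of i j] a_nonneg[of i j] by simp
  qed
  have R: "R \<in> events" "prob R \<le> \<Gamma>"
  proof -
    show "R \<in> events" unfolding R_def by (rule grid_bad_prob) (use wt2 cpos in auto)
    have "prob R \<le> real (n * (2 * N + 1)) ^ k * (11 / 12) ^ card {0..<n}"
      unfolding R_def by (rule grid_bad_prob) (use wt2 cpos in auto)
    also have "\<dots> \<le> \<Gamma>" unfolding \<Gamma>_def by (intro mult_left_mono power_decreasing) auto
    finally show "prob R \<le> \<Gamma>" .
  qed
  have K: "K j \<in> events" "prob (K j) \<le> \<Gamma>" if j: "j < n" for j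
  proof -
    show "K j \<in> events" unfolding K_def by (rule grid_bad_prob) (use wt2 cpos in auto)
    have "prob (K j) \<le> real (n * (2 * N + 1)) ^ k * (11 / 12) ^ card ({0..<n} - {j})"
      unfolding K_def by (rule grid_bad_prob) (use wt2 cpos in auto)
    also have "card ({0..<n} - {j}) = n - 1" using j by simp
    finally show "prob (K j) \<le> \<Gamma>" unfolding \<Gamma>_def .
  qed
  have cc: "?cc j \<in> events" "prob (?cc j) \<le> 384 / sqrt (real k)" if j: "j < n" for j
  proof -
    have N0: "0 < N" using N by simp
    show "?cc j \<in> events" by (rule close_column_prob(1)[OF j less_imp_le[OF \<tau>(1)] \<tau>(2) N0])
    have "prob (?cc j) * sqrt (real k) \<le> 384" by (rule close_column_prob(2)[OF j less_imp_le[OF \<tau>(1)] \<tau>(2) N0])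
    then show "prob (?cc j) \<le> 384 / sqrt (real k)" using k by (simp add: pos_le_divide_eq)
  qed
  have isum: "integrable P (\<lambda>\<omega>. \<Sum>j=0..<n. indicator (?cc j) \<omega> :: real)"
    using cc(1) by (intro Bochner_Integration.integrable_sum) (auto simp: integrable_indicator_iff emeasure_eq_measure)
  have Z: "Z \<in> events" "prob Z \<le> 384 * real n / (real k * sqrt (real k))"
  proof -
    show "Z \<in> events" unfolding Z_def using borel_measurable_integrable[OF isum] by measurable
    have "prob Z \<le> expectation (\<lambda>\<omega>. \<Sum>j=0..<n. indicator (?cc j) \<omega>) / real k"
      unfolding Z_def using integral_Markov_inequality_measure[OF isum sets.top, of "real k"] k
      by (simp add: sum_nonneg)
    also have "expectation (\<lambda>\<omega>. \<Sum>j=0..<n. indicator (?cc j) \<omega>) = (\<Sum>j=0..<n. prob (?cc j))"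
      using cc(1) by (subst Bochner_Integration.integral_sum) (auto simp: integrable_indicator_iff emeasure_eq_measure)
    also have "\<dots> \<le> (\<Sum>j=0..<n. 384 / sqrt (real k))" using cc(2) by (intro sum_mono) auto
    finally have "prob Z \<le> (\<Sum>j=0..<n. 384 / sqrt (real k)) / real k" using k by (simp add: divide_right_mono)
    then show "prob Z \<le> 384 * real n / (real k * sqrt (real k))" by (simp add: mult_ac)
  qed
  define B where "B = entries_large q \<union> R \<union> (\<Union>j\<in>{0..<n}. K j) \<union> Z"
  have UK: "(\<Union>j\<in>{0..<n}. K j) \<in> events" using K(1) by (intro sets.finite_UN) auto
  have Be: "B \<in> events" unfolding B_def using entries_large_prob(1)[OF q] R(1) UK Z(1) by auto
  have "prob B \<le> prob (entries_large q) + prob R + prob (\<Union>j\<in>{0..<n}. K j) + prob Z"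
  proof -
    have "prob B \<le> prob (entries_large q \<union> R \<union> (\<Union>j\<in>{0..<n}. K j)) + prob Z"
      unfolding B_def using entries_large_prob(1)[OF q] R(1) UK Z(1) by (intro measure_Un_le) auto
    also have "prob (entries_large q \<union> R \<union> (\<Union>j\<in>{0..<n}. K j)) \<le> prob (entries_large q \<union> R) + prob (\<Union>j\<in>{0..<n}. K j)"
      using entries_large_prob(1)[OF q] R(1) UK by (intro measure_Un_le) auto
    also have "prob (entries_large q \<union> R) \<le> prob (entries_large q) + prob R"
      using entries_large_prob(1)[OF q] R(1) by (intro measure_Un_le) auto
    finally show ?thesis by simp
  qed
  also have "prob (\<Union>j\<in>{0..<n}. K j) \<le> (\<Sum>j=0..<n. prob (K j))"
    using K(1) by (intro finite_measure_subadditive_finite) auto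
  also have "\<dots> \<le> (\<Sum>j=0..<n. \<Gamma>)" using K(2) by (intro sum_mono) auto
  finally have pB: "prob B \<le> (real n)\<^sup>2 * C / q\<^sup>2 + (real n + 1) * \<Gamma> + 384 * real n / (real k * sqrt (real k))"
    using entries_large_prob(2)[OF q] R(2) Z(2) by (simp add: algebra_simps)
  have good: "(\<forall>i<n. \<forall>j<n. \<bar>A \<omega> i j\<bar> \<le> q) \<and> (\<forall>x. sup_unit n x \<longrightarrow> (\<exists>i<n. \<kappa> < \<bar>\<Sum>j=0..<n. A \<omega> i j * x j\<bar>))"
    if \<omega>: "\<omega> \<in> space P - B" for \<omega>
  proof (intro conjI allI impI)
    have \<omega>P: "\<omega> \<in> space P" and el: "\<omega> \<notin> entries_large q" and nR: "\<omega> \<notin> R" and nK: "\<And>j. j < n \<Longrightarrow> \<omega> \<notin> K j" and nZ: "\<omega> \<notin> Z"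
      using \<omega> unfolding B_def by auto
    show "\<bar>A \<omega> i j\<bar> \<le> q" if "i < n" "j < n" for i j
      using el that \<omega>P unfolding entries_large_def by (auto simp: not_less)
    fix x assume x: "sup_unit n x"
    have "(\<Sum>j=0..<n. indicator (?cc j) \<omega> :: real) = real (card {j\<in>{0..<n}. \<omega> \<in> ?cc j})"
      by (simp add: indicator_def sum.If_cases Int_def)
    then have few: "card {j\<in>{0..<n}. \<omega> \<in> ?cc j} \<le> k" using nZ \<omega>P unfolding Z_def by simp
    show "\<exists>i<n. \<kappa> < \<bar>\<Sum>j=0..<n. A \<omega> i j * x j\<bar>"
      by (rule no_almost_null_vector[OF \<omega>P el nR[unfolded R_def] nK[unfolded K_def] few N \<kappa> \<tau>(1) par1 par2 x])
  qed
  have "prob (space P - B) = 1 - prob B" by (rule prob_compl[OF Be])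
  then show ?thesis
    using pB good Be unfolding \<Gamma>_def by (intro bexI[of _ "space P - B"]) auto
qed

end

section \<open>Concentration of the logarithm of the determinant\<close>

definition clip :: "real \<Rightarrow> real \<Rightarrow> real" where
  "clip K y = max (- K) (min K y)"

lemma abs_clip_le: "0 \<le> K \<Longrightarrow> \<bar>clip K y\<bar> \<le> K"
  unfolding clip_def by auto

lemma clip_eq: "\<bar>y\<bar> \<le> K \<Longrightarrow> clip K y = y"
  unfolding clip_def by auto

lemma clip_measurable [measurable]: "clip K \<in> borel_measurable borel"
  unfolding clip_def by measurable

lemma rdet_measurable:
  assumes "\<And>i j. i < n \<Longrightarrow> j < n \<Longrightarrow> (\<lambda>\<omega>. X \<omega> i j) \<in> borel_measurable M"
  shows "(\<lambda>\<omega>. rdet n (X \<omega>)) \<in> borel_measurable M"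
proof -
  have eq: "rdet n (X \<omega>) = (\<Sum>p | p permutes {0..<n}. signof p * (\<Prod>i=0..<n. X \<omega> i (p i)))" for \<omega>
    unfolding rdet_def by (subst det_def'[where n = n]) (auto intro!: sum.cong prod.cong simp: permutes_less)
  show ?thesis
    unfolding eq using assms permutes_less
    by (intro borel_measurable_sum borel_measurable_times borel_measurable_const borel_measurable_prod) auto
qed

lemma sup_det_measurable:
  assumes X: "\<And>i j. i < n \<Longrightarrow> j < n \<Longrightarrow> (\<lambda>\<omega>. X \<omega> i j) \<in> borel_measurable M"
  shows "(\<lambda>\<omega>. sup_det n K b (X \<omega>)) \<in> borel_measurable M"
proof -
  have "(\<lambda>\<omega>. sup_det_term n b (X \<omega>) T) \<in> borel_measurable M" for T
  proof -
    obtain I Q where T: "T = (I, Q)" by (cases T)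
    have "(\<lambda>\<omega>. rdet n (\<lambda>i. if i \<in> I then Q i else X \<omega> i)) \<in> borel_measurable M"
    proof (rule rdet_measurable)
      fix i j assume "i < n" "j < n"
      then show "(\<lambda>\<omega>. (if i \<in> I then Q i else X \<omega> i) j) \<in> borel_measurable M"
        using X by (cases "i \<in> I") simp_all
    qed
    then show ?thesis unfolding T sup_det_term_def prod.case
      by (intro borel_measurable_times borel_measurable_const borel_measurable_abs)
  qed
  then show ?thesis unfolding sup_det_def by (intro borel_measurable_Max finite_sup_det_terms)
qed

lemma ln_max_lipschitz:
  fixes X Y b d :: real
  assumes d: "0 < d" and b: "0 \<le> b" and XY: "X \<le> exp b * Y" "Y \<le> exp b * X"
  shows "\<bar>ln (max d X) - ln (max d Y)\<bar> \<le> b"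
proof -
  have *: "ln (max d X) \<le> b + ln (max d Y)" if "X \<le> exp b * Y" for X Y
  proof -
    have "d \<le> exp b * d" using mult_right_mono[of 1 "exp b" d] b d by simp
    also have "\<dots> \<le> exp b * max d Y" by (intro mult_left_mono) auto
    finally have "d \<le> exp b * max d Y" .
    moreover have "X \<le> exp b * max d Y" using that by (rule order.trans) (intro mult_left_mono, auto)
    ultimately have "max d X \<le> exp b * max d Y" by simp
    then have "ln (max d X) \<le> ln (exp b * max d Y)" using d by (subst ln_le_cancel_iff) auto
    also have "\<dots> = b + ln (max d Y)" using d by (subst ln_mult) auto
    finally show ?thesis .
  qed
  show ?thesis using *[OF XY(1)] *[OF XY(2)] by (simp add: abs_le_iff)
qed

context random_matrix
begin

text \<open>
  Clipping the entries makes the differences bounded on the whole space, and the floor \<open>d\<close> makes the logarithm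
  bounded.
\<close>

definition log_sup_det :: "real \<Rightarrow> real \<Rightarrow> real \<Rightarrow> 'a \<Rightarrow> real" where
  "log_sup_det K b d \<omega> = ln (max d (sup_det n K b (\<lambda>i j. clip K (A \<omega> i j))))"

text \<open>
  The bounded differences inequality is applied to the rows, of which there are \<open>n\<close>, rather than to the
  \<open>n\<^sup>2\<close> entries: the bound \<open>b\<close> for a row is no worse than the one for an entry.
\<close>

lemma log_sup_det_concentration:
  assumes K: "0 \<le> K" and b: "0 < b" and d: "0 < d"
  shows "\<exists>\<mu>. \<forall>r>0. prob {\<omega> \<in> space P. \<mu> + r \<le> log_sup_det K b d \<omega>} \<le> exp (- r\<^sup>2 / (2 * b\<^sup>2 * real n))
     \<and> prob {\<omega> \<in> space P. log_sup_det K b d \<omega> \<le> \<mu> - r} \<le> exp (- r\<^sup>2 / (2 * b\<^sup>2 * real n))"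
proof -
  define row where "row i = {i} \<times> {0..<n}" for i :: nat
  let ?B = "\<lambda>i. PiM (row i) (\<lambda>_. borel :: real measure)"
  let ?X = "\<lambda>i \<omega>. restrict (\<lambda>e. u e \<omega>) (row i)"
  let ?I = "{0..<n}"
  \<comment> \<open>A product of probability spaces needs one at every index, so the rows from \<open>n\<close> on repeat row 0.\<close>
  define h where "h i = (if i < n then i else 0)" for i
  have hn: "h i < n" for i using npos by (simp add: h_def)
  define R where "R i = distr P (?B (h i)) (?X (h i))" for i
  have ind: "indep_vars ?B ?X ?I"
    unfolding row_def by (rule indep_vars_restrict[OF indep]) (auto simp: disjoint_family_on_def)
  have rvX: "random_variable (?B i) (?X i)" if "i < n" for i
    using ind that unfolding indep_vars_def by auto
  have Rp: "prob_space (R i)" for i unfolding R_def by (rule prob_space_distr[OF rvX[OF hn]])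
  have "distr P (PiM ?I ?B) (\<lambda>\<omega>. \<lambda>i\<in>?I. ?X i \<omega>) = PiM ?I (\<lambda>i. distr P (?B i) (?X i))"
  proof (subst indep_vars_iff_distr_eq_PiM'[where I = ?I and X = ?X and M' = ?B, symmetric])
    show "?I \<noteq> {}" using npos by simp
    show "random_variable (?B i) (?X i)" if "i \<in> ?I" for i using that by (intro rvX) simp
  qed (rule ind)
  also have "\<dots> = PiM ?I R" by (rule PiM_cong) (auto simp: R_def h_def)
  finally have dist: "distr P (PiM ?I ?B) (\<lambda>\<omega>. \<lambda>i\<in>?I. ?X i \<omega>) = PiM ?I R" .
  have rvJ[measurable]: "(\<lambda>\<omega>. \<lambda>i\<in>?I. ?X i \<omega>) \<in> measurable P (PiM ?I ?B)"
  proof (rule measurable_restrict)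
    show "random_variable (?B i) (?X i)" if "i \<in> ?I" for i using that by (intro rvX) simp
  qed
  define Y where "Y x = (\<lambda>i j. clip K (sqrt (a i j) * x i (i, j)))" for x :: "nat \<Rightarrow> nat \<times> nat \<Rightarrow> real"
  define f where "f x = ln (max d (sup_det n K b (Y x)))" for x
  have setsR: "sets (PiM ?I R) = sets (PiM ?I ?B)"
    by (rule sets_PiM_cong) (auto simp: R_def h_def)
  have spaceR: "space (PiM ?I R) = space (PiM ?I ?B)" by (rule sets_eq_imp_space_eq[OF setsR])
  have fm: "f \<in> borel_measurable (PiM ?I ?B)"
  proof -
    have "(\<lambda>x. sup_det n K b (Y x)) \<in> borel_measurable (PiM ?I ?B)"
    proof (rule sup_det_measurable)
      fix i j assume i: "i < n" and j: "j < n"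
      have "(\<lambda>x. x i) \<in> measurable (PiM ?I ?B) (?B i)"
        using i by (intro measurable_component_singleton) simp
      moreover have "(\<lambda>y. y (i, j)) \<in> measurable (?B i) borel"
        using j by (intro measurable_component_singleton) (simp add: row_def)
      ultimately have "(\<lambda>x. x i (i, j)) \<in> borel_measurable (PiM ?I ?B)" by (rule measurable_compose)
      then show "(\<lambda>x. Y x i j) \<in> borel_measurable (PiM ?I ?B)" unfolding Y_def by measurable
    qed
    then show ?thesis unfolding f_def by (intro borel_measurable_ln borel_measurable_max borel_measurable_const)
  qed
  have fmR: "f \<in> borel_measurable (PiM ?I R)" using fm measurable_cong_sets[OF setsR refl] by blast
  have Yb: "\<bar>Y x i j\<bar> \<le> K" for x i j unfolding Y_def by (rule abs_clip_le[OF K])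
  define L where "L = \<bar>ln d\<bar> + \<bar>ln (max d ((real n * K) ^ n))\<bar>"
  have fb: "\<bar>f x\<bar> \<le> L" for x
  proof -
    have "sup_det n K b (Y x) \<le> (real n * K) ^ n" by (rule sup_det_bound[OF K less_imp_le[OF b] Yb])
    then have "f x \<le> ln (max d ((real n * K) ^ n))" unfolding f_def using d by (subst ln_le_cancel_iff) auto
    moreover have "ln d \<le> f x" unfolding f_def using d by (subst ln_le_cancel_iff) auto
    ultimately show ?thesis unfolding L_def by linarith
  qed
  have fl: "\<bar>f (x(i := y)) - f x\<bar> \<le> b" if i: "i \<in> ?I" for x i y
    unfolding f_def
  proof (rule ln_max_lipschitz[OF d less_imp_le[OF b]])
    have e: "Y (x(i := y)) k = Y x k" if "k \<noteq> i" for k using that by (simp add: Y_def)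
    show "sup_det n K b (Y (x(i := y))) \<le> exp b * sup_det n K b (Y x)"
      by (rule sup_det_row_lipschitz[of i]) (use i K b Yb e in auto)
    show "sup_det n K b (Y x) \<le> exp b * sup_det n K b (Y (x(i := y)))"
      by (rule sup_det_row_lipschitz[of i]) (use i K b Yb e[symmetric] in auto)
  qed
  have fX: "f (\<lambda>i\<in>?I. ?X i \<omega>) = log_sup_det K b d \<omega>" for \<omega>
  proof -
    have "Y (\<lambda>i\<in>?I. ?X i \<omega>) i j = clip K (A \<omega> i j)" if "i < n" "j < n" for i j
      using that by (simp add: Y_def row_def)
    then have "sup_det n K b (Y (\<lambda>i\<in>?I. ?X i \<omega>)) = sup_det n K b (\<lambda>i j. clip K (A \<omega> i j))"
      unfolding sup_det_def sup_det_term_def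
      by (intro arg_cong[where f = Max] image_cong refl) (auto intro!: arg_cong[where f = abs] rdet_cong)
    then show ?thesis unfolding f_def log_sup_det_def by simp
  qed
  have tr: "prob {\<omega> \<in> space P. Q (log_sup_det K b d \<omega>)} = measure (PiM ?I R) {x \<in> space (PiM ?I R). Q (f x)}"
    if Q: "{y. Q y} \<in> sets borel" for Q
  proof -
    have S: "{x \<in> space (PiM ?I ?B). Q (f x)} \<in> sets (PiM ?I ?B)"
    proof -
      have "f -` {y. Q y} \<inter> space (PiM ?I ?B) \<in> sets (PiM ?I ?B)" by (rule measurable_sets[OF fm Q])
      also have "f -` {y. Q y} \<inter> space (PiM ?I ?B) = {x \<in> space (PiM ?I ?B). Q (f x)}" by auto
      finally show ?thesis .
    qed
    have "measure (PiM ?I R) {x \<in> space (PiM ?I R). Q (f x)}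
      = prob ((\<lambda>\<omega>. \<lambda>i\<in>?I. ?X i \<omega>) -` {x \<in> space (PiM ?I ?B). Q (f x)} \<inter> space P)"
      unfolding spaceR unfolding dist[symmetric] by (rule measure_distr[OF rvJ S])
    also have "(\<lambda>\<omega>. \<lambda>i\<in>?I. ?X i \<omega>) -` {x \<in> space (PiM ?I ?B). Q (f x)} \<inter> space P = {\<omega> \<in> space P. Q (log_sup_det K b d \<omega>)}"
      using measurable_space[OF rvJ] by (auto simp: fX)
    finally show ?thesis ..
  qed
  define \<mu> where "\<mu> = (\<integral>x. f x \<partial>PiM ?I R)"
  show ?thesis
  proof (intro exI[of _ \<mu>] allI impI conjI)
    fix r :: real assume r: "0 < r"
    have "measure (PiM ?I R) {x \<in> space (PiM ?I R). (\<integral>x. f x \<partial>PiM ?I R) + r \<le> f x} \<le> exp (- r\<^sup>2 / (2 * b\<^sup>2 * card ?I))"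
    proof (rule mcdiarmid)
      show "\<bar>f x\<bar> \<le> L" for x by (rule fb)
      show "\<bar>f (x(i := y)) - f x\<bar> \<le> b" if "i \<in> ?I" for x i y by (rule fl[OF that])
    qed (use Rp fmR b r npos in simp_all)
    then show "prob {\<omega> \<in> space P. \<mu> + r \<le> log_sup_det K b d \<omega>} \<le> exp (- r\<^sup>2 / (2 * b\<^sup>2 * real n))"
      using tr[of "\<lambda>y. \<mu> + r \<le> y"] by (simp add: \<mu>_def)
    have mfm: "(\<lambda>x. - f x) \<in> borel_measurable (PiM ?I R)" using fmR by simp
    have "measure (PiM ?I R) {x \<in> space (PiM ?I R). (\<integral>x. - f x \<partial>PiM ?I R) + r \<le> - f x} \<le> exp (- r\<^sup>2 / (2 * b\<^sup>2 * card ?I))"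
    proof (rule mcdiarmid)
      show "\<bar>- f x\<bar> \<le> L" for x using fb by simp
      show "\<bar>- f (x(i := y)) - - f x\<bar> \<le> b" if "i \<in> ?I" for x i y
        using fl[OF that, of x y] by (simp only: minus_diff_minus abs_minus_cancel)
    qed (use Rp mfm b r npos in simp_all)
    also have "{x \<in> space (PiM ?I R). (\<integral>x. - f x \<partial>PiM ?I R) + r \<le> - f x} = {x \<in> space (PiM ?I R). f x \<le> \<mu> - r}"
      by (auto simp: \<mu>_def)
    finally show "prob {\<omega> \<in> space P. log_sup_det K b d \<omega> \<le> \<mu> - r} \<le> exp (- r\<^sup>2 / (2 * b\<^sup>2 * real n))"
      using tr[of "\<lambda>y. y \<le> \<mu> - r"] by simp
  qed
qed

text \<open>
  On the event \<open>D \<ge> per / 2\<close>, and without large entries, the concentrated function is at least \<open>ln (per / 2) / 2\<close>. This event is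
  more likely than the upper tail, so the centre \<open>\<mu>\<close> is at least \<open>ln (per / 2) / 2 - r\<close>. On \<open>G\<close> the function equals
  \<open>ln \<bar>det A\<bar>\<close>, and the lower tail loses another \<open>r\<close>. Only the crude bound for large entries has to be
  compared with the small probability of anticoncentration; \<open>\<epsilon>\<close> may be much larger.
\<close>

lemma det_lower_tail:
  assumes G: "G \<in> events" "1 - \<epsilon> \<le> prob G"
    and Gq: "\<And>\<omega> i j. \<omega> \<in> G \<Longrightarrow> i < n \<Longrightarrow> j < n \<Longrightarrow> \<bar>A \<omega> i j\<bar> \<le> K"
    and Ginv: "\<And>\<omega> x. \<omega> \<in> G \<Longrightarrow> sup_unit n x \<Longrightarrow> \<exists>i<n. \<kappa> < \<bar>\<Sum>j=0..<n. A \<omega> i j * x j\<bar>"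
    and K: "0 < K" and \<kappa>: "0 < \<kappa>" and b: "0 < b" "real n * (real n * K / \<kappa>) \<le> exp b" and r: "0 < r"
    and gap: "(real n)\<^sup>2 * C / K\<^sup>2 + exp (- r\<^sup>2 / (2 * b\<^sup>2 * real n)) < exp (- (2 * (C / c)\<^sup>2 * (1 + ln (real n)))) / 12"
  shows "1 - (\<epsilon> + exp (- r\<^sup>2 / (2 * b\<^sup>2 * real n))) \<le> prob {\<omega> \<in> space P. exp (- (4 * r)) * (per / 2) \<le> (rdet n (A \<omega>))\<^sup>2}"
proof -
  define \<eta> where "\<eta> = exp (- r\<^sup>2 / (2 * b\<^sup>2 * real n))"
  \<comment> \<open>A lower bound for \<open>\<bar>det A\<bar>\<close> on \<open>G\<close>, so that the floor does not matter there.\<close>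
  define d where "d = (\<kappa> / real n) ^ n"
  have d: "0 < d" using \<kappa> npos by (simp add: d_def)
  let ?L = "log_sup_det K b d"
  obtain \<mu> where \<mu>: "prob {\<omega> \<in> space P. \<mu> + r \<le> ?L \<omega>} \<le> \<eta>" "prob {\<omega> \<in> space P. ?L \<omega> \<le> \<mu> - r} \<le> \<eta>"
    using log_sup_det_concentration[OF less_imp_le[OF K] b(1) d] r unfolding \<eta>_def by blast
  have Lm[measurable]: "?L \<in> borel_measurable P"
    unfolding log_sup_det_def
  proof (intro borel_measurable_ln borel_measurable_max borel_measurable_const sup_det_measurable)
    fix i j assume ij: "i < n" "j < n"
    have [measurable]: "u (i, j) \<in> borel_measurable P" by (rule rv) (use ij in simp)
    show "(\<lambda>\<omega>. clip K (A \<omega> i j)) \<in> borel_measurable P" by measurable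
  qed
  have unclip: "sup_det n K b (\<lambda>i j. clip K (A \<omega> i j)) = sup_det n K b (A \<omega>)"
    if "\<And>i j. i < n \<Longrightarrow> j < n \<Longrightarrow> \<bar>A \<omega> i j\<bar> \<le> K" for \<omega>
  proof -
    have "rdet n (\<lambda>i. if i \<in> I then Q i else (\<lambda>j. clip K (A \<omega> i j))) = rdet n (\<lambda>i. if i \<in> I then Q i else A \<omega> i)" for I Q
      by (rule rdet_cong) (use clip_eq that in auto)
    then show ?thesis unfolding sup_det_def sup_det_term_def by simp
  qed
  have onG: "?L \<omega> = ln \<bar>rdet n (A \<omega>)\<bar> \<and> 0 < \<bar>rdet n (A \<omega>)\<bar>" if \<omega>: "\<omega> \<in> G" for \<omega>
  proof -
    have inj: "\<exists>i<n. \<kappa> < \<bar>\<Sum>j=0..<n. A \<omega> i j * y j\<bar>" if "sup_unit n y" for y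
      by (rule Ginv[OF \<omega> that])
    have "sup_det n K b (\<lambda>i j. clip K (A \<omega> i j)) = sup_det n K b (A \<omega>)"
      by (rule unclip) (rule Gq[OF \<omega>])
    also have "\<dots> = \<bar>rdet n (A \<omega>)\<bar>" by (rule sup_det_eq[OF inj \<kappa> less_imp_le[OF K] b(2)])
    finally have s: "sup_det n K b (\<lambda>i j. clip K (A \<omega> i j)) = \<bar>rdet n (A \<omega>)\<bar>" .
    have "1 \<le> (real n / \<kappa>) ^ n * \<bar>rdet n (A \<omega>)\<bar>"
      by (rule rdet_row_replacement(2)[OF inj \<kappa>, where I = "{}" and Q = "\<lambda>_ _. 0" and K = 0]) auto
    then have "d * 1 \<le> d * ((real n / \<kappa>) ^ n * \<bar>rdet n (A \<omega>)\<bar>)" using d by (intro mult_left_mono) auto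
    also have "\<dots> = \<bar>rdet n (A \<omega>)\<bar>" using \<kappa> npos by (simp add: d_def mult.assoc[symmetric] power_mult_distrib[symmetric])
    finally have "d \<le> \<bar>rdet n (A \<omega>)\<bar>" by simp
    then show ?thesis using d unfolding log_sup_det_def s by (simp add: max_absorb2)
  qed
  have half: "0 < per / 2" using per_pos by simp
  have comp: "prob (space P - G) \<le> \<epsilon>" using prob_compl[OF G(1)] G(2) by simp
  have ln2: "ln ((rdet n (A \<omega>))\<^sup>2) = 2 * ?L \<omega>" if "\<omega> \<in> G" for \<omega>
    using onG[OF that] ln_realpow[of "\<bar>rdet n (A \<omega>)\<bar>" 2] by simp
  have mu: "ln (per / 2) < 2 * (\<mu> + r)"
  proof (rule ccontr)
    assume "\<not> ?thesis"
    then have m: "2 * (\<mu> + r) \<le> ln (per / 2)" by simp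
    have "{\<omega> \<in> space P. per / 2 \<le> (rdet n (A \<omega>))\<^sup>2} \<subseteq> entries_large K \<union> {\<omega> \<in> space P. \<mu> + r \<le> ?L \<omega>}"
    proof
      fix \<omega> assume h: "\<omega> \<in> {\<omega> \<in> space P. per / 2 \<le> (rdet n (A \<omega>))\<^sup>2}"
      show "\<omega> \<in> entries_large K \<union> {\<omega> \<in> space P. \<mu> + r \<le> ?L \<omega>}"
      proof (cases "\<omega> \<in> entries_large K")
        case False
        have hp: "per / 2 \<le> (rdet n (A \<omega>))\<^sup>2" using h by blast
        have "0 < (rdet n (A \<omega>))\<^sup>2" using half hp by (rule less_le_trans)
        then have p: "0 < \<bar>rdet n (A \<omega>)\<bar>" by simp
        have "\<bar>A \<omega> i j\<bar> \<le> K" if "i < n" "j < n" for i j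
          using False that h unfolding entries_large_def by (auto simp: not_less)
        then have "\<bar>rdet n (A \<omega>)\<bar> \<le> sup_det n K b (\<lambda>i j. clip K (A \<omega> i j))"
          by (subst unclip) (use abs_rdet_le_sup_det in auto)
        then have lL: "ln \<bar>rdet n (A \<omega>)\<bar> \<le> ?L \<omega>"
          unfolding log_sup_det_def using p by (subst ln_le_cancel_iff) auto
        have "ln (per / 2) \<le> ln ((rdet n (A \<omega>))\<^sup>2)"
          using hp half \<open>0 < (rdet n (A \<omega>))\<^sup>2\<close> by (subst ln_le_cancel_iff) assumption+
        also have "\<dots> = 2 * ln \<bar>rdet n (A \<omega>)\<bar>" using ln_realpow[of "\<bar>rdet n (A \<omega>)\<bar>" 2] by simp
        finally have "2 * (\<mu> + r) \<le> 2 * ln \<bar>rdet n (A \<omega>)\<bar>" by (rule order.trans[OF m])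
        then have "\<mu> + r \<le> ln \<bar>rdet n (A \<omega>)\<bar>" by simp
        then have "\<mu> + r \<le> ?L \<omega>" using lL by (rule order.trans)
        then show ?thesis using h by blast
      qed blast
    qed
    then have "prob {\<omega> \<in> space P. per / 2 \<le> (rdet n (A \<omega>))\<^sup>2} \<le> prob (entries_large K \<union> {\<omega> \<in> space P. \<mu> + r \<le> ?L \<omega>})"
      using entries_large_prob(1)[OF K] by (intro finite_measure_mono) auto
    also have "\<dots> \<le> prob (entries_large K) + prob {\<omega> \<in> space P. \<mu> + r \<le> ?L \<omega>}"
      using entries_large_prob(1)[OF K] by (intro measure_Un_le) auto
    also have "\<dots> \<le> (real n)\<^sup>2 * C / K\<^sup>2 + \<eta>" using entries_large_prob(2)[OF K] \<mu>(1) by linarith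
    finally have "exp (- (2 * (C / c)\<^sup>2 * (1 + ln (real n)))) / 12 \<le> (real n)\<^sup>2 * C / K\<^sup>2 + \<eta>"
      by (rule order.trans[OF det_anticoncentration])
    from leD[OF this] gap show False unfolding \<eta>_def by (rule notE)
  qed
  have "space P - ((space P - G) \<union> {\<omega> \<in> space P. ?L \<omega> \<le> \<mu> - r}) \<subseteq> {\<omega> \<in> space P. exp (- (4 * r)) * (per / 2) \<le> (rdet n (A \<omega>))\<^sup>2}"
  proof
    fix \<omega> assume "\<omega> \<in> space P - ((space P - G) \<union> {\<omega> \<in> space P. ?L \<omega> \<le> \<mu> - r})"
    then have \<omega>: "\<omega> \<in> space P" "\<omega> \<in> G" "\<not> ?L \<omega> \<le> \<mu> - r" by blast+
    have pos: "0 < (rdet n (A \<omega>))\<^sup>2" using onG[OF \<omega>(2)] by simp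
    have "l - 4 * r \<le> 2 * ?L \<omega>" if "l < 2 * (\<mu> + r)" for l using that \<omega>(3) unfolding distrib_left by linarith
    from this[OF mu] have "ln (per / 2) - 4 * r \<le> 2 * ?L \<omega>" .
    then have "exp (ln (per / 2) - 4 * r) \<le> exp (ln ((rdet n (A \<omega>))\<^sup>2))" unfolding ln2[OF \<omega>(2)] by simp
    also have "\<dots> = (rdet n (A \<omega>))\<^sup>2" by (rule exp_ln[OF pos])
    also have "exp (ln (per / 2) - 4 * r) = exp (- (4 * r)) * (per / 2)"
      unfolding diff_conv_add_uminus exp_add exp_ln[OF half] by (simp add: mult.commute)
    finally show "\<omega> \<in> {\<omega> \<in> space P. exp (- (4 * r)) * (per / 2) \<le> (rdet n (A \<omega>))\<^sup>2}" using \<omega>(1) by blast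
  qed
  then have "prob (space P - ((space P - G) \<union> {\<omega> \<in> space P. ?L \<omega> \<le> \<mu> - r}))
      \<le> prob {\<omega> \<in> space P. exp (- (4 * r)) * (per / 2) \<le> (rdet n (A \<omega>))\<^sup>2}"
    by (intro finite_measure_mono) auto
  moreover have "prob (space P - ((space P - G) \<union> {\<omega> \<in> space P. ?L \<omega> \<le> \<mu> - r}))
      = 1 - prob ((space P - G) \<union> {\<omega> \<in> space P. ?L \<omega> \<le> \<mu> - r})"
    using G(1) by (intro prob_compl) auto
  moreover have "prob ((space P - G) \<union> {\<omega> \<in> space P. ?L \<omega> \<le> \<mu> - r}) \<le> \<epsilon> + \<eta>"
    using measure_Un_le[of "space P - G" P "{\<omega> \<in> space P. ?L \<omega> \<le> \<mu> - r}"] G(1) comp \<mu>(2) by simp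
  ultimately show ?thesis unfolding \<eta>_def by linarith
qed

lemma det_upper_tail:
  "1 - exp (- g) \<le> prob {\<omega> \<in> space P. (rdet n (A \<omega>))\<^sup>2 \<le> exp g * per}"
proof -
  have pos: "0 < exp g * per" using per_pos by simp
  have "prob {\<omega> \<in> space P. exp g * per \<le> (rdet n (A \<omega>))\<^sup>2} \<le> expectation (\<lambda>\<omega>. (rdet n (A \<omega>))\<^sup>2) / (exp g * per)"
    using integral_Markov_inequality_measure[OF det_second_moment(1) sets.top, of "exp g * per"] pos by simp
  also have "\<dots> = exp (- g)" unfolding det_second_moment(2) using per_pos by (simp add: exp_minus field_simps)
  finally have 1: "prob {\<omega> \<in> space P. exp g * per \<le> (rdet n (A \<omega>))\<^sup>2} \<le> exp (- g)" .
  have "prob (space P - {\<omega> \<in> space P. exp g * per \<le> (rdet n (A \<omega>))\<^sup>2}) = 1 - prob {\<omega> \<in> space P. exp g * per \<le> (rdet n (A \<omega>))\<^sup>2}"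
    by (rule prob_compl) measurable
  moreover have "prob (space P - {\<omega> \<in> space P. exp g * per \<le> (rdet n (A \<omega>))\<^sup>2}) \<le> prob {\<omega> \<in> space P. (rdet n (A \<omega>))\<^sup>2 \<le> exp g * per}"
    by (intro finite_measure_mono) (auto, measurable)
  ultimately show ?thesis using 1 by linarith
qed

end

section \<open>The sign law and the Gaussian law\<close>

definition normalized_law :: "real measure \<Rightarrow> bool" where
  "normalized_law L \<longleftrightarrow> integrable L (\<lambda>x. x ^ 4) \<and> integral\<^sup>L L (\<lambda>x. x) = 0
     \<and> integral\<^sup>L L (\<lambda>x. x\<^sup>2) = 1 \<and> integral\<^sup>L L (\<lambda>x. x ^ 4) \<le> 3 \<and> sets L = sets borel"

lemma normalized_bernoulli: "normalized_law bernoulli_sign_law"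
proof -
  let ?p = "pmf_of_set {-1, 1 :: real}"
  have i: "integrable bernoulli_sign_law f" if "f \<in> borel_measurable borel" for f :: "real \<Rightarrow> real"
  proof -
    have "integrable bernoulli_sign_law f \<longleftrightarrow> integrable (measure_pmf ?p) (\<lambda>x. f x)"
      unfolding bernoulli_sign_law_def by (rule integrable_distr_eq) (use that in simp_all)
    moreover have "integrable (measure_pmf ?p) (\<lambda>x. f x)" by (rule integrable_measure_pmf_finite) simp
    ultimately show ?thesis by blast
  qed
  have e: "integral\<^sup>L bernoulli_sign_law f = (f (-1) + f 1) / 2" if "f \<in> borel_measurable borel" for f :: "real \<Rightarrow> real"
  proof -
    have "integral\<^sup>L bernoulli_sign_law f = (\<integral>x. f x \<partial>measure_pmf ?p)"
      unfolding bernoulli_sign_law_def by (rule integral_distr) (use that in simp_all)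
    also have "\<dots> = (f (-1) + f 1) / 2" by (subst integral_pmf_of_set) simp_all
    finally show ?thesis .
  qed
  show ?thesis
    unfolding normalized_law_def
  proof (intro conjI)
    show "integrable bernoulli_sign_law (\<lambda>x. x ^ 4)" by (rule i) simp
    show "integral\<^sup>L bernoulli_sign_law (\<lambda>x. x) = 0" by (subst e) simp_all
    show "integral\<^sup>L bernoulli_sign_law (\<lambda>x. x\<^sup>2) = 1" by (subst e) simp_all
    show "integral\<^sup>L bernoulli_sign_law (\<lambda>x. x ^ 4) \<le> 3" by (subst e) simp_all
    show "sets bernoulli_sign_law = sets borel" by (simp add: bernoulli_sign_law_def)
  qed
qed

lemma normalized_gaussian: "normalized_law std_gaussian_law"
proof -
  have i: "integrable std_gaussian_law (\<lambda>x. x ^ k)" for k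
    unfolding std_gaussian_law_def
    by (subst integrable_density) (auto simp: integrable_std_normal_moment)
  have e: "integral\<^sup>L std_gaussian_law (\<lambda>x. x ^ k) = (\<integral>x. std_normal_density x * x ^ k \<partial>lborel)" for k
    unfolding std_gaussian_law_def by (subst integral_density) auto
  have "integral\<^sup>L std_gaussian_law (\<lambda>x. x ^ 1) = 0"
    unfolding e using integral_std_normal_moment_odd[of 0] by simp
  moreover have "integral\<^sup>L std_gaussian_law (\<lambda>x. x ^ 2) = 1"
    unfolding e using integral_std_normal_moment_even[of 1] by simp
  moreover have "integral\<^sup>L std_gaussian_law (\<lambda>x. x ^ 4) = 3"
    unfolding e using integral_std_normal_moment_even[of 2] by (simp add: fact_numeral)
  ultimately show ?thesis using i[of 4] unfolding normalized_law_def by (simp add: std_gaussian_law_def)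
qed

lemma iid_entries_standardized:
  assumes L: "normalized_law L" and iid: "iid_entries P L n u"
  shows "standardized P u ({0..<n} \<times> {0..<n})"
proof -
  interpret prob_space P using iid unfolding iid_entries_def by blast
  have ind: "indep_vars (\<lambda>_. borel) u ({0..<n} \<times> {0..<n})" and d: "\<And>e. e \<in> {0..<n} \<times> {0..<n} \<Longrightarrow> distr P borel (u e) = L"
    using iid unfolding iid_entries_def by auto
  have rv: "u e \<in> borel_measurable P" if "e \<in> {0..<n} \<times> {0..<n}" for e
    using ind that unfolding indep_vars_def by blast
  have e: "expectation (\<lambda>\<omega>. f (u e \<omega>)) = integral\<^sup>L L f" "integrable P (\<lambda>\<omega>. f (u e \<omega>)) \<longleftrightarrow> integrable L f"
    if "e \<in> {0..<n} \<times> {0..<n}" "f \<in> borel_measurable borel" for e and f :: "real \<Rightarrow> real"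
    using integral_distr[OF rv[OF that(1)] that(2)] integrable_distr_eq[OF rv[OF that(1)] that(2)]
    unfolding d[OF that(1)] by auto
  show ?thesis
  proof
    show "integrable P (\<lambda>\<omega>. u e \<omega> ^ 4)" if "e \<in> {0..<n} \<times> {0..<n}" for e
      using e(2)[OF that, of "\<lambda>x. x ^ 4"] L unfolding normalized_law_def by simp
    show "expectation (u e) = 0" if "e \<in> {0..<n} \<times> {0..<n}" for e
      using e(1)[OF that, of "\<lambda>x. x"] L unfolding normalized_law_def by simp
    show "expectation (\<lambda>\<omega>. (u e \<omega>)\<^sup>2) = 1" if "e \<in> {0..<n} \<times> {0..<n}" for e
      using e(1)[OF that, of "\<lambda>x. x\<^sup>2"] L unfolding normalized_law_def by simp
    show "expectation (\<lambda>\<omega>. u e \<omega> ^ 4) \<le> 3" if "e \<in> {0..<n} \<times> {0..<n}" for e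
      using e(1)[OF that, of "\<lambda>x. x ^ 4"] L unfolding normalized_law_def by simp
  qed (use ind in auto)
qed

section \<open>Choice of the parameters\<close>

text \<open>
  The scale exceeds every power of \<open>n\<close>, while its logarithm is so small that \<open>row_cost * sqrt n\<close> is
  of smaller order than \<open>deviation\<close>, and \<open>sparsity * ln scale\<close> of smaller order than \<open>n\<close>.
  The row cost is chosen with \<open>exp row_cost = n\<^sup>2 scale^7\<close>, as \<open>sup_det_eq\<close> demands.
\<close>

definition scale :: "nat \<Rightarrow> real" where "scale n = exp (real n powr (1/10))"
definition fine_mesh :: "nat \<Rightarrow> nat" where "fine_mesh n = nat \<lceil>scale n ^ 2\<rceil>"
definition finer_mesh :: "nat \<Rightarrow> nat" where "finer_mesh n = nat \<lceil>scale n ^ 7\<rceil>"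
definition sparsity :: "nat \<Rightarrow> nat" where "sparsity n = nat \<lceil>real n powr (4/5)\<rceil>"
definition row_cost :: "nat \<Rightarrow> real" where "row_cost n = 2 * ln (real n) + 7 * real n powr (1/10)"
definition deviation :: "nat \<Rightarrow> real" where "deviation n = real n powr (13/20)"

definition singular_error :: "real \<Rightarrow> nat \<Rightarrow> real" where
  "singular_error C n = (real n)\<^sup>2 * C / (scale n)\<^sup>2
     + (real n + 1) * (real (n * (2 * fine_mesh n + 1)) ^ sparsity n * (11 / 12) ^ (n - 1))
     + 384 * real n / (real (sparsity n) * sqrt (real (sparsity n)))"

definition concentration_error :: "nat \<Rightarrow> real" where
  "concentration_error n = exp (- (deviation n)\<^sup>2 / (2 * (row_cost n)\<^sup>2 * real n))"

lemma scale_ge_1: "1 \<le> scale n" unfolding scale_def by simp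

lemma mesh_bounds:
  "scale n ^ 2 \<le> real (fine_mesh n)" "real (fine_mesh n) \<le> scale n ^ 2 + 1" "scale n ^ 7 \<le> real (finer_mesh n)"
  unfolding fine_mesh_def finer_mesh_def using scale_ge_1[of n] by (simp_all add: of_nat_nat ceiling_le_iff)

lemma sparsity_bounds: "real n powr (4/5) \<le> real (sparsity n)" "real (sparsity n) \<le> real n powr (4/5) + 1"
proof -
  have "0 \<le> \<lceil>real n powr (4/5)\<rceil>" using powr_ge_zero[of "real n" "4/5"] by linarith
  then have "real (sparsity n) = of_int \<lceil>real n powr (4/5)\<rceil>" unfolding sparsity_def by simp
  then show "real n powr (4/5) \<le> real (sparsity n)" "real (sparsity n) \<le> real n powr (4/5) + 1" by linarith+
qed

lemma eventually_parameters:
  fixes c :: real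
  assumes c: "0 < c"
  shows "eventually (\<lambda>n. 2 \<le> fine_mesh n \<and> 2 * fine_mesh n \<le> finer_mesh n
      \<and> 4 * (1 / scale n ^ 3) < sqrt c / (2 * real (fine_mesh n))
      \<and> 1 / scale n ^ 6 + real n * (scale n / real (fine_mesh n)) < sqrt (c / 2)
      \<and> real n * (1 / scale n ^ 6) + real n * (real n * (scale n / real (finer_mesh n))) \<le> 1 / scale n ^ 3 / real (fine_mesh n)
      \<and> 0 < sparsity n) sequentially"
proof -
  have s: "scale = (\<lambda>n. exp (real n powr (1/10)))" by (rule ext) (simp add: scale_def)
  have "((\<lambda>n. 8 * (scale n ^ 2 + 1) / scale n ^ 3) \<longlongrightarrow> 0) sequentially" unfolding s by real_asymp
  then have e1: "eventually (\<lambda>n. 8 * (scale n ^ 2 + 1) / scale n ^ 3 < sqrt c) sequentially"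
    by (rule order_tendstoD) (use c in simp)
  have "((\<lambda>n. 1 / scale n ^ 6 + real n * (scale n / scale n ^ 2)) \<longlongrightarrow> 0) sequentially" unfolding s by real_asymp
  then have e2: "eventually (\<lambda>n. 1 / scale n ^ 6 + real n * (scale n / scale n ^ 2) < sqrt (c / 2)) sequentially"
    by (rule order_tendstoD) (use c in simp)
  have e3: "eventually (\<lambda>n. (real n * (1 / scale n ^ 6) + real n * (real n * (scale n / scale n ^ 7))) * (scale n ^ 3 * (scale n ^ 2 + 1)) \<le> 1) sequentially"
    unfolding s by real_asymp
  have e4: "eventually (\<lambda>n. 2 \<le> scale n ^ 2) sequentially" unfolding s by real_asymp
  have e5: "eventually (\<lambda>n. 2 * (scale n ^ 2 + 1) \<le> scale n ^ 7) sequentially" unfolding s by real_asymp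
  have e6: "eventually (\<lambda>n. 0 < real n powr (4/5)) sequentially" by real_asymp
  show ?thesis
    using e1 e2 e3 e4 e5 e6
  proof eventually_elim
    case (elim n)
    let ?q = "scale n" and ?N = "real (fine_mesh n)" and ?N2 = "real (finer_mesh n)"
    have q: "0 < ?q" using scale_ge_1[of n] by linarith
    have N: "?q ^ 2 \<le> ?N" "?N \<le> ?q ^ 2 + 1" and N2: "?q ^ 7 \<le> ?N2" by (rule mesh_bounds)+
    have N0: "0 < ?N" using N(1) q by (smt (verit) zero_less_power)
    have N20: "0 < ?N2" using N2 q by (smt (verit) zero_less_power)
    show ?case
    proof (intro conjI)
      have "2 \<le> ?N" using N(1) elim(4) by linarith
      then show "2 \<le> fine_mesh n" by simp
      have "2 * ?N \<le> ?N2" using N(2) N2 elim(5) unfolding distrib_left by linarith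
      then show "2 * fine_mesh n \<le> finer_mesh n" by (simp flip: of_nat_le_iff)
      have "8 * ?N / ?q ^ 3 \<le> 8 * (?q ^ 2 + 1) / ?q ^ 3" using N(2) q by (intro divide_right_mono mult_left_mono) auto
      then have "8 * ?N / ?q ^ 3 < sqrt c" using elim(1) by linarith
      then show "4 * (1 / ?q ^ 3) < sqrt c / (2 * ?N)" using N0 q by (simp add: field_simps)
      have "real n * (?q / ?N) \<le> real n * (?q / ?q ^ 2)" using N(1) q N0 by (intro mult_left_mono divide_left_mono) auto
      then show "1 / ?q ^ 6 + real n * (?q / ?N) < sqrt (c / 2)" using elim(2) by linarith
      let ?S = "real n * (1 / ?q ^ 6) + real n * (real n * (?q / ?q ^ 7))"
      have S0: "0 \<le> ?S" using q by (intro add_nonneg_nonneg mult_nonneg_nonneg divide_nonneg_nonneg) auto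
      have "real n * (1 / ?q ^ 6) + real n * (real n * (?q / ?N2)) \<le> ?S"
        using N2 q N20 by (intro add_left_mono mult_left_mono divide_left_mono) auto
      also have "?S \<le> 1 / ?q ^ 3 / ?N"
      proof -
        have "?S * (?q ^ 3 * ?N) \<le> ?S * (?q ^ 3 * (?q ^ 2 + 1))" using S0 N(2) q by (intro mult_left_mono) auto
        also have "\<dots> \<le> 1" by (rule elim(3))
        finally have "?S * (?q ^ 3 * ?N) \<le> 1" .
        then have "?S \<le> 1 / (?q ^ 3 * ?N)" using q N0 by (subst pos_le_divide_eq) auto
        then show ?thesis by simp
      qed
      finally show "real n * (1 / ?q ^ 6) + real n * (real n * (?q / ?N2)) \<le> 1 / ?q ^ 3 / ?N" .
      have "0 < real (sparsity n)" using elim(6) sparsity_bounds(1)[of n] by linarith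
      then show "0 < sparsity n" by simp
    qed
  qed
qed

lemma concentration_error_tendsto: "(concentration_error \<longlongrightarrow> 0) sequentially"
  unfolding concentration_error_def deviation_def row_cost_def by real_asymp

text \<open>
  The grid has \<open>exp (O(n^(9/10)))\<close> points, against a gain of \<open>(11/12)^(n-1)\<close>; the last summand is of order
  \<open>n / sparsity^(3/2) = n^(-1/5)\<close>.
\<close>

lemma singular_error_tendsto: "(singular_error C \<longlongrightarrow> 0) sequentially"
proof -
  have t1: "((\<lambda>n. (real n)\<^sup>2 * C / (scale n)\<^sup>2) \<longlongrightarrow> 0) sequentially"
  proof -
    have "((\<lambda>n. (real n)\<^sup>2 / (scale n)\<^sup>2) \<longlongrightarrow> 0) sequentially" unfolding scale_def by real_asymp
    from tendsto_mult_right[OF this, of C] show ?thesis by (simp add: mult.commute)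
  qed
  have t2: "((\<lambda>n. (real n + 1) * (real (n * (2 * fine_mesh n + 1)) ^ sparsity n * (11 / 12) ^ (n - 1))) \<longlongrightarrow> 0) sequentially"
  proof (rule tendsto_sandwich[OF _ _ tendsto_const])
    let ?l = "\<lambda>n. ln (real n * (2 * exp (2 * real n powr (1/10)) + 3))"
    let ?U = "\<lambda>n. (real n + 1) * exp ((real n powr (4/5) + 1) * ?l n - (real n - 1) / 12)"
    show "(?U \<longlongrightarrow> 0) sequentially" by real_asymp
    show "eventually (\<lambda>n. 0 \<le> (real n + 1) * (real (n * (2 * fine_mesh n + 1)) ^ sparsity n * (11 / 12) ^ (n - 1))) sequentially"
      by (rule always_eventually) simp
    show "eventually (\<lambda>n. (real n + 1) * (real (n * (2 * fine_mesh n + 1)) ^ sparsity n * (11 / 12) ^ (n - 1)) \<le> ?U n) sequentially"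
      using eventually_gt_at_top[of 0]
    proof eventually_elim
      case (elim n)
      let ?X = "real n * (2 * exp (2 * real n powr (1/10)) + 3)"
      have sq: "scale n ^ 2 = exp (2 * real n powr (1/10))"
        unfolding scale_def by (simp add: exp_double)
      have "1 * 3 \<le> real n * (2 * exp (2 * real n powr (1/10)) + 3)"
        using elim by (intro mult_mono) auto
      then have X: "1 \<le> ?X" by simp
      have "real (n * (2 * fine_mesh n + 1)) = real n * (2 * real (fine_mesh n) + 1)" by (simp add: algebra_simps)
      also have "\<dots> \<le> ?X" using mesh_bounds(2)[of n] unfolding sq by (intro mult_left_mono) auto
      finally have "real (n * (2 * fine_mesh n + 1)) ^ sparsity n \<le> ?X ^ sparsity n" by (intro power_mono) auto
      also have "\<dots> = ?X powr real (sparsity n)" using X by (subst powr_realpow) auto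
      also have "\<dots> \<le> ?X powr (real n powr (4/5) + 1)" using X sparsity_bounds(2) by (intro powr_mono) auto
      also have "\<dots> = exp ((real n powr (4/5) + 1) * ?l n)"
      proof -
        have "?X \<noteq> 0" using X by linarith
        then show ?thesis by (subst powr_def) (simp only: if_False)
      qed
      finally have A: "real (n * (2 * fine_mesh n + 1)) ^ sparsity n \<le> exp ((real n powr (4/5) + 1) * ?l n)" .
      have "(11 / 12 :: real) \<le> exp (- (1 / 12))" using exp_ge_add_one_self[of "- (1 / 12)"] by simp
      then have "(11 / 12 :: real) ^ (n - 1) \<le> exp (- (1 / 12)) ^ (n - 1)" by (intro power_mono) auto
      also have "\<dots> = exp (- ((real n - 1) / 12))"
        using elim by (simp add: exp_of_nat_mult[symmetric] of_nat_diff)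
      finally have B: "(11 / 12 :: real) ^ (n - 1) \<le> exp (- ((real n - 1) / 12))" .
      have "real (n * (2 * fine_mesh n + 1)) ^ sparsity n * (11 / 12) ^ (n - 1)
         \<le> exp ((real n powr (4/5) + 1) * ?l n) * exp (- ((real n - 1) / 12))"
        by (intro mult_mono A B) auto
      also have "\<dots> = exp ((real n powr (4/5) + 1) * ?l n - (real n - 1) / 12)" by (simp add: exp_add[symmetric])
      finally show ?case by (intro mult_left_mono) auto
    qed
  qed
  have t3: "((\<lambda>n. 384 * real n / (real (sparsity n) * sqrt (real (sparsity n)))) \<longlongrightarrow> 0) sequentially"
  proof (rule tendsto_sandwich[OF _ _ tendsto_const])
    let ?U = "\<lambda>n. 384 * real n / (real n powr (4/5) * sqrt (real n powr (4/5)))"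
    show "(?U \<longlongrightarrow> 0) sequentially" by real_asymp
    show "eventually (\<lambda>n. 0 \<le> 384 * real n / (real (sparsity n) * sqrt (real (sparsity n)))) sequentially"
      by (rule always_eventually) simp
    show "eventually (\<lambda>n. 384 * real n / (real (sparsity n) * sqrt (real (sparsity n))) \<le> ?U n) sequentially"
      using eventually_gt_at_top[of 0]
    proof eventually_elim
      case (elim n)
      have p: "0 < real n powr (4/5)" using elim by simp
      then have p': "0 < real (sparsity n)" using sparsity_bounds(1)[of n] by linarith
      show ?case using p p' sparsity_bounds(1)[of n]
        by (intro divide_left_mono mult_mono real_sqrt_le_mono mult_pos_pos) auto
    qed
  qed
  have "((\<lambda>n. (real n)\<^sup>2 * C / (scale n)\<^sup>2
     + (real n + 1) * (real (n * (2 * fine_mesh n + 1)) ^ sparsity n * (11 / 12) ^ (n - 1))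
     + 384 * real n / (real (sparsity n) * sqrt (real (sparsity n)))) \<longlongrightarrow> 0 + 0 + 0) sequentially"
    by (intro tendsto_add t1 t2 t3)
  then show ?thesis unfolding singular_error_def by simp
qed

text \<open>
  The left-hand side decays faster than any power of \<open>n\<close>, the right-hand side is a power.
\<close>

lemma eventually_gap:
  fixes C K :: real
  shows "eventually (\<lambda>n. (real n)\<^sup>2 * C / (scale n)\<^sup>2 + concentration_error n < exp (- (K * (1 + ln (real n)))) / 12) sequentially"
proof -
  have t1: "((\<lambda>n. (real n)\<^sup>2 / (scale n)\<^sup>2 * exp (K * (1 + ln (real n)))) \<longlongrightarrow> 0) sequentially"
    unfolding scale_def by real_asymp
  have t2: "((\<lambda>n. concentration_error n * exp (K * (1 + ln (real n)))) \<longlongrightarrow> 0) sequentially"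
    unfolding concentration_error_def deviation_def row_cost_def by real_asymp
  have "((\<lambda>n. C * ((real n)\<^sup>2 / (scale n)\<^sup>2 * exp (K * (1 + ln (real n)))) + concentration_error n * exp (K * (1 + ln (real n)))) \<longlongrightarrow> C * 0 + 0) sequentially"
    by (intro tendsto_intros t1 t2)
  then have "eventually (\<lambda>n. C * ((real n)\<^sup>2 / (scale n)\<^sup>2 * exp (K * (1 + ln (real n)))) + concentration_error n * exp (K * (1 + ln (real n))) < 1 / 12) sequentially"
    by (rule order_tendstoD) simp
  then show ?thesis
  proof eventually_elim
    case (elim n)
    let ?e = "exp (K * (1 + ln (real n)))"
    have "((real n)\<^sup>2 * C / (scale n)\<^sup>2 + concentration_error n) * ?e < 1 / 12"
      using elim by (simp add: algebra_simps)
    then have "(real n)\<^sup>2 * C / (scale n)\<^sup>2 + concentration_error n < 1 / 12 / ?e"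
      by (subst pos_less_divide_eq) auto
    also have "1 / 12 / ?e = exp (- (K * (1 + ln (real n)))) / 12" by (simp add: exp_minus inverse_eq_divide mult.commute)
    finally show ?case .
  qed
qed

section \<open>Concentration of the estimator\<close>

lemma estimator_tail_bound:
  assumes L: "normalized_law L" and iid: "iid_entries P L n u" and n: "0 < n"
    and c: "0 < c" and M: "M \<in> carrier_mat n n"
    and a: "\<And>i j. i < n \<Longrightarrow> j < n \<Longrightarrow> c \<le> M $$ (i, j) \<and> M $$ (i, j) \<le> C"
    and par: "2 \<le> fine_mesh n" "2 * fine_mesh n \<le> finer_mesh n"
      "4 * (1 / scale n ^ 3) < sqrt c / (2 * real (fine_mesh n))"
      "1 / scale n ^ 6 + real n * (scale n / real (fine_mesh n)) < sqrt (c / 2)"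
      "real n * (1 / scale n ^ 6) + real n * (real n * (scale n / real (finer_mesh n))) \<le> 1 / scale n ^ 3 / real (fine_mesh n)"
      "0 < sparsity n"
    and gap: "(real n)\<^sup>2 * C / (scale n)\<^sup>2 + concentration_error n < exp (- (2 * (C / c)\<^sup>2 * (1 + ln (real n)))) / 12"
    and g: "4 * deviation n + ln 2 \<le> g"
  shows "1 - (singular_error C n + concentration_error n + exp (- g)) \<le>
    measure P {\<omega> \<in> space P. exp (- g) * permanent M \<le> determinant_estimator M u \<omega>
      \<and> determinant_estimator M u \<omega> \<le> exp g * permanent M}"
proof -
  interpret standardized P u "{0..<n} \<times> {0..<n}" by (rule iid_entries_standardized[OF L iid])
  interpret random_matrix P u n "\<lambda>i j. M $$ (i, j)" c C
    by unfold_locales (use n c a in auto)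
  have D: "determinant_estimator M u \<omega> = (rdet n (A \<omega>))\<^sup>2" for \<omega>
    using M unfolding determinant_estimator_def estimator_matrix_def rdet_def by simp
  have pM: "permanent M = per" using M unfolding permanent_def per_def weight_def by simp
  have q: "0 < scale n" using scale_ge_1[of n] by linarith
  have k6: "0 < 1 / scale n ^ 6" and k3: "0 < 1 / scale n ^ 3" using q by auto
  obtain G where G: "G \<in> events" "1 - singular_error C n \<le> prob G"
    "\<forall>\<omega>\<in>G. (\<forall>i<n. \<forall>j<n. \<bar>A \<omega> i j\<bar> \<le> scale n) \<and> (\<forall>x. sup_unit n x \<longrightarrow> (\<exists>i<n. 1 / scale n ^ 6 < \<bar>\<Sum>j=0..<n. A \<omega> i j * x j\<bar>))"
    using invertible_with_high_probability[OF par(1,2) less_imp_le[OF k6] k3 par(3) q par(4,5,6)]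
    unfolding singular_error_def by auto
  have b: "0 < row_cost n" unfolding row_cost_def using n by (intro add_nonneg_pos mult_nonneg_nonneg mult_pos_pos) auto
  have eb: "real n * (real n * scale n / (1 / scale n ^ 6)) \<le> exp (row_cost n)"
  proof -
    have "exp (row_cost n) = exp (ln (real n)) ^ 2 * scale n ^ 7"
      unfolding row_cost_def scale_def exp_add by (simp add: exp_of_nat_mult[symmetric])
    also have "\<dots> = real n * (real n * scale n / (1 / scale n ^ 6))"
      using n by (simp add: power2_eq_square eval_nat_numeral)
    finally show ?thesis by simp
  qed
  have r: "0 < deviation n" using n unfolding deviation_def by simp
  have low: "1 - (singular_error C n + concentration_error n)
      \<le> prob {\<omega> \<in> space P. exp (- (4 * deviation n)) * (per / 2) \<le> (rdet n (A \<omega>))\<^sup>2}"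
    unfolding concentration_error_def
    by (rule det_lower_tail[OF G(1,2) _ _ q k6 b eb r gap[unfolded concentration_error_def]]) (use G(3) in auto)
  also have "\<dots> \<le> prob {\<omega> \<in> space P. exp (- g) * per \<le> (rdet n (A \<omega>))\<^sup>2}"
  proof (rule finite_measure_mono)
    have "exp (- g) \<le> exp (- (4 * deviation n) - ln 2)" using g by simp
    also have "\<dots> = exp (- (4 * deviation n)) / 2" by (simp add: exp_diff)
    finally have "exp (- g) * per \<le> exp (- (4 * deviation n)) / 2 * per"
      using per_pos by (intro mult_right_mono) auto
    then have le: "exp (- g) * per \<le> exp (- (4 * deviation n)) * (per / 2)" by simp
    show "{\<omega> \<in> space P. exp (- (4 * deviation n)) * (per / 2) \<le> (rdet n (A \<omega>))\<^sup>2}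
        \<subseteq> {\<omega> \<in> space P. exp (- g) * per \<le> (rdet n (A \<omega>))\<^sup>2}"
    proof (rule Collect_mono, rule impI, elim conjE, rule conjI)
      fix \<omega> assume "exp (- (4 * deviation n)) * (per / 2) \<le> (rdet n (A \<omega>))\<^sup>2"
      then show "exp (- g) * per \<le> (rdet n (A \<omega>))\<^sup>2" by (rule order.trans[OF le])
    qed
  qed measurable
  finally have low: "1 - (singular_error C n + concentration_error n) \<le> prob {\<omega> \<in> space P. exp (- g) * per \<le> (rdet n (A \<omega>))\<^sup>2}" .
  let ?L = "{\<omega> \<in> space P. exp (- g) * per \<le> (rdet n (A \<omega>))\<^sup>2}" and ?U = "{\<omega> \<in> space P. (rdet n (A \<omega>))\<^sup>2 \<le> exp g * per}"
  have LU: "?L \<in> events" "?U \<in> events" by measurable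
  have "prob (space P - ?L) + prob (space P - ?U) \<le> singular_error C n + concentration_error n + exp (- g)"
    using low det_upper_tail[of g] prob_compl[OF LU(1)] prob_compl[OF LU(2)] by linarith
  then have "prob ((space P - ?L) \<union> (space P - ?U)) \<le> singular_error C n + concentration_error n + exp (- g)"
    using measure_Un_le[of "space P - ?L" P "space P - ?U"] LU by auto
  moreover have "prob (space P - ((space P - ?L) \<union> (space P - ?U))) = 1 - prob ((space P - ?L) \<union> (space P - ?U))"
    using LU by (intro prob_compl) auto
  moreover have "space P - ((space P - ?L) \<union> (space P - ?U))
      = {\<omega> \<in> space P. exp (- g) * per \<le> (rdet n (A \<omega>))\<^sup>2 \<and> (rdet n (A \<omega>))\<^sup>2 \<le> exp g * per}" by auto
  ultimately show ?thesis unfolding D pM by simp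
qed

lemma estimator_concentration:
  assumes L: "normalized_law L" and c: "0 < c"
    and M: "\<And>n. M n \<in> carrier_mat n n"
    and a: "\<And>n i j. i < n \<Longrightarrow> j < n \<Longrightarrow> c \<le> M n $$ (i, j) \<and> M n $$ (i, j) \<le> C"
    and D: "\<And>n. \<exists>u. iid_entries (P n) L n u \<and> D n = determinant_estimator (M n) u"
  shows "(\<lambda>n. measure (P n)
            {\<omega> \<in> space (P n).
              exp (- (real n powr (2/3) * ln (real n))) * permanent (M n) \<le> D n \<omega> \<and>
              D n \<omega> \<le> exp (real n powr (2/3) * ln (real n)) * permanent (M n)})
         \<longlonglongrightarrow> 1"
proof (rule tendsto_sandwich)
  let ?g = "\<lambda>n. real n powr (2/3) * ln (real n)"
  let ?e = "\<lambda>n. singular_error C n + concentration_error n + exp (- ?g n)"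
  have "((\<lambda>n. exp (- ?g n)) \<longlongrightarrow> 0) sequentially" by real_asymp
  then have "((\<lambda>n. 1 - ?e n) \<longlongrightarrow> 1 - (0 + 0 + 0)) sequentially"
    by (intro tendsto_diff tendsto_add tendsto_const singular_error_tendsto concentration_error_tendsto)
  then show "((\<lambda>n. 1 - ?e n) \<longlongrightarrow> 1) sequentially" by simp
  have g: "eventually (\<lambda>n. 4 * deviation n + ln 2 \<le> ?g n) sequentially"
    unfolding deviation_def by real_asymp
  show "eventually (\<lambda>n. 1 - ?e n \<le> measure (P n)
            {\<omega> \<in> space (P n). exp (- ?g n) * permanent (M n) \<le> D n \<omega> \<and> D n \<omega> \<le> exp (?g n) * permanent (M n)}) sequentially"
    using eventually_parameters[OF c] eventually_gap[of C "2 * (C / c)\<^sup>2"] g eventually_gt_at_top[of 0]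
  proof eventually_elim
    case (elim n)
    obtain u where u: "iid_entries (P n) L n u" "D n = determinant_estimator (M n) u" using D by blast
    show ?case unfolding u(2)
      by (rule estimator_tail_bound[OF L u(1) elim(4) c M a]) (use elim in auto)
  qed
  show "eventually (\<lambda>n. measure (P n)
            {\<omega> \<in> space (P n). exp (- ?g n) * permanent (M n) \<le> D n \<omega> \<and> D n \<omega> \<le> exp (?g n) * permanent (M n)} \<le> 1) sequentially"
  proof (rule always_eventually, rule allI)
    fix n
    obtain u where "iid_entries (P n) L n u" using D by blast
    then interpret prob_space "P n" unfolding iid_entries_def by blast
    show "measure (P n) {\<omega> \<in> space (P n). exp (- ?g n) * permanent (M n) \<le> D n \<omega> \<and> D n \<omega> \<le> exp (?g n) * permanent (M n)} \<le> 1"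
      by (rule prob_le_1)
  qed
qed simp

theorem theorem2p1:
  fixes c C :: real
    and M :: "nat \<Rightarrow> real mat"
    and P :: "nat \<Rightarrow> 'a measure"
    and D :: "nat \<Rightarrow> 'a \<Rightarrow> real"
  assumes "0 < c" and "c \<le> C"
    and "\<And>n. M n \<in> carrier_mat n n"
    and "\<And>n i j. i < n \<Longrightarrow> j < n \<Longrightarrow> c \<le> M n $$ (i, j) \<and> M n $$ (i, j) \<le> C"
    and "(\<forall>n. godsil_gutman_estimator (P n) (M n) (D n)) \<or>
         (\<forall>n. barvinok_estimator (P n) (M n) (D n))"
  shows "(\<lambda>n. measure (P n)
            {\<omega> \<in> space (P n).
              exp (- (real n powr (2/3) * ln (real n))) * permanent (M n) \<le> D n \<omega> \<and>
              D n \<omega> \<le> exp (real n powr (2/3) * ln (real n)) * permanent (M n)})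
         \<longlonglongrightarrow> 1"
proof -
  have dim: "dim_row (M n) = n" for n using assms(3) by auto
  from assms(5) show ?thesis
  proof
    assume "\<forall>n. godsil_gutman_estimator (P n) (M n) (D n)"
    then have "\<exists>u. iid_entries (P n) bernoulli_sign_law n u \<and> D n = determinant_estimator (M n) u" for n
      unfolding godsil_gutman_estimator_def dim by blast
    then show ?thesis using assms(4)
      by (intro estimator_concentration[OF normalized_bernoulli assms(1,3)]) auto
  next
    assume "\<forall>n. barvinok_estimator (P n) (M n) (D n)"
    then have "\<exists>u. iid_entries (P n) std_gaussian_law n u \<and> D n = determinant_estimator (M n) u" for n
      unfolding barvinok_estimator_def dim by blast
    then show ?thesis using assms(4)
      by (intro estimator_concentration[OF normalized_gaussian assms(1,3)]) auto
  qed
qed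

end
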